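(* Let $\mathcal H$ be a real Hilbert space, let $z\in\mathcal H$, let $m\geq 1$ be an integer, let $f\in\Gamma_0(\mathcal H)$, and let $h\colon\mathcal H\to\mathbb R$ be convex and differentiable with a $\mu$-Lipschitzian gradient for some $\mu\in\,]0,+\infty[$. For every $i\in\{1,\ldots,m\}$, let $\mathcal G_i$ be a real Hilbert space, let $r_i\in\mathcal G_i$, let $g_i\in\Gamma_0(\mathcal G_i)$, let $\ell_i\in\Gamma_0(\mathcal G_i)$ be $1/\nu_i$-strongly convex for some $\nu_i\in\,]0,+\infty[$, and let $L_i\colon\mathcal H\to\mathcal G_i$ be a nonzero bounded linear operator. Consider the problem $$\text{(P)}\quad\underset{x\in\mathcal H}{\text{minimize}}\ \ f(x)+\sum_{i=1}^m(g_i\,\square\,\ell_i)(L_ix-r_i)+h(x)-\langle x\mid z\rangle,$$ and the dual problem $$\text{(D)}\quad\underset{v_1\in\mathcal G_1,\ldots,v_m\in\mathcal G_m}{\text{minimize}}\ \ (f^*\,\square\,h^* )\Big(z-\sum_{i=1}^m L_i^*v_i\Big)+\sum_{i=1}^m\big(g_i^*(v_i)+\ell_i^*(v_i)+\langle v_i\mid r_i\rangle\big).$$ Suppose that $$z\in\operatorname{ran}\Big(\partial f+\sum_{i=1}^m L_i^*(\partial g_i\,\square\,\partial\ell_i)(L_i\cdot-r_i)+\nabla h\Big).$$ Let $(a_{1,n})_{n\in\mathbb N}$, $(b_{1,n})_{n\in\mathbb N}$, and $(c_{1,n})_{n\in\mathbb N}$ be absolutely summable sequences in $\mathcal H$ and,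 for every $i\in\{1,\ldots,m\}$, let $(a_{2,i,n})_{n\in\mathbb N}$, $(b_{2,i,n})_{n\in\mathbb N}$, and $(c_{2,i,n})_{n\in\mathbb N}$ be absolutely summable sequences in $\mathcal G_i$. Set $$\beta=\max\{\mu,\nu_1,\ldots,\nu_m\}+\sqrt{\sum_{i=1}^m\|L_i\|^2},$$ let $x_0\in\mathcal H$, let $(v_{1,0},\ldots,v_{m,0})\in\mathcal G_1\oplus\cdots\oplus\mathcal G_m$, let $\varepsilon\in\,]0,1/(\beta+1)[$, let $(\gamma_n)_{n\in\mathbb N}$ be a sequence in $[\varepsilon,(1-\varepsilon)/\beta]$, and define recursively, for every $n\in\mathbb N$, $$\begin{aligned} y_{1,n}&=x_n-\gamma_n\Big(\nabla h(x_n)+\sum_{i=1}^m L_i^*v_{i,n}+a_{1,n}\Big),\\ p_{1,n}&=\operatorname{prox}_{\gamma_n f}(y_{1,n}+\gamma_n z)+b_{1,n},\\ &\text{for } i=1,\ldots,m:\\ &\quad y_{2,i,n}=v_{i,n}+\gamma_n\big(L_ix_n-\nabla\ell_i^*(v_{i,n})+a_{2,i,n}\big),\\ &\quad p_{2,i,n}=\operatorname{prox}_{\gamma_n g_i^*}(y_{2,i,n}-\gamma_n r_i)+b_{2,i,n},\\ &\quad q_{2,i,n}=p_{2,i,n}+\gamma_n\big(L_ip_{1,n}-\nabla\ell_i^*(p_{2,i,n})+c_{2,i,n}\big),\\ &\quad v_{i,n+1}=v_{i,n}-y_{2,i,n}+q_{2,i,n},\\ q_{1,n}&=p_{1,n}-\gamma_n\Big(\nabla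 h(p_{1,n})+\sum_{i=1}^m L_i^*p_{2,i,n}+c_{1,n}\Big),\\ x_{n+1}&=x_n-y_{1,n}+q_{1,n}. \end{aligned}$$ Then the following hold. (i) $\sum_{n\in\mathbb N}\|x_n-p_{1,n}\|^2<+\infty$ and, for every $i\in\{1,\ldots,m\}$, $\sum_{n\in\mathbb N}\|v_{i,n}-p_{2,i,n}\|^2<+\infty$. (ii) There exist a solution $\overline{x}$ to (P) and a solution $(\overline{v_1},\ldots,\overline{v_m})$ to (D) such that the following hold. (a) $z-\sum_{j=1}^m L_j^*\overline{v_j}\in\partial f(\overline{x})+\nabla h(\overline{x})$ and, for every $i\in\{1,\ldots,m\}$, $L_i\overline{x}-r_i\in\partial g_i^*(\overline{v_i})+\nabla\ell_i^*(\overline{v_i})$. (b) $x_n\rightharpoonup\overline{x}$ and $p_{1,n}\rightharpoonup\overline{x}$. (c) For every $i\in\{1,\ldots,m\}$, $v_{i,n}\rightharpoonup\overline{v_i}$ and $p_{2,i,n}\rightharpoonup\overline{v_i}$. (d) Suppose that $f$ or $h$ is uniformly convex at $\overline{x}$. Then $x_n\to\overline{x}$ and $p_{1,n}\to\overline{x}$. (e) Suppose that, for some $i\in\{1,\ldots,m\}$, $g_i^*$ or $\ell_i^*$ is uniformly convex at $\overline{v_i}$. Then $v_{i,n}\to\overline{v_i}$ and $p_{2,i,n}\to\overline{v_i}$.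
   Context: Notation: $\rightharpoonup$ and $\to$ denote weak and strong convergence. $\mathcal G_1\oplus\cdots\oplus\mathcal G_m$ is the Hilbert direct sum (product space with norm $\sqrt{\sum_i\|y_i\|^2}$). A sequence $(a_n)$ is absolutely summable if $\sum_n\|a_n\|<+\infty$. $L_i^*$ is the adjoint of $L_i$. A solution to a minimization problem is a global minimizer. Let $\mathcal K$ be a real Hilbert space. $\Gamma_0(\mathcal K)$ is the class of lower semicontinuous convex functions $\varphi\colon\mathcal K\to\,]-\infty,+\infty]$ with $\operatorname{dom}\varphi=\{x\in\mathcal K:\varphi(x)<+\infty\}\neq\varnothing$. For $\varphi\in\Gamma_0(\mathcal K)$: the conjugate is $\varphi^*(u)=\sup_{x\in\mathcal K}(\langle x\mid u\rangle-\varphi(x))$; the subdifferential is $\partial\varphi(x)=\{u\in\mathcal K: (\forall y\in\mathcal K)\ \langle y-x\mid u\rangle+\varphi(x)\leq\varphi(y)\}$; $\operatorname{prox}_\varphi x$ is the unique minimizer of $\varphi+\|x-\cdot\|^2/2$. $\varphi$ is $\nu$-strongly convex if $\varphi-\nu\|\cdot\|^2/2$ is convex. (If $\ell_i\in\Gamma_0(\mathcal G_i)$ is $1/\nu_i$-strongly convex, then $\ell_i^*$ is Fréchet differentiable on $\mathcal G_i$ with a $\nu_i$-Lipschitzian gradient $\nabla\ell_i^*$.) $\varphi$ is uniformly convex at $x\in\operatorname{dom}\varphi$ if there exists an increasing function $\phi\colon[0,+\infty[\,\to[0,+\infty]$ that vanishes only at $0$ such that, for all $y\in\operatorname{dom}\varphi$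 and all $\alpha\in\,]0,1[$, $\varphi(\alpha x+(1-\alpha)y)+\alpha(1-\alpha)\phi(\|x-y\|)\leq\alpha\varphi(x)+(1-\alpha)\varphi(y)$. The infimal convolution of $\varphi_1,\varphi_2\colon\mathcal K\to\,]-\infty,+\infty]$ is $(\varphi_1\,\square\,\varphi_2)(x)=\inf_{y\in\mathcal K}(\varphi_1(y)+\varphi_2(x-y))$. For set-valued operators $M_1,M_2\colon\mathcal K\to 2^{\mathcal K}$, the same symbol denotes the parallel sum $M_1\,\square\,M_2=(M_1^{-1}+M_2^{-1})^{-1}$, where $M^{-1}$ is the set-valued operator with $x\in M^{-1}u\Leftrightarrow u\in Mx$. The range of $M\colon\mathcal K\to 2^{\mathcal K}$ is $\operatorname{ran}M=\{u: (\exists x\in\mathcal K)\ u\in Mx\}$. The operator $\partial f+\sum_i L_i^*(\partial g_i\,\square\,\partial\ell_i)(L_i\cdot-r_i)+\nabla h$ is $x\mapsto\partial f(x)+\sum_i L_i^*\big((\partial g_i\,\square\,\partial\ell_i)(L_ix-r_i)\big)+\nabla h(x)$, with Minkowski sums and images of sets. *)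

theory Defs
  imports "HOL-Analysis.Analysis" "HOL-Library.Set_Algebras"
begin

text \<open>
  A real Hilbert space is a closed linear subspace \<open>K\<close> of a complete inner product space.
  This makes it possible to speak about a family of different Hilbert spaces
  \<open>G 1, \<dots>, G m\<close>, with \<open>m\<close> a variable: inside one type they are represented by
  closed subspaces, for instance by the factors of their Hilbert direct sum. Hence the
  notions below take the space \<open>K\<close> as a parameter; values of functions and operators at points
  outside \<open>K\<close> are never used. For a Hilbert space that is a whole type, \<open>K = UNIV\<close>.
\<close>

definition edom :: "'a set \<Rightarrow> ('a \<Rightarrow> ereal) \<Rightarrow> 'a set" where
  "edom K \<phi> = {x \<in> K. \<phi> x < \<infinity>}"

text \<open>Only meant for functions that do not take the value \<open>-\<infinity>\<close> on \<open>K\<close>.\<close>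

definition econvex_on :: "'a::real_vector set \<Rightarrow> ('a \<Rightarrow> ereal) \<Rightarrow> bool" where
  "econvex_on K \<phi> \<longleftrightarrow> (\<forall>x\<in>K. \<forall>y\<in>K. \<forall>\<alpha>. 0 < \<alpha> \<and> \<alpha> < 1 \<longrightarrow>
     \<phi> (\<alpha> *\<^sub>R x + (1 - \<alpha>) *\<^sub>R y) \<le> ereal \<alpha> * \<phi> x + ereal (1 - \<alpha>) * \<phi> y)"

definition lsc_on :: "'a::topological_space set \<Rightarrow> ('a \<Rightarrow> ereal) \<Rightarrow> bool" where
  "lsc_on K \<phi> \<longleftrightarrow> (\<forall>x\<in>K. \<phi> x \<le> Liminf (at x within K) \<phi>)"

definition Gamma0 :: "'a::real_inner set \<Rightarrow> ('a \<Rightarrow> ereal) set" where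
  "Gamma0 K = {\<phi>. (\<forall>x\<in>K. \<phi> x \<noteq> -\<infinity>) \<and> lsc_on K \<phi> \<and> econvex_on K \<phi> \<and> edom K \<phi> \<noteq> {}}"

definition strongly_convex_on :: "'a::real_inner set \<Rightarrow> real \<Rightarrow> ('a \<Rightarrow> ereal) \<Rightarrow> bool" where
  "strongly_convex_on K \<nu> \<phi> \<longleftrightarrow> econvex_on K (\<lambda>x. \<phi> x - ereal (\<nu> * (norm x)\<^sup>2 / 2))"

definition uniformly_convex_at :: "'a::real_inner set \<Rightarrow> ('a \<Rightarrow> ereal) \<Rightarrow> 'a \<Rightarrow> bool" where
  "uniformly_convex_at K \<phi> x \<longleftrightarrow> x \<in> edom K \<phi> \<and>
     (\<exists>\<psi> :: real \<Rightarrow> ereal. mono_on {0..} \<psi> \<and> (\<forall>t\<ge>0. 0 \<le> \<psi> t) \<and> (\<forall>t\<ge>0. \<psi> t = 0 \<longleftrightarrow> t = 0) \<and>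
       (\<forall>y\<in>edom K \<phi>. \<forall>\<alpha>. 0 < \<alpha> \<and> \<alpha> < 1 \<longrightarrow>
          \<phi> (\<alpha> *\<^sub>R x + (1 - \<alpha>) *\<^sub>R y) + ereal (\<alpha> * (1 - \<alpha>)) * \<psi> (norm (x - y))
            \<le> ereal \<alpha> * \<phi> x + ereal (1 - \<alpha>) * \<phi> y))"

definition conjugate :: "'a::real_inner set \<Rightarrow> ('a \<Rightarrow> ereal) \<Rightarrow> 'a \<Rightarrow> ereal" where
  "conjugate K \<phi> u = (SUP x\<in>K. ereal (x \<bullet> u) - \<phi> x)"

definition infconv :: "'a::real_inner set \<Rightarrow> ('a \<Rightarrow> ereal) \<Rightarrow> ('a \<Rightarrow> ereal) \<Rightarrow> 'a \<Rightarrow> ereal" where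
  "infconv K \<phi> \<psi> x = (INF y\<in>K. \<phi> y + \<psi> (x - y))"

definition prox :: "'a::real_inner set \<Rightarrow> ('a \<Rightarrow> ereal) \<Rightarrow> 'a \<Rightarrow> 'a" where
  "prox K \<phi> x = (THE p. is_arg_min (\<lambda>y. \<phi> y + ereal ((norm (x - y))\<^sup>2 / 2)) (\<lambda>y. y \<in> K) p)"

definition subdifferential :: "'a::real_inner set \<Rightarrow> ('a \<Rightarrow> ereal) \<Rightarrow> 'a \<Rightarrow> 'a set" where
  "subdifferential K \<phi> x = {u \<in> K. \<forall>y\<in>K. ereal ((y - x) \<bullet> u) + \<phi> x \<le> \<phi> y}"

text \<open>
  The Frechet gradient in the Hilbert space \<open>K\<close>. On a proper subspace the derivative within \<open>K\<close>
  does not determine a linear map on the whole type, but it has only one representing vector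
  in \<open>K\<close>.
\<close>

definition gradient :: "'a::real_inner set \<Rightarrow> ('a \<Rightarrow> real) \<Rightarrow> 'a \<Rightarrow> 'a" where
  "gradient K \<phi> x = (THE u. u \<in> K \<and> (\<phi> has_derivative (\<lambda>d. d \<bullet> u)) (at x within K))"

lemma gradient_eqI:
  fixes K :: "'a::real_inner set"
  assumes K: "subspace K" "x \<in> K"
    and u: "u \<in> K" "(\<phi> has_derivative (\<lambda>d. d \<bullet> u)) (at x within K)"
  shows "gradient K \<phi> x = u"
  unfolding gradient_def
proof (rule the_equality)
  fix w assume w: "w \<in> K \<and> (\<phi> has_derivative (\<lambda>d. d \<bullet> w)) (at x within K)"
  have line: "(\<phi> \<circ> (\<lambda>t. x + t *\<^sub>R d) has_derivative ((\<lambda>d. d \<bullet> v) \<circ> (\<lambda>t. t *\<^sub>R d))) (at 0)"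
    if "d \<in> K" and v: "(\<phi> has_derivative (\<lambda>d. d \<bullet> v)) (at x within K)" for d v
  proof (rule diff_chain_within)
    show "((\<lambda>t. x + t *\<^sub>R d) has_derivative (\<lambda>t. t *\<^sub>R d)) (at 0)"
      by (auto intro!: derivative_eq_intros)
    have "range (\<lambda>t. x + t *\<^sub>R d) \<subseteq> K"
      using K \<open>d \<in> K\<close> by (auto intro!: subspace_add subspace_scale)
    then show "(\<phi> has_derivative (\<lambda>d. d \<bullet> v)) (at (x + 0 *\<^sub>R d) within range (\<lambda>t. x + t *\<^sub>R d))"
      using v by (auto intro: has_derivative_subset)
  qed
  have "w - u \<in> K"
    using w u K by (simp add: subspace_diff)
  then have "(\<lambda>d. d \<bullet> w) \<circ> (\<lambda>t. t *\<^sub>R (w - u)) = (\<lambda>d. d \<bullet> u) \<circ> (\<lambda>t. t *\<^sub>R (w - u))"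
    using has_derivative_unique line w u by blast
  from fun_cong[OF this, of 1] have "(w - u) \<bullet> (w - u) = 0"
    by (simp add: inner_diff_right)
  then show "w = u" by simp
qed (use u in simp)

text \<open>
  The gradient of the conjugate of a strongly convex function in \<open>Gamma0 K\<close>, for which the conjugate
  is finite on \<open>K\<close>.
\<close>

definition grad_conjugate :: "'a::real_inner set \<Rightarrow> ('a \<Rightarrow> ereal) \<Rightarrow> 'a \<Rightarrow> 'a" where
  "grad_conjugate K \<phi> = gradient K (\<lambda>u. real_of_ereal (conjugate K \<phi> u))"

definition op_inverse :: "'a set \<Rightarrow> ('a \<Rightarrow> 'a set) \<Rightarrow> 'a \<Rightarrow> 'a set" where
  "op_inverse K M u = {x \<in> K. u \<in> M x}"

definition parallel_sum :: "'a::plus set \<Rightarrow> ('a \<Rightarrow> 'a set) \<Rightarrow> ('a \<Rightarrow> 'a set) \<Rightarrow> 'a \<Rightarrow> 'a set" where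
  "parallel_sum K M N = op_inverse K (\<lambda>u. op_inverse K M u + op_inverse K N u)"

definition weakly_tendsto :: "'a::real_inner set \<Rightarrow> (nat \<Rightarrow> 'a) \<Rightarrow> 'a \<Rightarrow> bool" where
  "weakly_tendsto K X x \<longleftrightarrow> (\<forall>u\<in>K. (\<lambda>n. X n \<bullet> u) \<longlonglongrightarrow> x \<bullet> u)"

text \<open>
  The primal and dual objective functions. The library's adjoint of a map \<open>L\<close> into the type
  \<open>'g\<close> whose range lies in \<open>K\<close> agrees on \<open>K\<close> with the adjoint of \<open>L\<close> as a map into \<open>K\<close>.
\<close>

definition primal_objective ::
  "nat \<Rightarrow> (nat \<Rightarrow> 'g::real_inner set) \<Rightarrow> ('h::real_inner \<Rightarrow> ereal) \<Rightarrow> ('h \<Rightarrow> real) \<Rightarrow>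
   (nat \<Rightarrow> 'g \<Rightarrow> ereal) \<Rightarrow> (nat \<Rightarrow> 'g \<Rightarrow> ereal) \<Rightarrow> (nat \<Rightarrow> 'h \<Rightarrow> 'g) \<Rightarrow> (nat \<Rightarrow> 'g) \<Rightarrow> 'h \<Rightarrow> 'h \<Rightarrow> ereal"
  where
  "primal_objective m G f h g l L r z x =
     f x + (\<Sum>i=1..m. infconv (G i) (g i) (l i) (L i x - r i)) + ereal (h x) - ereal (x \<bullet> z)"

definition dual_objective ::
  "nat \<Rightarrow> (nat \<Rightarrow> 'g::real_inner set) \<Rightarrow> ('h::real_inner \<Rightarrow> ereal) \<Rightarrow> ('h \<Rightarrow> real) \<Rightarrow>
   (nat \<Rightarrow> 'g \<Rightarrow> ereal) \<Rightarrow> (nat \<Rightarrow> 'g \<Rightarrow> ereal) \<Rightarrow> (nat \<Rightarrow> 'h \<Rightarrow> 'g) \<Rightarrow> (nat \<Rightarrow> 'g) \<Rightarrow> 'h \<Rightarrow>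
   (nat \<Rightarrow> 'g) \<Rightarrow> ereal"
  where
  "dual_objective m G f h g l L r z v =
     infconv UNIV (conjugate UNIV f) (conjugate UNIV (\<lambda>x. ereal (h x)))
       (z - (\<Sum>i=1..m. adjoint (L i) (v i)))
     + (\<Sum>i=1..m. conjugate (G i) (g i) (v i) + conjugate (G i) (l i) (v i) + ereal (v i \<bullet> r i))"

definition primal_solution where
  "primal_solution m G f h g l L r z x \<longleftrightarrow>
     is_arg_min (primal_objective m G f h g l L r z) (\<lambda>_. True) x"

text \<open>
  Elements of the direct sum of \<open>G 1, \<dots>, G m\<close> are functions on \<open>nat\<close>, of which only the values
  at \<open>1, \<dots>, m\<close> matter.
\<close>

definition dual_solution where
  "dual_solution m G f h g l L r z v \<longleftrightarrow>
     is_arg_min (dual_objective m G f h g l L r z) (\<lambda>w. \<forall>i\<in>{1..m}. w i \<in> G i) v"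

end

theory Submission
  imports Defs "HOL-Library.Diagonal_Subsequence" "HOL-Library.Poly_Mapping"
begin

text \<open>
  In the product space of all pairs \<open>(x, (v\<^sub>1, \<dots>, v\<^sub>m))\<close> the optimality conditions of the primal and of the
  dual problem form one inclusion \<open>0 \<in> A w + B w\<close>, where
  \<open>A (x, v) = (\<partial>f x - z) \<times> (\<partial>g\<^sub>1\<^sup>* v\<^sub>1 + r\<^sub>1) \<times> \<dots>\<close> is maximally monotone and
  \<open>B (x, v) = (\<nabla>h x + \<Sum>i L\<^sub>i\<^sup>* v\<^sub>i, (\<nabla>l\<^sub>i\<^sup>* v\<^sub>i - L\<^sub>i x)\<^sub>i)\<close> is monotone, because its linear part is skew, and
  \<open>\<beta>\<close>-Lipschitz: the gradients contribute \<open>max {\<mu>, \<nu>\<^sub>i}\<close> and the skew part \<open>sqrt (\<Sum>i \<parallel>L\<^sub>i\<parallel>\<^sup>2)\<close>.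
  The resolvent of \<open>A\<close> acts componentwise by the proximity operators, so the algorithm is Tseng's
  forward-backward-forward method for \<open>A + B\<close> with summable errors.

  Convergence of that method (\<open>forward_backward_forward_weak_convergence\<close>) rests on three facts. One
  step decreases the squared distance to each zero by a multiple of \<open>\<parallel>x - p\<parallel>\<^sup>2\<close>, up to a summable
  error, which gives the summability claims and convergence of the distances
  (\<open>forward_backward_forward_descent\<close>). Weak cluster points are zeros (\<open>weak_limit_in_zer\<close>). A
  sequence with these two properties converges weakly (\<open>opial_weak_convergence\<close>). Each zero gives
  solutions of both problems, since its components are common subgradients at which the infimal
  convolutions are attained (\<open>kuhn_tucker_primal_solution\<close>, \<open>kuhn_tucker_dual_solution\<close>). For strong
  convergence, the exact resolvent points \<open>P\<^sub>n\<close> carry residuals \<open>U\<^sub>n \<in> (A + B) P\<^sub>n\<close> that tend to \<open>0\<close>; the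
  product of \<open>P\<^sub>n - w\<close>, where \<open>w\<close> is the limit, with \<open>U\<^sub>n\<close> is a sum of nonnegative monotonicity terms,
  one for each of \<open>f\<close>, \<open>h\<close>, \<open>g\<^sub>i\<^sup>*\<close>, \<open>l\<^sub>i\<^sup>*\<close>, so each of them tends to \<open>0\<close> and uniform convexity of one
  function controls its own component (\<open>residue_dissipation\<close>).

  The Hilbert space theory starts from one minimization lemma, \<open>convex_resolvent_exists\<close>: it
  yields the proximity operators, the Riesz representation theorem and from it adjoints, gradients
  and weak sequential compactness. It also shows that the identity plus a subdifferential is surjective,
  and this maximality identifies the subdifferential of the conjugate with the inverse of the
  subdifferential (\<open>subdifferential_conjugate_iff\<close>).
\<close>

section \<open>Minimization of a convex function plus a quadratic\<close>

text \<open>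
  The parallelogram law makes every minimizing sequence of \<open>F + \<parallel>y - \<cdot>\<parallel>\<^sup>2 / (2 * t)\<close> a Cauchy sequence; its
  limit is a minimizer, and comparing it with nearby points of a segment gives the subgradient
  inequality. Lower semicontinuity enters as sequential closedness of the epigraph over the domain \<open>D\<close>.
\<close>

lemma convex_resolvent_exists:
  fixes F :: "'a::real_inner \<Rightarrow> real"
  assumes K: "complete K" "D \<subseteq> K" and ne: "D \<noteq> {}" and conv: "convex_on D F"
    and closed_epi: "\<And>w s c c0. \<lbrakk>\<And>n. s n \<in> D; s \<longlonglongrightarrow> w; w \<in> K; \<And>n. F (s n) \<le> c n; c \<longlonglongrightarrow> c0\<rbrakk>
        \<Longrightarrow> w \<in> D \<and> F w \<le> c0"
    and lower: "\<And>w. w \<in> D \<Longrightarrow> - a - b * norm (w - e) \<le> F w"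
    and t: "t > 0"
  obtains p where "p \<in> D" "\<And>w. w \<in> D \<Longrightarrow> F p + ((1/t) *\<^sub>R (y - p)) \<bullet> (w - p) \<le> F w"
proof -
  define \<Phi> where "\<Phi> w = F w + (norm (y - w))\<^sup>2 / (2*t)" for w
  have cD: "convex D" using conv by (simp add: convex_on_def)
  \<comment> \<open>Young's inequality lets the quadratic term absorb the linear decrease of the lower bound.\<close>
  have young: "\<bar>b\<bar> * s \<le> t * b\<^sup>2 / 2 + s\<^sup>2 / (2*t)" for s
  proof -
    have "0 \<le> (t * \<bar>b\<bar> - s)\<^sup>2 / (2*t)" using t by simp
    also have "\<dots> = t * b\<^sup>2/2 - \<bar>b\<bar> * s + s\<^sup>2/(2*t)"
      using t by (simp add: power2_diff field_simps power2_eq_square)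
    finally show ?thesis by simp
  qed
  have bdd: "- a - \<bar>b\<bar> * norm (y - e) - t * b\<^sup>2 / 2 \<le> \<Phi> w" if "w \<in> D" for w
  proof -
    have "norm (w - e) \<le> norm (y - w) + norm (y - e)"
      by (metis norm_minus_commute norm_triangle_sub add.commute norm_triangle_ineq4 diff_diff_eq2 diff_add_cancel)
    then have "b * norm (w - e) \<le> \<bar>b\<bar> * (norm (y - w) + norm (y - e))"
      by (metis abs_ge_self abs_ge_zero mult_mono norm_ge_zero)
    then show ?thesis using lower[OF that] young[of "norm (y-w)"]
      unfolding \<Phi>_def by (simp add: algebra_simps)
  qed
  define \<mu> where "\<mu> = Inf (\<Phi> ` D)"
  have bb: "bdd_below (\<Phi> ` D)" using bdd by (meson bdd_belowI2)
  have mu_le: "\<mu> \<le> \<Phi> w" if "w \<in> D" for w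
    unfolding \<mu>_def using bb that by (simp add: cInf_lower)
  have "\<exists>w\<in>D. \<Phi> w < \<mu> + 1 / real (Suc n)" for n
    using cInf_lessD[of "\<Phi> ` D" "\<mu> + 1 / real (Suc n)"] ne unfolding \<mu>_def by auto
  then obtain s where s: "\<And>n. s n \<in> D" "\<And>n. \<Phi> (s n) < \<mu> + 1 / real (Suc n)" by metis
  have para: "(norm (u - w))\<^sup>2 \<le> 8 * t * ((\<Phi> u + \<Phi> w)/2 - \<mu>)" if "u \<in> D" "w \<in> D" for u w
  proof -
    let ?q = "(1/2) *\<^sub>R u + (1/2) *\<^sub>R w"
    have q: "?q \<in> D" using cD that by (simp add: convexD)
    have 1: "F ?q \<le> F u / 2 + F w / 2"
      using conv that convex_onD[OF conv, of "1/2" u w] by simp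
    have 2: "(norm (y - ?q))\<^sup>2 = (norm (y-u))\<^sup>2/2 + (norm (y-w))\<^sup>2/2 - (norm (u-w))\<^sup>2/4"
      by (simp add: power2_norm_eq_inner inner_diff inner_add inner_commute field_simps)
    have 3: "(norm (y - ?q))\<^sup>2/(2*t) = (norm (y-u))\<^sup>2/(4*t) + (norm (y-w))\<^sup>2/(4*t) - (norm (u-w))\<^sup>2/(8*t)"
      unfolding 2 using t by (simp add: field_simps)
    have half: "\<Phi> v / 2 = F v / 2 + (norm (y-v))\<^sup>2/(4*t)" for v
      unfolding \<Phi>_def using t by (simp add: field_simps)
    have "\<mu> \<le> \<Phi> u / 2 + \<Phi> w / 2 - (norm (u-w))\<^sup>2/(8*t)"
      using mu_le[OF q] 1 3 half[of u] half[of w] unfolding \<Phi>_def[of ?q] by linarith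
    then have "\<mu> \<le> (\<Phi> u + \<Phi> w)/2 - (norm (u-w))\<^sup>2/(8*t)" by (simp add: add_divide_distrib)
    then show ?thesis using t by (simp add: field_simps)
  qed
  have "Cauchy s"
  proof (rule metric_CauchyI)
    fix d :: real assume d: "d > 0"
    then have "0 < d\<^sup>2 / (8*t)" using t by simp
    then obtain N where N: "1 / real (Suc N) < d\<^sup>2/(8*t)"
      using reals_Archimedean[of "d\<^sup>2/(8*t)"] by (auto simp: inverse_eq_divide)
    have "dist (s i) (s j) < d" if "i \<ge> N" "j \<ge> N" for i j
    proof -
      have le: "1 / real (Suc i) \<le> 1 / real (Suc N)" "1 / real (Suc j) \<le> 1 / real (Suc N)"
        using that by (auto simp: frac_le)
      have "\<Phi> (s i) < \<mu> + d\<^sup>2/(8*t)" "\<Phi> (s j) < \<mu> + d\<^sup>2/(8*t)"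
        using s(2)[of i] s(2)[of j] le N by linarith+
      then have "(\<Phi> (s i) + \<Phi> (s j))/2 - \<mu> < d\<^sup>2/(8*t)"
        by (simp add: field_simps)
      then have "8 * t * ((\<Phi> (s i) + \<Phi> (s j))/2 - \<mu>) < d\<^sup>2"
        using t by (simp add: field_simps)
      then have "(norm (s i - s j))\<^sup>2 < d\<^sup>2"
        using para[OF s(1)[of i] s(1)[of j]] by linarith
      then show ?thesis using d by (simp add: dist_norm power2_less_imp_less)
    qed
    then show "\<exists>M. \<forall>m\<ge>M. \<forall>n\<ge>M. dist (s m) (s n) < d" by blast
  qed
  then obtain p where p: "p \<in> K" "s \<longlonglongrightarrow> p"
    using K s(1) by (meson completeE subsetD)
  have c: "(\<lambda>n. \<mu> + 1 / real (Suc n) - (norm (y - s n))\<^sup>2/(2*t)) \<longlonglongrightarrow> \<mu> + 0 - (norm (y - p))\<^sup>2/(2*t)"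
    using t by (intro tendsto_intros p LIMSEQ_Suc lim_1_over_n) auto
  have "p \<in> D \<and> F p \<le> \<mu> + 0 - (norm (y - p))\<^sup>2/(2*t)"
  proof (rule closed_epi[OF s(1) p(2,1) _ c])
    show "F (s n) \<le> \<mu> + 1 / real (Suc n) - (norm (y - s n))\<^sup>2/(2*t)" for n
      using s(2)[of n] unfolding \<Phi>_def by linarith
  qed
  then have pD: "p \<in> D" and pmu: "\<Phi> p \<le> \<mu>" unfolding \<Phi>_def by auto
  show ?thesis
  proof (rule that[OF pD])
    fix w assume w: "w \<in> D"
    define A where "A = F w - F p - ((1/t) *\<^sub>R (y - p)) \<bullet> (w - p)"
    define B where "B = (norm (w - p))\<^sup>2/(2*t)"
    have *: "0 \<le> A + \<tau> * B" if \<tau>: "0 < \<tau>" "\<tau> < 1" for \<tau>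
    proof -
      let ?q = "(1-\<tau>) *\<^sub>R p + \<tau> *\<^sub>R w"
      have q: "?q \<in> D" using cD pD w \<tau> by (simp add: convexD)
      have 1: "F ?q \<le> (1-\<tau>) * F p + \<tau> * F w"
        using convex_onD[OF conv, of \<tau> p w] pD w \<tau> by simp
      have "y - ?q = (y - p) - \<tau> *\<^sub>R (w - p)" by (simp add: algebra_simps)
      moreover have "(norm (u - \<tau> *\<^sub>R d))\<^sup>2 = (norm u)\<^sup>2 - 2 * \<tau> * (u \<bullet> d) + \<tau>\<^sup>2 * (norm d)\<^sup>2" for u d :: 'a
        unfolding power2_norm_eq_inner
        by (simp add: inner_diff inner_commute algebra_simps power2_eq_square)
      ultimately have 2: "(norm (y - ?q))\<^sup>2 = (norm (y-p))\<^sup>2 - 2 * \<tau> * ((y-p) \<bullet> (w-p)) + \<tau>\<^sup>2 * (norm (w-p))\<^sup>2"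
        by (simp only:)
      have "\<Phi> p \<le> \<Phi> ?q" using mu_le[OF q] pmu by simp
      then have "0 \<le> F ?q - F p + (- 2 * \<tau> * ((y-p) \<bullet> (w-p)) + \<tau>\<^sup>2 * (norm (w-p))\<^sup>2)/(2*t)"
        unfolding \<Phi>_def 2 by (simp add: add_divide_distrib diff_divide_distrib)
      also have "\<dots> \<le> \<tau> * (A + \<tau> * B)"
      proof -
        have split: "(- 2 * \<tau> * X + \<tau>\<^sup>2 * N)/(2*t) = - (\<tau> * (1/t * X)) + \<tau> * (\<tau> * (N/(2*t)))" for X N
          using t by (simp add: field_simps power2_eq_square)
        have "F ?q - F p \<le> \<tau> * (F w - F p)" using 1 by (simp add: algebra_simps)
        then show ?thesis unfolding A_def B_def split by (simp add: algebra_simps)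
      qed
      finally show ?thesis using \<tau> by (simp add: zero_le_mult_iff)
    qed
    have "0 \<le> A"
    proof (rule ccontr)
      assume neg: "\<not> 0 \<le> A"
      \<comment> \<open>A step so short that the quadratic term cannot compensate a negative \<open>A\<close>.\<close>
      define \<tau> where "\<tau> = min (1/2) (- A / (2 * (B + 1)))"
      have B: "B \<ge> 0" unfolding B_def using t by simp
      have \<tau>: "0 < \<tau>" "\<tau> < 1" unfolding \<tau>_def using neg B by (auto simp: field_simps)
      have "\<tau> \<le> - A / (2 * (B + 1))" unfolding \<tau>_def by simp
      then have "\<tau> * (B + 1) \<le> - A / 2" using B by (simp add: field_simps)
      then have "\<tau> * B \<le> - A / 2" using \<tau> by (simp add: algebra_simps)
      then show False using *[OF \<tau>] neg by simp
    qed
    then show "F p + ((1/t) *\<^sub>R (y - p)) \<bullet> (w - p) \<le> F w" unfolding A_def by simp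
  qed
qed

section \<open>Riesz representation and weak compactness in a complete subspace\<close>

text \<open>
  A minimizer \<open>p\<close> of \<open>\<parallel>x\<parallel>\<^sup>2 / 2 - \<phi> x\<close> represents \<open>\<phi>\<close>: the optimality inequality at \<open>p + d\<close> and at
  \<open>p - d\<close> turns into an equation because \<open>\<phi>\<close> is linear.
\<close>

lemma riesz_representation_on:
  fixes \<phi> :: "'a::real_inner \<Rightarrow> real"
  assumes K: "subspace K" "complete K"
    and add: "\<And>x y. x \<in> K \<Longrightarrow> y \<in> K \<Longrightarrow> \<phi> (x + y) = \<phi> x + \<phi> y"
    and scale: "\<And>c x. x \<in> K \<Longrightarrow> \<phi> (c *\<^sub>R x) = c * \<phi> x"
    and bound: "\<And>x. x \<in> K \<Longrightarrow> \<bar>\<phi> x\<bar> \<le> C * norm x"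
  obtains p where "p \<in> K" "\<And>x. x \<in> K \<Longrightarrow> \<phi> x = x \<bullet> p"
proof -
  have diff: "\<phi> (x - y) = \<phi> x - \<phi> y" if "x \<in> K" "y \<in> K" for x y
    using add[of x "(-1) *\<^sub>R y"] scale[of y "-1"] that K by (simp add: subspace_neg)
  have conv: "convex_on K (\<lambda>x. - \<phi> x)"
    using K by (intro convex_onI subspace_imp_convex) (auto simp: add scale subspace_scale)
  have closed_epi: "w \<in> K \<and> - \<phi> w \<le> c0"
    if s: "\<And>n. s n \<in> K" "s \<longlonglongrightarrow> w" "w \<in> K" "\<And>n. - \<phi> (s n) \<le> c n" "c \<longlonglongrightarrow> c0"
    for s w c c0
  proof -
    have "(\<lambda>n. \<phi> (s n) - \<phi> w) \<longlonglongrightarrow> 0"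
    proof (rule Lim_null_comparison)
      show "\<forall>\<^sub>F n in sequentially. norm (\<phi> (s n) - \<phi> w) \<le> C * norm (s n - w)"
        using bound[of "s _ - w"] diff s K by (auto simp: subspace_diff)
      have "(\<lambda>n. C * norm (s n - w)) \<longlonglongrightarrow> C * norm (w - w)"
        by (intro tendsto_intros s)
      then show "(\<lambda>n. C * norm (s n - w)) \<longlonglongrightarrow> 0" by simp
    qed
    then have "(\<lambda>n. - \<phi> (s n)) \<longlonglongrightarrow> - \<phi> w"
      by (simp add: LIM_zero_iff tendsto_minus)
    then show ?thesis using s by (auto intro: LIMSEQ_le)
  qed
  obtain p where p: "p \<in> K" "\<And>w. w \<in> K \<Longrightarrow> - \<phi> p + ((1/1) *\<^sub>R (0 - p)) \<bullet> (w - p) \<le> - \<phi> w"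
  proof (rule convex_resolvent_exists[OF K(2) order_refl _ conv, where t = 1 and y = 0 and a = 0 and b = C and e = 0])
    show "K \<noteq> {}" using K subspace_0 by blast
    show "- 0 - C * norm (w - 0) \<le> - \<phi> w" if "w \<in> K" for w using bound[OF that] by simp
    show "w \<in> K \<and> - \<phi> w \<le> c0" if "\<And>n. s n \<in> K" "s \<longlonglongrightarrow> w" "w \<in> K" "\<And>n. - \<phi> (s n) \<le> c n" "c \<longlonglongrightarrow> c0"
      for s w c c0 by (rule closed_epi) (fact that)+
  qed simp_all
  show ?thesis
  proof (rule that[OF p(1)])
    fix d assume d: "d \<in> K"
    have "- \<phi> p - p \<bullet> d \<le> - \<phi> (p + d)" "- \<phi> p + p \<bullet> d \<le> - \<phi> (p - d)"
      using p(2)[of "p + d"] p(2)[of "p - d"] p(1) d K by (auto simp: subspace_add subspace_diff)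
    then show "\<phi> d = d \<bullet> p"
      using add[OF p(1) d] diff[OF p(1) d] by (simp add: inner_commute)
  qed
qed

text \<open>
  The adjoint is defined by choice; the Riesz representation of \<open>x \<mapsto> T x \<bullet> y\<close> shows that
  the choice succeeds on a Hilbert space.
\<close>

lemma adjoint_inner:
  fixes T :: "'a::{real_inner, banach} \<Rightarrow> 'b::real_inner"
  assumes T: "bounded_linear T"
  shows "x \<bullet> adjoint T y = T x \<bullet> y"
proof -
  interpret T: bounded_linear T by fact
  have "\<exists>p. \<forall>x. T x \<bullet> y = x \<bullet> p" for y
  proof -
    have bound: "\<bar>T x \<bullet> y\<bar> \<le> (onorm T * norm y) * norm x" for x
    proof -
      have "\<bar>T x \<bullet> y\<bar> \<le> norm (T x) * norm y" by (rule Cauchy_Schwarz_ineq2)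
      also have "\<dots> \<le> (onorm T * norm x) * norm y"
        by (intro mult_right_mono onorm T norm_ge_zero)
      finally show ?thesis by (simp add: mult_ac)
    qed
    show ?thesis
      by (rule riesz_representation_on[OF subspace_UNIV complete_UNIV, of "\<lambda>x. T x \<bullet> y"])
         (use bound in \<open>auto simp: T.add T.scaleR inner_add_left\<close>)
  qed
  then have "\<exists>T'. \<forall>x y. T x \<bullet> y = x \<bullet> T' y" by metis
  then have "\<forall>x y. T x \<bullet> y = x \<bullet> adjoint T y"
    unfolding adjoint_def by (rule someI_ex)
  then show ?thesis by simp
qed

lemma norm_adjoint_le:
  fixes T :: "'a::{real_inner, banach} \<Rightarrow> 'b::real_inner"
  assumes T: "bounded_linear T"
  shows "norm (adjoint T y) \<le> onorm T * norm y"
proof -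
  let ?a = "adjoint T y"
  have "norm ?a * norm ?a = T ?a \<bullet> y"
    using adjoint_inner[OF T, of ?a y] by (metis dot_square_norm power2_eq_square)
  also have "\<dots> \<le> norm (T ?a) * norm y" by (rule norm_cauchy_schwarz)
  also have "\<dots> \<le> (onorm T * norm ?a) * norm y"
    by (intro mult_right_mono onorm T norm_ge_zero)
  finally have "norm ?a * norm ?a \<le> (onorm T * norm y) * norm ?a" by (simp add: mult_ac)
  then show ?thesis
    using onorm_pos_le[OF T] by (cases "norm ?a = 0") (auto simp: mult_le_cancel_right)
qed

lemma adjoint_diff:
  fixes T :: "'a::{real_inner, banach} \<Rightarrow> 'b::real_inner"
  assumes T: "bounded_linear T"
  shows "adjoint T (y - w) = adjoint T y - adjoint T w"
proof -
  have "x \<bullet> adjoint T (y - w) = x \<bullet> (adjoint T y - adjoint T w)" for x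
    by (simp add: adjoint_inner[OF T] inner_diff_right)
  then show ?thesis using vector_eq_ldot by blast
qed

lemma bounded_real_convergent_subsequence:
  fixes s :: "nat \<Rightarrow> real"
  assumes "\<And>n. \<bar>s n\<bar> \<le> B"
  shows "\<exists>r. strict_mono r \<and> convergent (s \<circ> r)"
proof -
  have "bounded (range s)" using assms by (auto simp: bounded_iff)
  then show ?thesis
    using bounded_imp_convergent_subsequence[of s] by (auto simp: convergent_def)
qed

lemma subspace_closure_normed:
  fixes S :: "'a::real_normed_vector set"
  assumes S: "subspace S"
  shows "subspace (closure S)"
proof (rule subspaceI)
  show "0 \<in> closure S" using subspace_0[OF S] closure_subset by blast
next
  fix x y assume "x \<in> closure S" "y \<in> closure S"
  then obtain X Y where "\<And>n. X n \<in> S" "X \<longlonglongrightarrow> x" "\<And>n. Y n \<in> S" "Y \<longlonglongrightarrow> y"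
    unfolding closure_sequential by metis
  then have "(\<forall>n. X n + Y n \<in> S) \<and> (\<lambda>n. X n + Y n) \<longlonglongrightarrow> x + y"
    using S by (auto intro: subspace_add tendsto_add)
  then show "x + y \<in> closure S" unfolding closure_sequential by fast
next
  fix c and x assume "x \<in> closure S"
  then obtain X where "\<And>n. X n \<in> S" "X \<longlonglongrightarrow> x" unfolding closure_sequential by metis
  then have "(\<forall>n. c *\<^sub>R X n \<in> S) \<and> (\<lambda>n. c *\<^sub>R X n) \<longlonglongrightarrow> c *\<^sub>R x"
    using S by (auto intro: subspace_scale tendsto_scaleR)
  then show "c *\<^sub>R x \<in> closure S" unfolding closure_sequential by fast
qed

text \<open>
  A diagonal subsequence converges against each term of the sequence, hence against the closed span of
  the terms. Against any other vector the terms behave as against its Riesz representative in that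
  span, and the limits define a bounded functional whose representative in \<open>K\<close> is the weak limit.
\<close>

lemma bounded_weakly_convergent_subsequence:
  fixes X :: "nat \<Rightarrow> 'a::real_inner"
  assumes K: "subspace K" "complete K" and X: "\<And>n. X n \<in> K" and M: "\<And>n. norm (X n) \<le> M"
  obtains r x where "strict_mono (r :: nat \<Rightarrow> nat)" "x \<in> K" "weakly_tendsto K (X \<circ> r) x"
proof -
  define P where "P k s \<longleftrightarrow> convergent (\<lambda>n. X (s n) \<bullet> X k)" for k and s :: "nat \<Rightarrow> nat"
  have inner_bound: "\<bar>X n \<bullet> y\<bar> \<le> M * norm y" for n y
    by (meson Cauchy_Schwarz_ineq2 M mult_right_mono norm_ge_zero order_trans)
  interpret subseqs P
  proof
    fix k and s :: "nat \<Rightarrow> nat" assume "strict_mono s"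
    show "\<exists>r'. strict_mono r' \<and> P k (s \<circ> r')"
      using bounded_real_convergent_subsequence[of "\<lambda>n. X (s n) \<bullet> X k", OF inner_bound]
      by (simp add: P_def o_def)
  qed
  let ?r = diagseq
  have conv_gen: "convergent (\<lambda>n. X (?r n) \<bullet> X k)" for k
  proof -
    have "P k (?r \<circ> (+) (Suc k))"
      by (rule diagseq_holds) (auto simp: P_def o_def dest: convergent_subseq_convergent)
    then have "convergent (\<lambda>n. X (?r (n + Suc k)) \<bullet> X k)" by (simp add: P_def o_def add.commute)
    then show ?thesis by (rule iffD1[OF convergent_ignore_initial_segment])
  qed
  have conv_span: "convergent (\<lambda>n. X (?r n) \<bullet> y)" if "y \<in> span (range X)" for y
    using that
  proof (induction rule: span_induct_alt)
    case base
    then show ?case by (simp add: convergent_const)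
  next
    case (step c u w)
    then have "convergent (\<lambda>n. X (?r n) \<bullet> u)" using conv_gen by auto
    then have "convergent (\<lambda>n. c * (X (?r n) \<bullet> u) + X (?r n) \<bullet> w)"
      using step by (intro convergent_add convergent_mult convergent_const)
    then show ?case by (simp add: inner_add_right)
  qed
  define V where "V = closure (span (range X))"
  have V: "subspace V" unfolding V_def by (intro subspace_closure_normed subspace_span)
  have "V \<subseteq> K"
    unfolding V_def using K X
    by (intro closure_minimal span_minimal) (auto simp: complete_imp_closed)
  then have Vc: "complete V"
    unfolding V_def using K(2)
    by (metis closed_closure complete_Int_closed Int_absorb1)
  have XV: "X n \<in> V" for n unfolding V_def by (meson closure_subset rangeI span_base subsetD)
  have conv_V: "convergent (\<lambda>n. X (?r n) \<bullet> y)" if y: "y \<in> V" for y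
  proof -
    have "Cauchy (\<lambda>n. X (?r n) \<bullet> y)"
    proof (rule metric_CauchyI)
      fix e :: real assume e: "e > 0"
      have M0: "M \<ge> 0" using M[of 0] norm_ge_zero order_trans by blast
      have "e / (3 * (M + 1)) > 0" using e M0 by simp
      then obtain w where w: "w \<in> span (range X)" "dist w y < e / (3 * (M + 1))"
        using y unfolding V_def closure_approachable by blast
      have "norm (w - y) * (3 * (M + 1)) < e"
        using w(2) M0 by (simp add: dist_norm pos_less_divide_eq)
      moreover have "norm (w - y) * (3 * M) \<le> norm (w - y) * (3 * (M + 1))"
        by (intro mult_left_mono) auto
      ultimately have "norm (w - y) * (3 * M) < e" by (rule order.strict_trans1[rotated])
      then have small: "M * norm (w - y) < e / 3" by (simp add: mult_ac)
      have "Cauchy (\<lambda>n. X (?r n) \<bullet> w)" using conv_span[OF w(1)] by (simp add: convergent_Cauchy)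
      then obtain N where N: "\<And>m n. m \<ge> N \<Longrightarrow> n \<ge> N \<Longrightarrow> dist (X (?r m) \<bullet> w) (X (?r n) \<bullet> w) < e/3"
        using e by (meson metric_CauchyD zero_less_divide_iff zero_less_numeral)
      have close: "\<bar>X (?r n) \<bullet> w - X (?r n) \<bullet> y\<bar> < e/3" for n
        using inner_bound[of "?r n" "w - y"] small by (simp add: inner_diff_right)
      have "dist (X (?r m) \<bullet> y) (X (?r n) \<bullet> y) < e" if "m \<ge> N" "n \<ge> N" for m n
        using N[OF that] close[of m] close[of n] unfolding dist_real_def by linarith
      then show "\<exists>N. \<forall>m\<ge>N. \<forall>n\<ge>N. dist (X (?r m) \<bullet> y) (X (?r n) \<bullet> y) < e" by blast
    qed
    then show ?thesis by (simp add: Cauchy_convergent)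
  qed
  have conv: "convergent (\<lambda>n. X (?r n) \<bullet> y)" for y
  proof -
    obtain p where "p \<in> V" "\<And>x. x \<in> V \<Longrightarrow> x \<bullet> y = x \<bullet> p"
      by (rule riesz_representation_on[OF V Vc, of "\<lambda>x. x \<bullet> y" "norm y"])
         (use Cauchy_Schwarz_ineq2[of _ y] in \<open>auto simp: inner_add_left mult.commute\<close>)
    then show ?thesis using conv_V XV by simp
  qed
  define \<phi> where "\<phi> y = lim (\<lambda>n. X (?r n) \<bullet> y)" for y
  have lim: "(\<lambda>n. X (?r n) \<bullet> y) \<longlonglongrightarrow> \<phi> y" for y
    unfolding \<phi>_def using conv by (simp add: convergent_LIMSEQ_iff)
  obtain x where x: "x \<in> K" "\<And>y. y \<in> K \<Longrightarrow> \<phi> y = y \<bullet> x"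
  proof (rule riesz_representation_on[OF K, of \<phi> M])
    show "\<phi> (x + y) = \<phi> x + \<phi> y" for x y
      using tendsto_add[OF lim[of x] lim[of y]] lim[of "x + y"]
      by (simp add: inner_add_right LIMSEQ_unique)
    show "\<phi> (c *\<^sub>R x) = c * \<phi> x" for c x
      using tendsto_mult_left[OF lim[of x], of c] lim[of "c *\<^sub>R x"] by (simp add: LIMSEQ_unique)
    show "\<bar>\<phi> y\<bar> \<le> M * norm y" for y
      by (rule LIMSEQ_le_const2[OF tendsto_rabs[OF lim]]) (use inner_bound in auto)
  qed auto
  show ?thesis
  proof (rule that[OF subseq_diagseq x(1)])
    show "weakly_tendsto K (X \<circ> ?r) x"
      unfolding weakly_tendsto_def
    proof
      fix u assume "u \<in> K"
      then show "(\<lambda>n. (X \<circ> ?r) n \<bullet> u) \<longlonglongrightarrow> x \<bullet> u"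
        using lim[of u] x(2)[of u] by (simp add: inner_commute)
    qed
  qed
qed

section \<open>Subdifferentials, proximity operators and conjugates\<close>

lemma lsc_onD:
  assumes "lsc_on K \<phi>" "x \<in> K" "c < \<phi> x"
  shows "\<exists>d>0. \<forall>y\<in>K. dist y x < d \<longrightarrow> c < \<phi> y"
proof -
  have "\<forall>\<^sub>F y in at x within K. c < \<phi> y"
    using assms unfolding lsc_on_def le_Liminf_iff by blast
  then obtain d where "d > 0" "\<forall>y\<in>K. y \<noteq> x \<and> dist y x < d \<longrightarrow> c < \<phi> y"
    unfolding eventually_at by blast
  then show ?thesis using assms(3) by (intro exI[of _ d]) auto
qed

lemma lsc_onI:
  fixes \<phi> :: "'a::metric_space \<Rightarrow> ereal"
  assumes "\<And>x c. x \<in> K \<Longrightarrow> c < \<phi> x \<Longrightarrow> \<exists>d>0. \<forall>y\<in>K. dist y x < d \<longrightarrow> c < \<phi> y"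
  shows "lsc_on K \<phi>"
  unfolding lsc_on_def le_Liminf_iff eventually_at
proof (intro ballI allI impI)
  fix x c assume "x \<in> K" "c < \<phi> x"
  from assms[OF this] show "\<exists>d>0. \<forall>y\<in>K. y \<noteq> x \<and> dist y x < d \<longrightarrow> c < \<phi> y" by blast
qed

text \<open>
  The calculus of subgradients is stated for this class, so that it applies to members of \<open>Gamma0 K\<close> and
  to their conjugates alike.
\<close>

definition proper_on :: "'a set \<Rightarrow> ('a \<Rightarrow> ereal) \<Rightarrow> bool" where
  "proper_on K \<phi> \<longleftrightarrow> (\<forall>x\<in>K. \<phi> x \<noteq> -\<infinity>) \<and> edom K \<phi> \<noteq> {}"

lemma Gamma0_proper: "\<phi> \<in> Gamma0 K \<Longrightarrow> proper_on K \<phi>"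
  by (simp add: Gamma0_def proper_on_def)

lemma proper_on_finite:
  assumes "proper_on K \<phi>" "x \<in> edom K \<phi>"
  shows "x \<in> K" "\<phi> x = ereal (real_of_ereal (\<phi> x))" "ereal (real_of_ereal (\<phi> x)) = \<phi> x"
proof -
  show "x \<in> K" using assms by (simp add: edom_def)
  show "ereal (real_of_ereal (\<phi> x)) = \<phi> x"
    using assms unfolding proper_on_def edom_def by (auto simp: ereal_real)
  then show "\<phi> x = ereal (real_of_ereal (\<phi> x))" by (rule sym)
qed

text \<open>
  With the values turned into real numbers, subgradient inequalities are open to linear arithmetic; only
  points of the effective domain have to be considered.
\<close>

lemma subdifferentialD:
  assumes \<phi>: "proper_on K \<phi>" and p: "p \<in> K" "u \<in> subdifferential K \<phi> p"
  shows "p \<in> edom K \<phi>" "u \<in> K"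
    and "y \<in> edom K \<phi> \<Longrightarrow> real_of_ereal (\<phi> p) + (y - p) \<bullet> u \<le> real_of_ereal (\<phi> y)"
proof -
  obtain e where e: "e \<in> edom K \<phi>" using \<phi> by (auto simp: proper_on_def)
  have "ereal ((e - p) \<bullet> u) + \<phi> p \<le> \<phi> e"
    using p proper_on_finite(1)[OF \<phi> e] by (auto simp: subdifferential_def)
  then show pe: "p \<in> edom K \<phi>" using p e by (auto simp: edom_def)
  show "u \<in> K" using p by (auto simp: subdifferential_def)
  assume y: "y \<in> edom K \<phi>"
  have "ereal ((y - p) \<bullet> u) + \<phi> p \<le> \<phi> y"
    using p proper_on_finite(1)[OF \<phi> y] by (auto simp: subdifferential_def)
  then have "ereal ((y - p) \<bullet> u) + ereal (real_of_ereal (\<phi> p)) \<le> ereal (real_of_ereal (\<phi> y))"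
    by (simp only: proper_on_finite(3)[OF \<phi> y] proper_on_finite(3)[OF \<phi> pe])
  then show "real_of_ereal (\<phi> p) + (y - p) \<bullet> u \<le> real_of_ereal (\<phi> y)" by simp
qed

lemma subdifferentialI:
  assumes \<phi>: "proper_on K \<phi>" and p: "p \<in> edom K \<phi>" and u: "u \<in> K"
    and le: "\<And>y. y \<in> edom K \<phi> \<Longrightarrow> real_of_ereal (\<phi> p) + (y - p) \<bullet> u \<le> real_of_ereal (\<phi> y)"
  shows "u \<in> subdifferential K \<phi> p"
proof -
  have "ereal ((y - p) \<bullet> u) + \<phi> p \<le> \<phi> y" if "y \<in> K" for y
  proof (cases "y \<in> edom K \<phi>")
    case True
    have "ereal ((y - p) \<bullet> u) + ereal (real_of_ereal (\<phi> p)) \<le> ereal (real_of_ereal (\<phi> y))"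
      using le[OF True] by simp
    then show ?thesis
      by (simp only: proper_on_finite(3)[OF \<phi> True] proper_on_finite(3)[OF \<phi> p])
  next
    case False
    then show ?thesis using that by (auto simp: edom_def)
  qed
  then show ?thesis using u by (simp add: subdifferential_def)
qed

lemma subdifferential_monotone:
  assumes \<phi>: "proper_on K \<phi>" and p: "p \<in> K" "u \<in> subdifferential K \<phi> p"
    and q: "q \<in> K" "w \<in> subdifferential K \<phi> q"
  shows "0 \<le> (p - q) \<bullet> (u - w)"
  using subdifferentialD(3)[OF \<phi> p subdifferentialD(1)[OF \<phi> q]]
    subdifferentialD(3)[OF \<phi> q subdifferentialD(1)[OF \<phi> p]]
  by (simp add: inner_diff_right inner_diff_left)

lemma Gamma0_convex_on:
  assumes K: "subspace K" and \<phi>: "\<phi> \<in> Gamma0 K"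
  shows "convex_on (edom K \<phi>) (\<lambda>x. real_of_ereal (\<phi> x))"
proof -
  note pr = Gamma0_proper[OF \<phi>]
  have conv: "(1 - a) *\<^sub>R x + a *\<^sub>R y \<in> edom K \<phi> \<and>
      real_of_ereal (\<phi> ((1 - a) *\<^sub>R x + a *\<^sub>R y)) \<le> (1 - a) * real_of_ereal (\<phi> x) + a * real_of_ereal (\<phi> y)"
    if a: "0 < a" "a < 1" and xy: "x \<in> edom K \<phi>" "y \<in> edom K \<phi>" for a x y
  proof -
    let ?q = "(1 - a) *\<^sub>R x + a *\<^sub>R y"
    have xK: "x \<in> K" "y \<in> K" using proper_on_finite(1)[OF pr] xy by auto
    then have qK: "?q \<in> K" using K by (simp add: subspace_add subspace_scale)
    have "\<phi> ?q \<le> ereal (1 - a) * \<phi> x + ereal a * \<phi> y"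
    proof -
      have "econvex_on K \<phi>" using \<phi> by (simp add: Gamma0_def)
      from this[unfolded econvex_on_def, rule_format, of x y "1 - a"] show ?thesis
        using xK a by simp
    qed
    also have "\<dots> = ereal ((1 - a) * real_of_ereal (\<phi> x) + a * real_of_ereal (\<phi> y))"
      by (subst proper_on_finite(2)[OF pr xy(1)], subst proper_on_finite(2)[OF pr xy(2)]) simp
    finally have le: "\<phi> ?q \<le> ereal ((1 - a) * real_of_ereal (\<phi> x) + a * real_of_ereal (\<phi> y))" .
    then have qd: "?q \<in> edom K \<phi>" using qK by (auto simp: edom_def)
    have "real_of_ereal (\<phi> ?q) \<le> (1 - a) * real_of_ereal (\<phi> x) + a * real_of_ereal (\<phi> y)"
      using le by (subst (asm) proper_on_finite(2)[OF pr qd]) simp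
    with qd show ?thesis by simp
  qed
  show ?thesis
  proof (rule convex_onI)
    show "convex (edom K \<phi>)"
      unfolding convex_alt
    proof (intro ballI allI impI)
      fix x y and u :: real assume "x \<in> edom K \<phi>" "y \<in> edom K \<phi>" "0 \<le> u \<and> u \<le> 1"
      then show "(1 - u) *\<^sub>R x + u *\<^sub>R y \<in> edom K \<phi>"
        using conv[of u x y] by (cases "u = 0"; cases "u = 1") auto
    qed
  qed (use conv in auto)
qed

lemma Gamma0_closed_epigraph:
  assumes \<phi>: "\<phi> \<in> Gamma0 K" and s: "\<And>n. s n \<in> K" "s \<longlonglongrightarrow> w" "w \<in> K"
    and le: "\<And>n. \<phi> (s n) \<le> ereal (c n)" and c: "c \<longlonglongrightarrow> c0"
  shows "\<phi> w \<le> ereal c0"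
proof (rule ccontr)
  assume "\<not> \<phi> w \<le> ereal c0"
  then obtain b where b: "ereal c0 < ereal b" "ereal b < \<phi> w"
    using ereal_dense2[of "ereal c0" "\<phi> w"] by (metis not_le)
  have "lsc_on K \<phi>" using \<phi> by (simp add: Gamma0_def)
  from lsc_onD[OF this s(3) b(2)]
  obtain d where "d > 0" "\<forall>y\<in>K. dist y w < d \<longrightarrow> ereal b < \<phi> y" by blast
  then have "\<forall>\<^sub>F n in sequentially. ereal b < \<phi> (s n)"
    using s(1) eventually_mono[OF tendstoD[OF s(2) \<open>d > 0\<close>], of "\<lambda>n. ereal b < \<phi> (s n)"] by blast
  moreover have "\<forall>\<^sub>F n in sequentially. c n < b"
    using c b order_tendstoD(2) by fastforce
  ultimately have "\<forall>\<^sub>F n in sequentially. False"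
  proof eventually_elim
    case (elim n)
    have "ereal b < ereal (c n)" using elim(1) le[of n] by (rule less_le_trans)
    then show ?case using elim(2) by simp
  qed
  then show False by simp
qed

text \<open>
  Semicontinuity bounds \<open>\<phi>\<close> below near a point \<open>e\<close> of its domain. Along each ray from \<open>e\<close>, convexity
  turns this into a lower bound that decreases at most linearly.
\<close>

lemma Gamma0_affine_lower_bound:
  assumes K: "subspace K" and \<phi>: "\<phi> \<in> Gamma0 K"
  obtains a b e where "\<And>w. w \<in> edom K \<phi> \<Longrightarrow> - a - b * norm (w - e) \<le> real_of_ereal (\<phi> w)"
proof -
  note pr = Gamma0_proper[OF \<phi>]
  define F where "F x = real_of_ereal (\<phi> x)" for x
  have conv: "convex_on (edom K \<phi>) F" unfolding F_def using Gamma0_convex_on[OF K \<phi>] .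
  obtain e where e: "e \<in> edom K \<phi>" using pr by (auto simp: proper_on_def)
  have "ereal (F e - 1) < \<phi> e"
    by (subst proper_on_finite(2)[OF pr e]) (simp add: F_def)
  moreover have "lsc_on K \<phi>" using \<phi> by (simp add: Gamma0_def)
  ultimately obtain d0 where d0: "d0 > 0" "\<forall>y\<in>K. dist y e < d0 \<longrightarrow> ereal (F e - 1) < \<phi> y"
    using lsc_onD[of K \<phi> e "ereal (F e - 1)"] proper_on_finite(1)[OF pr e] by blast
  define d where "d = d0 / 2"
  have d: "d > 0" using d0 by (simp add: d_def)
  have near: "F e - 1 \<le> F y" if "y \<in> edom K \<phi>" "norm (y - e) \<le> d" for y
  proof -
    have "ereal (F e - 1) < \<phi> y"
      using d0 that proper_on_finite(1)[OF pr that(1)] by (auto simp: dist_norm d_def)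
    then show ?thesis unfolding F_def
      by (subst (asm) proper_on_finite(2)[OF pr that(1)]) simp
  qed
  have "- (1 - F e) - (1/d) * norm (w - e) \<le> F w" if w: "w \<in> edom K \<phi>" for w
  proof (cases "norm (w - e) \<le> d")
    case True
    have "0 \<le> (1/d) * norm (w - e)" using d by simp
    then show ?thesis using near[OF w True] by linarith
  next
    case False
    \<comment> \<open>The point at distance \<open>d\<close> from \<open>e\<close> on the segment towards \<open>w\<close>.\<close>
    define t where "t = d / norm (w - e)"
    have "norm (w - e) > d" using False by simp
    moreover from this have "norm (w - e) > 0" using d by linarith
    ultimately have t: "0 < t" "t < 1" using d unfolding t_def by simp_all
    let ?q = "(1 - t) *\<^sub>R e + t *\<^sub>R w"
    have q: "?q \<in> edom K \<phi>"
      using conv e w t unfolding convex_on_def by (simp add: convexD)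
    have "?q - e = t *\<^sub>R (w - e)" by (simp add: algebra_simps)
    then have "norm (?q - e) = t * norm (w - e)" using t by simp
    also have "\<dots> = d" unfolding t_def using False d by auto
    finally have nq: "norm (?q - e) \<le> d" by simp
    have "F e - 1 \<le> (1 - t) * F e + t * F w"
      using near[OF q nq] convex_onD[OF conv, of t e w] e w t by simp
    then have "0 \<le> 1 + t * (F w - F e)" by (simp add: algebra_simps)
    then have "0 \<le> (1 + t * (F w - F e)) / t" using t by simp
    then have "0 \<le> 1 / t + (F w - F e)" using t by (simp add: field_simps)
    moreover have "1 / t = (1/d) * norm (w - e)" unfolding t_def by simp
    ultimately show ?thesis by linarith
  qed
  then show ?thesis using that unfolding F_def by blast
qed

text \<open>
  This is the maximality of the subdifferential in Minty's form.
\<close>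

lemma Gamma0_resolvent_exists:
  assumes K: "subspace K" "complete K" and \<phi>: "\<phi> \<in> Gamma0 K" and t: "t > 0" and y: "y \<in> K"
  obtains p where "p \<in> K" "(1/t) *\<^sub>R (y - p) \<in> subdifferential K \<phi> p"
proof -
  note pr = Gamma0_proper[OF \<phi>]
  obtain a b e where lower: "\<And>w. w \<in> edom K \<phi> \<Longrightarrow> - a - b * norm (w - e) \<le> real_of_ereal (\<phi> w)"
    using Gamma0_affine_lower_bound[OF K(1) \<phi>] by blast
  have closed: "w \<in> edom K \<phi> \<and> real_of_ereal (\<phi> w) \<le> c0"
    if s: "\<And>n. s n \<in> edom K \<phi>" "s \<longlonglongrightarrow> w" "w \<in> K" "\<And>n. real_of_ereal (\<phi> (s n)) \<le> c n" "c \<longlonglongrightarrow> c0"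
    for s w c c0
  proof -
    have le: "\<phi> w \<le> ereal c0"
    proof (rule Gamma0_closed_epigraph[OF \<phi> _ s(2,3) _ s(5)])
      show "s n \<in> K" for n by (rule proper_on_finite(1)[OF pr s(1)])
      show "\<phi> (s n) \<le> ereal (c n)" for n
        by (subst proper_on_finite(2)[OF pr s(1)]) (simp add: s(4))
    qed
    then have w: "w \<in> edom K \<phi>" using s by (auto simp: edom_def)
    show ?thesis using le w by (subst (asm) proper_on_finite(2)[OF pr w]) simp
  qed
  obtain p where p: "p \<in> edom K \<phi>"
    "\<And>w. w \<in> edom K \<phi> \<Longrightarrow> real_of_ereal (\<phi> p) + ((1/t) *\<^sub>R (y - p)) \<bullet> (w - p) \<le> real_of_ereal (\<phi> w)"
  proof (rule convex_resolvent_exists[OF K(2) _ _ Gamma0_convex_on[OF K(1) \<phi>] _ lower t, of y])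
    show "edom K \<phi> \<subseteq> K" using proper_on_finite(1)[OF pr] by blast
    show "edom K \<phi> \<noteq> {}" using pr by (simp add: proper_on_def)
    show "w \<in> edom K \<phi> \<and> real_of_ereal (\<phi> w) \<le> c0"
      if "\<And>n. s n \<in> edom K \<phi>" "s \<longlonglongrightarrow> w" "w \<in> K" "\<And>n. real_of_ereal (\<phi> (s n)) \<le> c n" "c \<longlonglongrightarrow> c0"
      for s w c c0 by (rule closed) (fact that)+
  qed auto
  have pK: "p \<in> K" using proper_on_finite(1)[OF pr p(1)] .
  show ?thesis
  proof (rule that[OF pK subdifferentialI[OF pr p(1)]])
    show "(1/t) *\<^sub>R (y - p) \<in> K" using K y pK by (simp add: subspace_diff subspace_scale)
  qed (use p(2) in \<open>simp add: inner_commute\<close>)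
qed

text \<open>
  The subgradient inequality exceeds the minimal value of the proximal objective at \<open>w\<close> by at least
  \<open>\<parallel>w - p\<parallel>\<^sup>2 / 2\<close>, so the minimizer is unique.
\<close>

lemma prox_eqI:
  assumes \<phi>: "proper_on K \<phi>" and t: "t > 0" and p: "p \<in> K"
    and u: "(1/t) *\<^sub>R (y - p) \<in> subdifferential K \<phi> p"
  shows "prox K (\<lambda>w. ereal t * \<phi> w) y = p"
proof -
  define \<Psi> where "\<Psi> w = ereal t * \<phi> w + ereal ((norm (y - w))\<^sup>2 / 2)" for w
  note pe = subdifferentialD(1)[OF \<phi> p u]
  have \<Psi>: "\<Psi> w = ereal (t * real_of_ereal (\<phi> w) + (norm (y - w))\<^sup>2 / 2)" if "w \<in> edom K \<phi>" for w
    unfolding \<Psi>_def by (subst proper_on_finite(2)[OF \<phi> that]) simp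
  have less: "\<Psi> p < \<Psi> w" if w: "w \<in> K" "w \<noteq> p" for w
  proof (cases "w \<in> edom K \<phi>")
    case True
    have le: "real_of_ereal (\<phi> p) + (w - p) \<bullet> ((1/t) *\<^sub>R (y - p)) \<le> real_of_ereal (\<phi> w)"
      by (rule subdifferentialD(3)[OF \<phi> p u True])
    have "t * real_of_ereal (\<phi> p) + (w - p) \<bullet> (y - p) \<le> t * real_of_ereal (\<phi> w)"
    proof -
      have "t * (real_of_ereal (\<phi> p) + 1/t * ((w - p) \<bullet> (y - p))) \<le> t * real_of_ereal (\<phi> w)"
        using le t by (intro mult_left_mono) (simp_all only: inner_scaleR_right less_imp_le)
      then show ?thesis using t by (simp add: distrib_left)
    qed
    moreover have "(norm (y - w))\<^sup>2 = (norm (y - p))\<^sup>2 + (norm (w - p))\<^sup>2 - 2 * ((w - p) \<bullet> (y - p))"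
      by (simp add: power2_norm_eq_inner inner_diff inner_commute algebra_simps)
    moreover have "(norm (w - p))\<^sup>2 > 0" using w by simp
    ultimately have "t * real_of_ereal (\<phi> p) + (norm (y - p))\<^sup>2 / 2
        < t * real_of_ereal (\<phi> w) + (norm (y - w))\<^sup>2 / 2" by linarith
    then show ?thesis unfolding \<Psi>[OF True] \<Psi>[OF pe] by simp
  next
    case False
    then have "\<phi> w = \<infinity>" using w by (auto simp: edom_def)
    then show ?thesis unfolding \<Psi>[OF pe] using t by (simp add: \<Psi>_def)
  qed
  show ?thesis
    unfolding prox_def is_arg_min_def \<Psi>_def[symmetric]
  proof (rule the_equality)
    show "p \<in> K \<and> \<not> (\<exists>w. w \<in> K \<and> \<Psi> w < \<Psi> p)"
      using p less by (auto dest: less_asym)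
    show "q = p" if "q \<in> K \<and> \<not> (\<exists>w. w \<in> K \<and> \<Psi> w < \<Psi> q)" for q
      using that p less by blast
  qed
qed

lemma fenchel_young: "x \<in> K \<Longrightarrow> ereal (x \<bullet> u) - \<phi> x \<le> conjugate K \<phi> u"
  unfolding conjugate_def by (rule SUP_upper)

lemma conjugate_at_subgradient:
  assumes \<phi>: "proper_on K \<phi>" and x: "x \<in> K" "u \<in> subdifferential K \<phi> x"
  shows "conjugate K \<phi> u = ereal (x \<bullet> u - real_of_ereal (\<phi> x))"
proof (rule antisym)
  note xe = subdifferentialD(1)[OF \<phi> x]
  show "conjugate K \<phi> u \<le> ereal (x \<bullet> u - real_of_ereal (\<phi> x))"
    unfolding conjugate_def
  proof (rule SUP_least)
    fix y assume y: "y \<in> K"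
    show "ereal (y \<bullet> u) - \<phi> y \<le> ereal (x \<bullet> u - real_of_ereal (\<phi> x))"
    proof (cases "y \<in> edom K \<phi>")
      case True
      show ?thesis
        by (subst proper_on_finite(2)[OF \<phi> True])
           (use subdifferentialD(3)[OF \<phi> x True] in \<open>simp add: inner_diff_left\<close>)
    next
      case False
      then have "\<phi> y = \<infinity>" using y by (auto simp: edom_def)
      then show ?thesis by simp
    qed
  qed
  have "ereal (x \<bullet> u) - \<phi> x \<le> conjugate K \<phi> u" using x by (intro fenchel_young)
  then show "ereal (x \<bullet> u - real_of_ereal (\<phi> x)) \<le> conjugate K \<phi> u"
    by (subst (asm) proper_on_finite(2)[OF \<phi> xe]) simp
qed

text \<open>
  Fenchel's inequality holds with equality at a subgradient, and the inequality at the other points says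
  that \<open>x\<close> is a subgradient of the conjugate.
\<close>

lemma conjugate_subgradient:
  assumes \<phi>: "proper_on K \<phi>" and x: "x \<in> K" "u \<in> subdifferential K \<phi> x"
  shows "x \<in> subdifferential K (conjugate K \<phi>) u"
proof -
  note xe = subdifferentialD(1)[OF \<phi> x]
  have "ereal ((w - u) \<bullet> x) + conjugate K \<phi> u \<le> conjugate K \<phi> w" for w
  proof -
    have "ereal ((w - u) \<bullet> x) + conjugate K \<phi> u = ereal (x \<bullet> w) - \<phi> x"
      unfolding conjugate_at_subgradient[OF assms]
      by (subst (2) proper_on_finite(2)[OF \<phi> xe]) (simp add: inner_diff_left inner_diff_right inner_commute)
    also have "\<dots> \<le> conjugate K \<phi> w" using x by (intro fenchel_young)
    finally show ?thesis .
  qed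
  then show ?thesis using x by (simp add: subdifferential_def)
qed

lemma Gamma0_subgradient_exists:
  assumes K: "subspace K" "complete K" and \<phi>: "\<phi> \<in> Gamma0 K"
  obtains x u where "x \<in> K" "u \<in> subdifferential K \<phi> x"
  using Gamma0_resolvent_exists[OF K \<phi>, of 1 0] subspace_0[OF K(1)] by (metis zero_less_one)

lemma conjugate_proper:
  assumes K: "subspace K" "complete K" and \<phi>: "\<phi> \<in> Gamma0 K"
  shows "proper_on K (conjugate K \<phi>)"
proof -
  note pr = Gamma0_proper[OF \<phi>]
  obtain x u where x: "x \<in> K" "u \<in> subdifferential K \<phi> x"
    using Gamma0_subgradient_exists[OF K \<phi>] by blast
  have "conjugate K \<phi> w \<noteq> -\<infinity>" for w
    using fenchel_young[OF x(1), of w \<phi>]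
    by (subst (asm) proper_on_finite(2)[OF pr subdifferentialD(1)[OF pr x]]) auto
  moreover have "u \<in> edom K (conjugate K \<phi>)"
    using conjugate_at_subgradient[OF pr x] subdifferentialD(2)[OF pr x] by (simp add: edom_def)
  ultimately show ?thesis by (auto simp: proper_on_def)
qed

text \<open>
  Only the direction from left to right has content. A point \<open>p\<close> with \<open>x + u - p \<in> \<partial>\<phi> p\<close> exists by
  \<open>Gamma0_resolvent_exists\<close>; monotonicity of the subdifferential of the conjugate then forces \<open>p = x\<close>.
\<close>

lemma subdifferential_conjugate_iff:
  assumes K: "subspace K" "complete K" and \<phi>: "\<phi> \<in> Gamma0 K" and xu: "x \<in> K" "u \<in> K"
  shows "x \<in> subdifferential K (conjugate K \<phi>) u \<longleftrightarrow> u \<in> subdifferential K \<phi> x"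
proof
  note pr = Gamma0_proper[OF \<phi>]
  assume x: "x \<in> subdifferential K (conjugate K \<phi>) u"
  have "x + u \<in> K" using K xu by (simp add: subspace_add)
  then obtain p where p: "p \<in> K" "(1/1) *\<^sub>R (x + u - p) \<in> subdifferential K \<phi> p"
    using Gamma0_resolvent_exists[OF K \<phi>, of 1 "x + u"] by auto
  then have p': "x + u - p \<in> subdifferential K \<phi> p" by simp
  have "0 \<le> (u - (x + u - p)) \<bullet> (x - p)"
    by (rule subdifferential_monotone[OF conjugate_proper[OF K \<phi>] xu(2) x
          subdifferentialD(2)[OF pr p(1) p'] conjugate_subgradient[OF pr p(1) p']])
  then have "(x - p) \<bullet> (x - p) \<le> 0" by (simp add: inner_diff_left inner_diff_right inner_commute)
  then have "x = p" by (metis eq_iff_diff_eq_0 inner_gt_zero_iff not_le)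
  then show "u \<in> subdifferential K \<phi> x" using p' by simp
qed (use conjugate_subgradient[OF Gamma0_proper[OF \<phi>]] xu in blast)

text \<open>
  This is Moreau's decomposition: \<open>p = y - t * q\<close>, where \<open>q\<close> is the resolvent point of \<open>\<phi>\<close> itself
  at \<open>y / t\<close> for the parameter \<open>1 / t\<close>.
\<close>

lemma conjugate_resolvent_exists:
  assumes K: "subspace K" "complete K" and \<phi>: "\<phi> \<in> Gamma0 K" and t: "t > 0" and y: "y \<in> K"
  obtains p where "p \<in> K" "(1/t) *\<^sub>R (y - p) \<in> subdifferential K (conjugate K \<phi>) p"
proof -
  note pr = Gamma0_proper[OF \<phi>]
  have "(1/t) *\<^sub>R y \<in> K" using K y by (simp add: subspace_scale)
  then obtain q where q: "q \<in> K" "(1/(1/t)) *\<^sub>R ((1/t) *\<^sub>R y - q) \<in> subdifferential K \<phi> q"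
    using Gamma0_resolvent_exists[OF K \<phi>, of "1/t"] t by auto
  have eq: "(1/(1/t)) *\<^sub>R ((1/t) *\<^sub>R y - q) = y - t *\<^sub>R q" using t by (simp add: algebra_simps)
  have "(1/t) *\<^sub>R (y - (y - t *\<^sub>R q)) = q" using t by simp
  then show ?thesis
    using that[of "y - t *\<^sub>R q"] conjugate_subgradient[OF pr q] subdifferentialD(2)[OF pr q]
    unfolding eq by simp
qed

lemma subdifferential_minorant:
  assumes \<phi>: "proper_on K \<phi>" and p: "p \<in> K" "u \<in> subdifferential K \<phi> p" and y: "y \<in> K"
  shows "ereal (real_of_ereal (\<phi> p) + (y - p) \<bullet> u) \<le> \<phi> y"
proof -
  have "ereal ((y - p) \<bullet> u) + \<phi> p \<le> \<phi> y" using p y by (simp add: subdifferential_def)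
  then show ?thesis
    by (subst (asm) proper_on_finite(2)[OF \<phi> subdifferentialD(1)[OF \<phi> p]]) (simp add: add.commute)
qed

text \<open>
  Adding the two subgradient inequalities for the same \<open>v\<close> bounds every competitor in the
  infimum from below; at the point \<open>a + b\<close> the bound is attained by the splitting into \<open>a\<close> and \<open>b\<close>.
\<close>

lemma infconv_common_subgradient:
  assumes \<phi>: "proper_on K \<phi>" and \<psi>: "proper_on K \<psi>" and K: "subspace K"
    and a: "a \<in> K" "v \<in> subdifferential K \<phi> a" and b: "b \<in> K" "v \<in> subdifferential K \<psi> b"
  shows infconv_minorant: "\<And>y. y \<in> K \<Longrightarrow>
      ereal (real_of_ereal (\<phi> a) + real_of_ereal (\<psi> b) + (y - (a + b)) \<bullet> v) \<le> infconv K \<phi> \<psi> y"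
    and infconv_exact: "infconv K \<phi> \<psi> (a + b) = ereal (real_of_ereal (\<phi> a) + real_of_ereal (\<psi> b))"
proof -
  have lower: "ereal (real_of_ereal (\<phi> a) + real_of_ereal (\<psi> b) + (y - (a + b)) \<bullet> v) \<le> infconv K \<phi> \<psi> y"
    if y: "y \<in> K" for y
    unfolding infconv_def
  proof (rule INF_greatest)
    fix w assume w: "w \<in> K"
    have "y - w \<in> K" using K y w by (simp add: subspace_diff)
    then have "ereal (real_of_ereal (\<phi> a) + (w - a) \<bullet> v) + ereal (real_of_ereal (\<psi> b) + (y - w - b) \<bullet> v)
        \<le> \<phi> w + \<psi> (y - w)"
      by (intro add_mono subdifferential_minorant[OF \<phi> a w] subdifferential_minorant[OF \<psi> b])
    then show "ereal (real_of_ereal (\<phi> a) + real_of_ereal (\<psi> b) + (y - (a + b)) \<bullet> v) \<le> \<phi> w + \<psi> (y - w)"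
      by (simp add: inner_diff_left inner_add_left algebra_simps)
  qed
  then show "\<And>y. y \<in> K \<Longrightarrow>
      ereal (real_of_ereal (\<phi> a) + real_of_ereal (\<psi> b) + (y - (a + b)) \<bullet> v) \<le> infconv K \<phi> \<psi> y" .
  show "infconv K \<phi> \<psi> (a + b) = ereal (real_of_ereal (\<phi> a) + real_of_ereal (\<psi> b))"
  proof (rule antisym)
    have "infconv K \<phi> \<psi> (a + b) \<le> \<phi> a + \<psi> (a + b - a)"
      unfolding infconv_def by (rule INF_lower[OF a(1)])
    also have "\<dots> = \<phi> a + \<psi> b" by simp
    also have "\<dots> = ereal (real_of_ereal (\<phi> a)) + ereal (real_of_ereal (\<psi> b))"
      by (simp only: proper_on_finite(3)[OF \<phi> subdifferentialD(1)[OF \<phi> a]]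
          proper_on_finite(3)[OF \<psi> subdifferentialD(1)[OF \<psi> b]])
    finally show "infconv K \<phi> \<psi> (a + b) \<le> ereal (real_of_ereal (\<phi> a) + real_of_ereal (\<psi> b))" by simp
    show "ereal (real_of_ereal (\<phi> a) + real_of_ereal (\<psi> b)) \<le> infconv K \<phi> \<psi> (a + b)"
      using lower[of "a + b"] K a b by (simp add: subspace_add)
  qed
qed

lemma prox_Gamma0:
  assumes K: "subspace K" "complete K" and \<phi>: "\<phi> \<in> Gamma0 K" and t: "t > 0" and y: "y \<in> K"
  shows "prox K (\<lambda>w. ereal t * \<phi> w) y \<in> K \<and>
    (1/t) *\<^sub>R (y - prox K (\<lambda>w. ereal t * \<phi> w) y) \<in> subdifferential K \<phi> (prox K (\<lambda>w. ereal t * \<phi> w) y)"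
proof -
  obtain p where p: "p \<in> K" "(1/t) *\<^sub>R (y - p) \<in> subdifferential K \<phi> p"
    using Gamma0_resolvent_exists[OF K \<phi> t y] .
  then show ?thesis using prox_eqI[OF Gamma0_proper[OF \<phi>] t p] by simp
qed

lemma prox_conjugate:
  assumes K: "subspace K" "complete K" and \<phi>: "\<phi> \<in> Gamma0 K" and t: "t > 0" and y: "y \<in> K"
  shows "prox K (\<lambda>w. ereal t * conjugate K \<phi> w) y \<in> K \<and>
    (1/t) *\<^sub>R (y - prox K (\<lambda>w. ereal t * conjugate K \<phi> w) y)
      \<in> subdifferential K (conjugate K \<phi>) (prox K (\<lambda>w. ereal t * conjugate K \<phi> w) y)"
proof -
  obtain p where p: "p \<in> K" "(1/t) *\<^sub>R (y - p) \<in> subdifferential K (conjugate K \<phi>) p"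
    using conjugate_resolvent_exists[OF K \<phi> t y] .
  then show ?thesis using prox_eqI[OF conjugate_proper[OF K \<phi>] t p] by simp
qed

section \<open>Strong and uniform convexity, gradients\<close>

text \<open>
  Subtracting the quadratic leaves a function \<open>q\<close> in \<open>Gamma0 K\<close>. The resolvent of \<open>q\<close> at \<open>u / \<sigma>\<close> for the
  parameter \<open>1 / \<sigma>\<close> gives a point \<open>x\<close> with \<open>u - \<sigma> * x \<in> \<partial>q x\<close>, and adding the quadratic back
  sharpens the subgradient inequality of \<open>u\<close> at \<open>x\<close>.
\<close>

lemma strongly_convex_minorant:
  assumes K: "subspace K" "complete K" and \<phi>: "\<phi> \<in> Gamma0 K"
    and strong: "strongly_convex_on K \<sigma> \<phi>" and \<sigma>: "\<sigma> > 0" and u: "u \<in> K"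
  obtains x where "x \<in> edom K \<phi>"
    "\<And>y. y \<in> edom K \<phi> \<Longrightarrow>
       real_of_ereal (\<phi> x) + (y - x) \<bullet> u + \<sigma> / 2 * (norm (y - x))\<^sup>2 \<le> real_of_ereal (\<phi> y)"
proof -
  note pr = Gamma0_proper[OF \<phi>]
  define q where "q w = \<phi> w - ereal (\<sigma> * (norm w)\<^sup>2 / 2)" for w
  have "q w < \<infinity> \<longleftrightarrow> \<phi> w < \<infinity>" for w unfolding q_def by (cases "\<phi> w") auto
  then have dom: "edom K q = edom K \<phi>" unfolding edom_def by simp
  have q_real: "real_of_ereal (q w) = real_of_ereal (\<phi> w) - \<sigma> * (norm w)\<^sup>2 / 2" if "w \<in> edom K \<phi>" for w
    unfolding q_def by (subst proper_on_finite(2)[OF pr that]) simp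
  have "lsc_on K q"
  proof (rule lsc_onI)
    fix x and c :: ereal assume x: "x \<in> K" and c: "c < q x"
    obtain b where b: "c < ereal b" "ereal b < q x"
      using ereal_dense2[OF c] by blast
    \<comment> \<open>Between \<open>b + s x\<close> and \<open>\<phi> x\<close> there is room for an oscillation \<open>e\<close> of the continuous function \<open>s\<close>.\<close>
    define s where "s w = \<sigma> * (norm w)\<^sup>2 / 2" for w :: 'a
    have "ereal b + ereal (s x) < \<phi> x"
      using b(2) unfolding q_def s_def by (cases "\<phi> x") auto
    then obtain a where a: "ereal (b + s x) < ereal a" "ereal a < \<phi> x"
      using ereal_dense2[of "ereal (b + s x)" "\<phi> x"] by auto
    define e where "e = a - b - s x"
    have e: "e > 0" using a(1) by (simp add: e_def)
    have "lsc_on K \<phi>" using \<phi> by (simp add: Gamma0_def)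
    from lsc_onD[OF this x a(2)] obtain d1 where d1: "d1 > 0" "\<forall>y\<in>K. dist y x < d1 \<longrightarrow> ereal a < \<phi> y"
      by blast
    have "isCont s x" unfolding s_def by (intro continuous_intros) auto
    then obtain d2 where d2: "d2 > 0" "\<forall>y. dist y x < d2 \<longrightarrow> dist (s y) (s x) < e"
      using e unfolding continuous_at_eps_delta by blast
    have "c < q y" if y: "y \<in> K" "dist y x < min d1 d2" for y
    proof -
      have 1: "ereal a < \<phi> y" using d1 y by simp
      have 2: "s y < s x + e" using d2 y by (auto simp: dist_real_def)
      have "ereal b < q y"
        unfolding q_def s_def[symmetric] using 1 2 by (cases "\<phi> y") (auto simp: e_def)
      then show ?thesis using b(1) by (rule less_trans[rotated])
    qed
    then show "\<exists>d>0. \<forall>y\<in>K. dist y x < d \<longrightarrow> c < q y"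
      using d1 d2 by (intro exI[of _ "min d1 d2"]) auto
  qed
  moreover have "q w \<noteq> -\<infinity>" if "w \<in> K" for w
    using pr that unfolding q_def proper_on_def by (cases "\<phi> w") auto
  ultimately have q: "q \<in> Gamma0 K"
    using strong pr unfolding Gamma0_def strongly_convex_on_def q_def[symmetric] proper_on_def by (simp add: dom)
  have "(1/\<sigma>) *\<^sub>R u \<in> K" using K u by (simp add: subspace_scale)
  then obtain x where x: "x \<in> K" "(1/(1/\<sigma>)) *\<^sub>R ((1/\<sigma>) *\<^sub>R u - x) \<in> subdifferential K q x"
    using Gamma0_resolvent_exists[OF K q, of "1/\<sigma>"] \<sigma> by auto
  have eq: "(1/(1/\<sigma>)) *\<^sub>R ((1/\<sigma>) *\<^sub>R u - x) = u - \<sigma> *\<^sub>R x" using \<sigma> by (simp add: algebra_simps)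
  note x = x[unfolded eq]
  have xd: "x \<in> edom K \<phi>" using subdifferentialD(1)[OF Gamma0_proper[OF q] x] by (simp add: dom)
  show ?thesis
  proof (rule that[OF xd])
    fix y assume y: "y \<in> edom K \<phi>"
    have "real_of_ereal (q x) + (y - x) \<bullet> (u - \<sigma> *\<^sub>R x) \<le> real_of_ereal (q y)"
      using subdifferentialD(3)[OF Gamma0_proper[OF q] x] y by (simp add: dom)
    moreover have "\<sigma> / 2 * (norm (y - x))\<^sup>2 = \<sigma> * (norm y)\<^sup>2 / 2 - \<sigma> * (norm x)\<^sup>2 / 2 - \<sigma> * ((y - x) \<bullet> x)"
      by (simp add: power2_norm_eq_inner inner_diff inner_commute algebra_simps)
    ultimately show "real_of_ereal (\<phi> x) + (y - x) \<bullet> u + \<sigma> / 2 * (norm (y - x))\<^sup>2 \<le> real_of_ereal (\<phi> y)"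
      unfolding q_real[OF xd] q_real[OF y] inner_diff_right inner_scaleR_right by linarith
  qed
qed

lemma quadratic_remainder_has_derivative:
  fixes F :: "'a::real_inner \<Rightarrow> real"
  assumes "\<And>y. y \<in> K \<Longrightarrow> \<bar>F y - F x - (y - x) \<bullet> u\<bar> \<le> C * (norm (y - x))\<^sup>2"
  shows "(F has_derivative (\<lambda>d. d \<bullet> u)) (at x within K)"
  unfolding has_derivative_within_alt
proof (intro conjI allI impI)
  show "bounded_linear (\<lambda>d. d \<bullet> u)" by (rule bounded_linear_inner_left)
  fix e :: real assume e: "e > 0"
  define \<delta> where "\<delta> = e / (\<bar>C\<bar> + 1)"
  have "norm (F y - F x - (y - x) \<bullet> u) \<le> e * norm (y - x)" if y: "y \<in> K" "norm (y - x) < \<delta>" for y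
  proof -
    have "\<bar>F y - F x - (y - x) \<bullet> u\<bar> \<le> C * (norm (y - x))\<^sup>2" by (rule assms[OF y(1)])
    also have "\<dots> \<le> (\<bar>C\<bar> + 1) * (norm (y - x))\<^sup>2" by (intro mult_right_mono) auto
    also have "\<dots> = ((\<bar>C\<bar> + 1) * norm (y - x)) * norm (y - x)" by (simp add: power2_eq_square)
    also have "\<dots> \<le> ((\<bar>C\<bar> + 1) * \<delta>) * norm (y - x)"
      using y by (intro mult_right_mono mult_left_mono) auto
    also have "(\<bar>C\<bar> + 1) * \<delta> = e" by (simp add: \<delta>_def)
    finally show ?thesis by simp
  qed
  moreover have "\<delta> > 0" using e by (simp add: \<delta>_def)
  ultimately show "\<exists>d>0. \<forall>y\<in>K. norm (y - x) < d \<longrightarrow> norm (F y - F x - (y - x) \<bullet> u) \<le> e * norm (y - x)"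
    by blast
qed

text \<open>
  Let \<open>T u\<close> be the point at which \<open>u\<close> is a subgradient. The sharpened subgradient inequalities at \<open>T u\<close> and
  \<open>T w\<close> add up to \<open>\<sigma> * \<parallel>T u - T w\<parallel>\<^sup>2 \<le> (T u - T w) \<bullet> (u - w)\<close>, hence \<open>T\<close> is Lipschitz. As \<open>T u\<close> is a
  subgradient of the conjugate at \<open>u\<close>, the linearization error of the conjugate is quadratic, and so
  \<open>T u\<close> is the gradient.
\<close>

lemma grad_conjugate_strongly_convex:
  assumes K: "subspace K" "complete K" and \<phi>: "\<phi> \<in> Gamma0 K"
    and strong: "strongly_convex_on K \<sigma> \<phi>" and \<sigma>: "\<sigma> > 0"
  shows grad_conjugate_in_subdifferential:
      "\<And>u. u \<in> K \<Longrightarrow> grad_conjugate K \<phi> u \<in> subdifferential K (conjugate K \<phi>) u"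
    and grad_conjugate_unique:
      "\<And>u x. \<lbrakk>u \<in> K; x \<in> K; u \<in> subdifferential K \<phi> x\<rbrakk> \<Longrightarrow> grad_conjugate K \<phi> u = x"
    and grad_conjugate_lipschitz:
      "\<And>u w. \<lbrakk>u \<in> K; w \<in> K\<rbrakk> \<Longrightarrow> norm (grad_conjugate K \<phi> u - grad_conjugate K \<phi> w) \<le> (1/\<sigma>) * norm (u - w)"
proof -
  note pr = Gamma0_proper[OF \<phi>]
  let ?F = "\<lambda>x. real_of_ereal (\<phi> x)"
  have "\<exists>x. x \<in> edom K \<phi> \<and> (\<forall>y\<in>edom K \<phi>. ?F x + (y - x) \<bullet> u + \<sigma> / 2 * (norm (y - x))\<^sup>2 \<le> ?F y)"
    if "u \<in> K" for u
    using strongly_convex_minorant[OF K \<phi> strong \<sigma> that] by metis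
  then obtain T where Td: "\<And>u. u \<in> K \<Longrightarrow> T u \<in> edom K \<phi>"
    and T: "\<And>u y. u \<in> K \<Longrightarrow> y \<in> edom K \<phi> \<Longrightarrow> ?F (T u) + (y - T u) \<bullet> u + \<sigma> / 2 * (norm (y - T u))\<^sup>2 \<le> ?F y"
    by metis
  have TK: "T u \<in> K" if "u \<in> K" for u using proper_on_finite(1)[OF pr Td[OF that]] .
  have Tsub: "u \<in> subdifferential K \<phi> (T u)" if u: "u \<in> K" for u
  proof (rule subdifferentialI[OF pr Td[OF u] u])
    fix y assume y: "y \<in> edom K \<phi>"
    have "0 \<le> \<sigma> / 2 * (norm (y - T u))\<^sup>2" using \<sigma> by simp
    then show "?F (T u) + (y - T u) \<bullet> u \<le> ?F y" using T[OF u y] by linarith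
  qed
  have lip: "norm (T u - T w) \<le> (1/\<sigma>) * norm (u - w)" if uw: "u \<in> K" "w \<in> K" for u w
  proof -
    have "?F (T u) + (T w - T u) \<bullet> u + \<sigma> / 2 * (norm (T w - T u))\<^sup>2 \<le> ?F (T w)"
      "?F (T w) + (T u - T w) \<bullet> w + \<sigma> / 2 * (norm (T u - T w))\<^sup>2 \<le> ?F (T u)"
      using T Td uw by blast+
    then have "\<sigma> * (norm (T u - T w))\<^sup>2 \<le> (T u - T w) \<bullet> (u - w)"
      by (simp add: norm_minus_commute inner_diff algebra_simps)
    also have "\<dots> \<le> norm (T u - T w) * norm (u - w)" by (rule norm_cauchy_schwarz)
    finally have "norm (T u - T w) * (\<sigma> * norm (T u - T w)) \<le> norm (T u - T w) * norm (u - w)"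
      by (simp add: power2_eq_square mult_ac)
    then have "\<sigma> * norm (T u - T w) \<le> norm (u - w)"
      by (cases "norm (T u - T w) = 0") (auto simp: mult_le_cancel_left)
    then show ?thesis using \<sigma> by (simp add: field_simps)
  qed
  define C where "C u = T u \<bullet> u - ?F (T u)" for u
  have conj: "conjugate K \<phi> u = ereal (C u)" if u: "u \<in> K" for u
    unfolding C_def using conjugate_at_subgradient[OF pr TK[OF u] Tsub[OF u]] .
  have lower: "C u + (w - u) \<bullet> T u \<le> C w" if u: "u \<in> K" and w: "w \<in> K" for u w
    using subdifferentialD(3)[OF pr TK[OF w] Tsub[OF w] Td[OF u]]
    by (simp add: C_def inner_diff inner_commute algebra_simps)
  have grad: "grad_conjugate K \<phi> u = T u" if u: "u \<in> K" for u
    unfolding grad_conjugate_def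
  proof (rule gradient_eqI[OF K(1) u TK[OF u]], rule quadratic_remainder_has_derivative)
    fix w assume w: "w \<in> K"
    have "C w - C u - (w - u) \<bullet> T u \<le> (w - u) \<bullet> (T w - T u)"
      using lower[OF w u] by (simp add: inner_diff)
    also have "\<dots> \<le> norm (w - u) * norm (T w - T u)" by (rule norm_cauchy_schwarz)
    also have "\<dots> \<le> norm (w - u) * ((1/\<sigma>) * norm (w - u))"
      using lip[OF w u] by (intro mult_left_mono) auto
    finally have "C w - C u - (w - u) \<bullet> T u \<le> (1/\<sigma>) * (norm (w - u))\<^sup>2"
      by (simp add: power2_eq_square mult_ac)
    then show "\<bar>real_of_ereal (conjugate K \<phi> w) - real_of_ereal (conjugate K \<phi> u) - (w - u) \<bullet> T u\<bar>
        \<le> (1/\<sigma>) * (norm (w - u))\<^sup>2"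
      using lower[OF u w] by (simp add: conj u w)
  qed
  show "grad_conjugate K \<phi> u \<in> subdifferential K (conjugate K \<phi>) u" if "u \<in> K" for u
    unfolding grad[OF that] using conjugate_subgradient[OF pr TK Tsub] that by blast
  show "norm (grad_conjugate K \<phi> u - grad_conjugate K \<phi> w) \<le> (1/\<sigma>) * norm (u - w)"
    if "u \<in> K" "w \<in> K" for u w
    using lip that by (simp add: grad)
  show "grad_conjugate K \<phi> u = x" if u: "u \<in> K" and x: "x \<in> K" "u \<in> subdifferential K \<phi> x" for u x
  proof -
    have "?F x + (T u - x) \<bullet> u \<le> ?F (T u)"
      by (rule subdifferentialD(3)[OF pr x Td[OF u]])
    then have "\<sigma> / 2 * (norm (x - T u))\<^sup>2 \<le> 0"
      using T[OF u subdifferentialD(1)[OF pr x]] by (simp add: inner_diff)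
    then have "(norm (x - T u))\<^sup>2 \<le> 0" using \<sigma> by (simp add: mult_le_0_iff)
    then show ?thesis using grad[OF u] by simp
  qed
qed

text \<open>
  The uniform convexity inequality is used only at the midpoint of \<open>x\<close> and \<open>p\<close>, where the subgradients at
  both ends bound the value from below; the factor \<open>1/4\<close> then cancels.
\<close>

lemma uniformly_convex_modulus:
  assumes \<phi>: "proper_on K \<phi>" and K: "subspace K" and uc: "uniformly_convex_at K \<phi> x" and ub: "ub \<in> subdifferential K \<phi> x"
  obtains \<psi> :: "real \<Rightarrow> ereal" where "mono_on {0..} \<psi>" "\<And>t. t > 0 \<Longrightarrow> 0 < \<psi> t"
    "\<And>p u. \<lbrakk>p \<in> K; u \<in> subdifferential K \<phi> p\<rbrakk> \<Longrightarrow> \<psi> (norm (x - p)) \<le> ereal ((p - x) \<bullet> (u - ub))"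
proof -
  let ?F = "\<lambda>x. real_of_ereal (\<phi> x)"
  obtain \<psi> :: "real \<Rightarrow> ereal" where x: "x \<in> edom K \<phi>"
    and psi: "mono_on {0..} \<psi>" "\<forall>t\<ge>0. 0 \<le> \<psi> t" "\<forall>t\<ge>0. \<psi> t = 0 \<longleftrightarrow> t = 0"
    and ineq: "\<forall>y\<in>edom K \<phi>. \<forall>\<alpha>. 0 < \<alpha> \<and> \<alpha> < 1 \<longrightarrow>
          \<phi> (\<alpha> *\<^sub>R x + (1 - \<alpha>) *\<^sub>R y) + ereal (\<alpha> * (1 - \<alpha>)) * \<psi> (norm (x - y))
            \<le> ereal \<alpha> * \<phi> x + ereal (1 - \<alpha>) * \<phi> y"
    using uc unfolding uniformly_convex_at_def by blast
  have xK: "x \<in> K" using x by (simp add: edom_def)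
  show ?thesis
  proof (rule that[OF psi(1)])
    show "0 < \<psi> t" if "t > 0" for t
      using psi(2,3) that by (metis less_eq_real_def order_le_less less_irrefl)
    fix p u assume p: "p \<in> K" "u \<in> subdifferential K \<phi> p"
    have pd: "p \<in> edom K \<phi>" by (rule subdifferentialD(1)[OF \<phi> p])
    let ?q = "(1/2) *\<^sub>R x + (1 - 1/2) *\<^sub>R p"
    have qK: "?q \<in> K" using K xK p by (simp add: subspace_add subspace_scale)
    have rhs: "ereal (1/2) * \<phi> x + ereal (1 - 1/2) * \<phi> p = ereal ((?F x + ?F p) / 2)"
      by (subst proper_on_finite(2)[OF \<phi> x], subst proper_on_finite(2)[OF \<phi> pd]) (simp add: add_divide_distrib)
    have "\<phi> ?q + ereal (1/2 * (1 - 1/2)) * \<psi> (norm (x - p)) \<le> ereal (1/2) * \<phi> x + ereal (1 - 1/2) * \<phi> p"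
      using ineq pd by (auto dest!: bspec[where x = p] spec[where x = "1/2"])
    then have main: "\<phi> ?q + ereal (1/4) * \<psi> (norm (x - p)) \<le> ereal ((?F x + ?F p) / 2)"
      unfolding rhs by simp
    have psi0: "0 \<le> ereal (1/4) * \<psi> (norm (x - p))" using psi(2) by simp
    have "\<phi> ?q \<le> \<phi> ?q + ereal (1/4) * \<psi> (norm (x - p))" using psi0 by (simp add: ereal_le_add_self)
    then have qd: "?q \<in> edom K \<phi>" using main qK unfolding edom_def by (auto intro: le_less_trans)
    have h1: "?q - x = (1/2) *\<^sub>R (p - x)" and h2: "?q - p = - ((1/2) *\<^sub>R (p - x))"
      by (simp_all add: algebra_simps flip: scaleR_add_left)
    have "?F x + (?q - x) \<bullet> ub \<le> ?F ?q" by (rule subdifferentialD(3)[OF \<phi> xK ub qd])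
    then have 1: "?F x + (1/2) * ((p - x) \<bullet> ub) \<le> ?F ?q" unfolding h1 by simp
    have "?F p + (?q - p) \<bullet> u \<le> ?F ?q" by (rule subdifferentialD(3)[OF \<phi> p qd])
    then have 2: "?F p - (1/2) * ((p - x) \<bullet> u) \<le> ?F ?q" unfolding h2 by simp
    have "ereal (?F ?q) + ereal (1/4) * \<psi> (norm (x - p)) \<le> ereal ((?F x + ?F p) / 2)"
      using main by (subst proper_on_finite(3)[OF \<phi> qd])
    then show "\<psi> (norm (x - p)) \<le> ereal ((p - x) \<bullet> (u - ub))"
    proof (cases "\<psi> (norm (x - p))")
      case (real s)
      then have "?F ?q + s / 4 \<le> (?F x + ?F p) / 2"
        using \<open>ereal (?F ?q) + ereal (1/4) * \<psi> (norm (x - p)) \<le> ereal ((?F x + ?F p) / 2)\<close> by simp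
      then have "s \<le> (p - x) \<bullet> (u - ub)" using 1 2 unfolding inner_diff_right by argo
      then show ?thesis using real by simp
    qed auto
  qed
qed

text \<open>
  The modulus is monotone, so a distance that stays above \<open>e\<close> would keep the monotonicity term above
  \<open>\<psi> e > 0\<close>.
\<close>

lemma uniformly_convex_strong_convergence:
  assumes \<phi>: "proper_on K \<phi>" and K: "subspace K" and uc: "uniformly_convex_at K \<phi> x"
    and ub: "ub \<in> subdifferential K \<phi> x"
    and p: "\<And>n. p n \<in> K" "\<And>n. u n \<in> subdifferential K \<phi> (p n)"
    and le: "\<And>n. (p n - x) \<bullet> (u n - ub) \<le> t n" and t: "t \<longlonglongrightarrow> 0"
  shows "p \<longlonglongrightarrow> x"
proof (rule tendstoI)
  fix e :: real assume e: "e > 0"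
  obtain \<psi> :: "real \<Rightarrow> ereal" where psi: "mono_on {0..} \<psi>" "\<And>t. t > 0 \<Longrightarrow> 0 < \<psi> t"
    "\<And>p u. \<lbrakk>p \<in> K; u \<in> subdifferential K \<phi> p\<rbrakk> \<Longrightarrow> \<psi> (norm (x - p)) \<le> ereal ((p - x) \<bullet> (u - ub))"
    using uniformly_convex_modulus[OF \<phi> K uc ub] by metis
  obtain b where b: "0 < ereal b" "ereal b < \<psi> e" using ereal_dense2[OF psi(2)[OF e]] by blast
  have "\<forall>\<^sub>F n in sequentially. t n < b" using order_tendstoD(2)[OF t] b(1) by simp
  then show "\<forall>\<^sub>F n in sequentially. dist (p n) x < e"
  proof eventually_elim
    case (elim n)
    show ?case
    proof (rule ccontr)
      assume "\<not> dist (p n) x < e"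
      then have "e \<le> norm (x - p n)" by (simp add: dist_norm norm_minus_commute)
      then have "\<psi> e \<le> \<psi> (norm (x - p n))" using psi(1) e by (auto intro: mono_onD)
      also have "\<dots> \<le> ereal ((p n - x) \<bullet> (u n - ub))" using psi(3) p by blast
      also have "\<dots> \<le> ereal (t n)" using le by simp
      also have "\<dots> < ereal b" using elim by simp
      finally show False using b(2) by simp
    qed
  qed
qed

text \<open>
  The gradient is defined as the representing vector of the derivative, which exists by the Riesz
  representation theorem.
\<close>

lemma gradient_has_derivative:
  fixes h :: "'a::{real_inner, banach} \<Rightarrow> real"
  assumes "h differentiable (at x)"
  shows "(h has_derivative (\<lambda>d. d \<bullet> gradient UNIV h x)) (at x)"
proof -
  obtain D where D: "(h has_derivative D) (at x)" using assms by (auto simp: differentiable_def)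
  then interpret D: bounded_linear D by (rule has_derivative_bounded_linear)
  obtain C where C: "\<And>d. norm (D d) \<le> norm d * C" using D.bounded by blast
  obtain u where u: "\<And>d. D d = d \<bullet> u"
    by (rule riesz_representation_on[OF subspace_UNIV complete_UNIV, of D C])
       (use C in \<open>auto simp: D.add D.scaleR mult.commute\<close>)
  have "D = (\<lambda>d. d \<bullet> u)" by (rule ext) (rule u)
  then have hu: "(h has_derivative (\<lambda>d. d \<bullet> u)) (at x)" using D by (rule back_subst[of "\<lambda>D. (h has_derivative D) (at x)", rotated])
  have "gradient UNIV h x = u" by (rule gradient_eqI[OF subspace_UNIV UNIV_I UNIV_I hu])
  then show ?thesis using hu by (simp only:)
qed

lemma gradient_in_subdifferential:
  fixes h :: "'a::{real_inner, banach} \<Rightarrow> real"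
  assumes conv: "convex_on UNIV h" and diff: "h differentiable (at x)"
  shows "gradient UNIV h x \<in> subdifferential UNIV (\<lambda>x. ereal (h x)) x"
proof -
  have "h x + (y - x) \<bullet> gradient UNIV h x \<le> h y" for y
  proof -
    let ?c = "\<lambda>t::real. x + t *\<^sub>R (y - x)"
    have "((h \<circ> ?c) has_derivative (\<lambda>d. d \<bullet> gradient UNIV h x) \<circ> (\<lambda>t. t *\<^sub>R (y - x))) (at 0)"
      by (rule diff_chain_at) (auto intro!: derivative_eq_intros simp: gradient_has_derivative[OF diff])
    moreover have "(\<lambda>d. d \<bullet> gradient UNIV h x) \<circ> (\<lambda>t. t *\<^sub>R (y - x)) = (*) ((y - x) \<bullet> gradient UNIV h x)"
      by (rule ext) simp
    ultimately have "((h \<circ> ?c) has_field_derivative ((y - x) \<bullet> gradient UNIV h x)) (at 0)"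
      unfolding has_field_derivative_def by (simp only:)
    moreover have "convex_on UNIV (h \<circ> ?c)"
    proof (rule convex_onI)
      fix t a b :: real assume t: "0 < t" "t < 1"
      have "?c ((1 - t) *\<^sub>R a + t *\<^sub>R b) = (1 - t) *\<^sub>R ?c a + t *\<^sub>R ?c b" by (simp add: algebra_simps)
      then show "(h \<circ> ?c) ((1 - t) *\<^sub>R a + t *\<^sub>R b) \<le> (1 - t) * (h \<circ> ?c) a + t * (h \<circ> ?c) b"
        using convex_onD[OF conv, of t "?c a" "?c b"] t by simp
    qed simp
    ultimately have "(h \<circ> ?c) 1 - (h \<circ> ?c) 0 \<ge> ((y - x) \<bullet> gradient UNIV h x) * (1 - 0)"
      using convex_on_imp_above_tangent[of UNIV "h \<circ> ?c" 0 1 "(y - x) \<bullet> gradient UNIV h x"]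
      by (simp del: o_apply)
    then show ?thesis by simp
  qed
  then show ?thesis by (simp add: subdifferential_def add.commute)
qed

section \<open>The forward-backward-forward method with summable errors\<close>

text \<open>
  Subtracting the partial sums of the errors makes the sequence decreasing.
\<close>

lemma quasi_fejer_convergent:
  fixes a e :: "nat \<Rightarrow> real"
  assumes a: "\<And>n. 0 \<le> a n" and e: "summable e"
    and step: "\<And>n. a (Suc n) \<le> a n + e n"
  shows "convergent a"
proof -
  define b where "b n = a n - (\<Sum>k<n. e k)" for n
  have es: "(\<lambda>n. \<Sum>k<n. e k) \<longlonglongrightarrow> suminf e" using e by (rule summable_LIMSEQ)
  then obtain M where M: "\<And>n. norm (\<Sum>k<n. e k) \<le> M"
    using convergent_imp_Bseq[OF convergentI[OF es]] by (auto simp: Bseq_def)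
  have "decseq b" by (rule decseq_SucI) (use step in \<open>simp add: b_def\<close>, smt (verit))
  moreover have "- M \<le> b n" for n using a[of n] M[of n] by (simp add: b_def)
  ultimately obtain L where "b \<longlonglongrightarrow> L" using decseq_convergent by metis
  from tendsto_add[OF this es] have "a \<longlonglongrightarrow> L + suminf e" by (simp add: b_def)
  then show ?thesis by (rule convergentI)
qed

text \<open>
  The decrements telescope against the values of \<open>s\<close>, up to the total error.
\<close>

lemma quasi_fejer_summable:
  fixes s d e :: "nat \<Rightarrow> real"
  assumes s: "\<And>n. 0 \<le> s n" and d: "\<And>n. 0 \<le> d n" and e: "summable e"
    and step: "\<And>n. s (Suc n) \<le> s n - d n + e n"
  shows "summable d"
proof -
  have es: "(\<lambda>n. \<Sum>k<n. e k) \<longlonglongrightarrow> suminf e" using e by (rule summable_LIMSEQ)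
  then obtain M where M: "\<And>n. norm (\<Sum>k<n. e k) \<le> M"
    using convergent_imp_Bseq[OF convergentI[OF es]] by (auto simp: Bseq_def)
  have "(\<Sum>k<n. d k) \<le> s 0 - s n + (\<Sum>k<n. e k)" for n
  proof (induction n)
    case (Suc n)
    then show ?case using step[of n] by simp
  qed simp
  then have "(\<Sum>k<n. d k) \<le> s 0 + M" for n
    using s[of n] M[of n] by (smt (verit) real_norm_def)
  then show ?thesis using d by (intro summableI_nonneg_bounded) auto
qed

text \<open>
  If \<open>x\<close> and \<open>w\<close> are weak cluster points, the difference of the squared distances to them converges and is
  affine in \<open>X n\<close> with slope along \<open>x - w\<close>, so the inner products with \<open>x - w\<close> converge. Their limit
  can be computed along either subsequence, which gives \<open>x = w\<close>.
\<close>

lemma opial_weak_convergence: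
  fixes X :: "nat \<Rightarrow> 'a::real_inner"
  assumes K: "subspace K" "complete K" and X: "\<And>n. X n \<in> K"
    and Z: "Z \<noteq> {}" "Z \<subseteq> K"
    and conv: "\<And>w. w \<in> Z \<Longrightarrow> convergent (\<lambda>n. norm (X n - w))"
    and cluster: "\<And>r w. \<lbrakk>strict_mono (r :: nat \<Rightarrow> nat); w \<in> K; weakly_tendsto K (X \<circ> r) w\<rbrakk> \<Longrightarrow> w \<in> Z"
  obtains x where "x \<in> Z" "weakly_tendsto K X x"
proof -
  obtain w0 where w0: "w0 \<in> Z" using Z by blast
  from convergent_imp_Bseq[OF conv[OF w0]] obtain B where B: "\<And>n. norm (norm (X n - w0)) \<le> B"
    by (auto simp: Bseq_def)
  have M: "norm (X n) \<le> norm w0 + B" for n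
    using B[of n] norm_triangle_sub[of "X n" w0] by simp
  have unique: "x = w" if r: "strict_mono r" "x \<in> K" "weakly_tendsto K (X \<circ> r) x"
    and s: "strict_mono s" "w \<in> K" "weakly_tendsto K (X \<circ> s) w" for r s :: "nat \<Rightarrow> nat" and x w
  proof -
    have xw: "x \<in> Z" "w \<in> Z" using r s cluster by blast+
    have d: "x - w \<in> K" using K r s by (simp add: subspace_diff)
    \<comment> \<open>The polarization that expresses the inner product by the two distances.\<close>
    have eq: "X n \<bullet> (x - w) = ((norm (X n - w))\<^sup>2 - (norm (X n - x))\<^sup>2 + (norm x)\<^sup>2 - (norm w)\<^sup>2) / 2" for n
      by (simp add: power2_norm_eq_inner inner_diff inner_commute)
    obtain a b where "(\<lambda>n. norm (X n - w)) \<longlonglongrightarrow> a" "(\<lambda>n. norm (X n - x)) \<longlonglongrightarrow> b"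
      using conv[OF xw(1)] conv[OF xw(2)] unfolding convergent_def by blast
    then have "(\<lambda>n. X n \<bullet> (x - w)) \<longlonglongrightarrow> (a\<^sup>2 - b\<^sup>2 + (norm x)\<^sup>2 - (norm w)\<^sup>2) / 2"
      unfolding eq by (intro tendsto_intros) auto
    then obtain c where c: "(\<lambda>n. X n \<bullet> (x - w)) \<longlonglongrightarrow> c" by blast
    have "(\<lambda>n. X (r n) \<bullet> (x - w)) \<longlonglongrightarrow> c" "(\<lambda>n. X (s n) \<bullet> (x - w)) \<longlonglongrightarrow> c"
      using LIMSEQ_subseq_LIMSEQ[OF c] r s by (auto simp: o_def)
    moreover have "(\<lambda>n. X (r n) \<bullet> (x - w)) \<longlonglongrightarrow> x \<bullet> (x - w)" "(\<lambda>n. X (s n) \<bullet> (x - w)) \<longlonglongrightarrow> w \<bullet> (x - w)"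
      using r s d by (auto simp: weakly_tendsto_def o_def)
    ultimately have "x \<bullet> (x - w) = w \<bullet> (x - w)" by (metis LIMSEQ_unique)
    then have "(x - w) \<bullet> (x - w) = 0" by (simp add: inner_diff_left)
    then show ?thesis by simp
  qed
  obtain r x where r: "strict_mono (r :: nat \<Rightarrow> nat)" "x \<in> K" "weakly_tendsto K (X \<circ> r) x"
    by (rule bounded_weakly_convergent_subsequence[OF K X M])
  have "weakly_tendsto K X x"
    unfolding weakly_tendsto_def
  proof (intro ballI, rule ccontr)
    fix u assume u: "u \<in> K" and not: "\<not> (\<lambda>n. X n \<bullet> u) \<longlonglongrightarrow> x \<bullet> u"
    then obtain e where e: "e > 0" "\<forall>N. \<exists>n\<ge>N. \<not> dist (X n \<bullet> u) (x \<bullet> u) < e"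
      unfolding LIMSEQ_def by blast
    then have "infinite {n. \<not> dist (X n \<bullet> u) (x \<bullet> u) < e}"
      unfolding infinite_nat_iff_unbounded_le by blast
    then obtain s :: "nat \<Rightarrow> nat" where s: "strict_mono s" "\<And>n. \<not> dist (X (s n) \<bullet> u) (x \<bullet> u) < e"
      using infinite_enumerate[of "{n. \<not> dist (X n \<bullet> u) (x \<bullet> u) < e}"] by auto
    obtain r' w where r': "strict_mono (r' :: nat \<Rightarrow> nat)" "w \<in> K" "weakly_tendsto K ((X \<circ> s) \<circ> r') w"
    proof (rule bounded_weakly_convergent_subsequence[OF K])
      show "(X \<circ> s) n \<in> K" "norm ((X \<circ> s) n) \<le> norm w0 + B" for n
        using X M by simp_all
    qed
    have "x = w"
      using unique[OF r, of "s \<circ> r'" w] r' s by (auto simp: strict_mono_o o_assoc)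
    then have "(\<lambda>n. X (s (r' n)) \<bullet> u) \<longlonglongrightarrow> x \<bullet> u"
      using r' u by (auto simp: weakly_tendsto_def)
    then have "\<forall>\<^sub>F n in sequentially. dist (X (s (r' n)) \<bullet> u) (x \<bullet> u) < e"
      using e by (intro tendstoD)
    then show False using s by (auto dest: eventually_happens)
  qed
  then show ?thesis using that cluster[OF r] by blast
qed

lemma weakly_tendsto_null_diff:
  assumes X: "weakly_tendsto K X x" and d: "(\<lambda>n. Y n - X n) \<longlonglongrightarrow> 0"
  shows "weakly_tendsto K Y x"
  unfolding weakly_tendsto_def
proof
  fix u assume "u \<in> K"
  then have "(\<lambda>n. X n \<bullet> u) \<longlonglongrightarrow> x \<bullet> u" using X by (simp add: weakly_tendsto_def)
  from tendsto_add[OF this tendsto_inner[OF d tendsto_const[of u]]] show "(\<lambda>n. Y n \<bullet> u) \<longlonglongrightarrow> x \<bullet> u" by (simp add: inner_diff_left)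
qed

lemma summable_power2:
  fixes a :: "nat \<Rightarrow> real"
  assumes a: "summable a" "\<And>n. 0 \<le> a n"
  shows "summable (\<lambda>n. (a n)\<^sup>2)"
proof -
  obtain M where M: "\<And>n. norm (a n) \<le> M"
    using convergent_imp_Bseq[OF convergentI[OF summable_LIMSEQ_zero[OF a(1)]]]
    by (auto simp: Bseq_def)
  show ?thesis
  proof (rule summable_comparison_test)
    show "summable (\<lambda>n. M * a n)" using a by (intro summable_mult)
    have "(a n)\<^sup>2 \<le> M * a n" for n
      unfolding power2_eq_square using M[of n] a(2)[of n] by (intro mult_right_mono) auto
    then show "\<exists>N. \<forall>n\<ge>N. norm ((a n)\<^sup>2) \<le> M * a n" by simp
  qed
qed

text \<open>
  Maximal monotonicity of \<open>A\<close> appears as the surjectivity of \<open>Id + t * A\<close> for all \<open>t > 0\<close>.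
\<close>

locale monotone_lipschitz_inclusion =
  fixes K :: "'a::real_inner set" and A :: "'a \<Rightarrow> 'a set" and B :: "'a \<Rightarrow> 'a" and \<beta> :: real
  assumes K: "subspace K" "complete K"
    and A_monotone: "\<And>x y u w. \<lbrakk>x \<in> K; y \<in> K; u \<in> A x; w \<in> A y\<rbrakk> \<Longrightarrow> 0 \<le> (x - y) \<bullet> (u - w)"
    and A_resolvent: "\<And>t x. \<lbrakk>t > 0; x \<in> K\<rbrakk> \<Longrightarrow> \<exists>p\<in>K. (1/t) *\<^sub>R (x - p) \<in> A p"
    and B_in: "\<And>x. x \<in> K \<Longrightarrow> B x \<in> K"
    and B_monotone: "\<And>x y. \<lbrakk>x \<in> K; y \<in> K\<rbrakk> \<Longrightarrow> 0 \<le> (x - y) \<bullet> (B x - B y)"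
    and B_lipschitz: "\<And>x y. \<lbrakk>x \<in> K; y \<in> K\<rbrakk> \<Longrightarrow> norm (B x - B y) \<le> \<beta> * norm (x - y)"
    and beta_pos: "\<beta> > 0"
begin

definition zer :: "'a set" where "zer = {x \<in> K. - B x \<in> A x}"

lemma resolvent_nonexpansive:
  assumes t: "t > 0" and pq: "p \<in> K" "q \<in> K"
    and p: "(1/t) *\<^sub>R (x - p) \<in> A p" and q: "(1/t) *\<^sub>R (y - q) \<in> A q"
  shows "norm (p - q) \<le> norm (x - y)"
proof -
  have "0 \<le> (p - q) \<bullet> ((1/t) *\<^sub>R (x - p) - (1/t) *\<^sub>R (y - q))"
    using A_monotone pq p q by blast
  also have "\<dots> = (1/t) * ((p - q) \<bullet> (x - y) - (p - q) \<bullet> (p - q))"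
    by (simp add: inner_diff_right algebra_simps)
  finally have "(p - q) \<bullet> (p - q) \<le> (p - q) \<bullet> (x - y)"
    using t by (simp add: zero_le_mult_iff zero_le_divide_iff)
  also have "\<dots> \<le> norm (p - q) * norm (x - y)" by (rule norm_cauchy_schwarz)
  finally have "norm (p - q) * norm (p - q) \<le> norm (p - q) * norm (x - y)"
    by (metis dot_square_norm power2_eq_square)
  then show ?thesis by (cases "norm (p - q) = 0") (auto simp: mult_le_cancel_left)
qed

text \<open>
  Both \<open>A\<close> and \<open>B\<close> are evaluated at points that converge only weakly, so one has to use that \<open>A + B\<close> is
  maximal. For small \<open>t\<close> the map \<open>w \<mapsto> J (x - t * B w)\<close> is a contraction, where \<open>J\<close> is the resolvent of \<open>A\<close>;
  its fixed point \<open>y\<close> satisfies \<open>(x - y) / t \<in> (A + B) y\<close>. Monotonicity of \<open>A + B\<close> passes to the limit and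
  yields \<open>\<parallel>x - y\<parallel>\<^sup>2 \<le> 0\<close>.
\<close>

lemma weak_limit_in_zer:
  assumes p: "\<And>n. p n \<in> K" and u: "\<And>n. u n - B (p n) \<in> A (p n)"
    and u0: "u \<longlonglongrightarrow> 0" and weak: "weakly_tendsto K p x" "x \<in> K"
    and bdd: "\<And>n. norm (p n) \<le> M"
  shows "x \<in> zer"
proof -
  \<comment> \<open>Any \<open>t\<close> below \<open>1 / \<beta>\<close> gives a contraction; this one has the factor \<open>1/2\<close>.\<close>
  define t where "t = 1 / (2 * \<beta>)"
  have t: "t > 0" using beta_pos by (simp add: t_def)
  define J where "J w = (SOME q. q \<in> K \<and> (1/t) *\<^sub>R (w - q) \<in> A q)" for w
  have J: "J w \<in> K \<and> (1/t) *\<^sub>R (w - J w) \<in> A (J w)" if "w \<in> K" for w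
    unfolding J_def by (rule someI_ex) (use A_resolvent[OF t that] in blast)
  have arg: "x - t *\<^sub>R B w \<in> K" if "w \<in> K" for w
    using K weak that B_in by (simp add: subspace_diff subspace_scale)
  have "\<exists>!w\<in>K. J (x - t *\<^sub>R B w) = w"
  proof (rule Banach_fix[OF K(2), of "1/2"])
    show "(\<lambda>w. J (x - t *\<^sub>R B w)) ` K \<subseteq> K" using J arg by blast
    show "dist (J (x - t *\<^sub>R B v)) (J (x - t *\<^sub>R B w)) \<le> 1/2 * dist v w" if "v \<in> K" "w \<in> K" for v w
    proof -
      have "norm (J (x - t *\<^sub>R B v) - J (x - t *\<^sub>R B w)) \<le> norm ((x - t *\<^sub>R B v) - (x - t *\<^sub>R B w))"
        using resolvent_nonexpansive[OF t] J arg that by blast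
      also have "\<dots> = norm (t *\<^sub>R (B w - B v))" by (simp add: algebra_simps)
      also have "\<dots> = t * norm (B v - B w)" using t by (simp add: norm_minus_commute)
      also have "\<dots> \<le> t * (\<beta> * norm (v - w))" using B_lipschitz that t by (intro mult_left_mono) auto
      also have "\<dots> = 1/2 * norm (v - w)" using beta_pos by (simp add: t_def)
      finally show ?thesis by (simp add: dist_norm)
    qed
  qed (use weak in auto)
  then obtain y where y: "y \<in> K" "J (x - t *\<^sub>R B y) = y" by blast
  define w where "w = (1/t) *\<^sub>R (x - y)"
  have "(1/t) *\<^sub>R ((x - t *\<^sub>R B y) - y) \<in> A y" using J[OF arg[OF y(1)]] y by simp
  moreover have "(1/t) *\<^sub>R ((x - t *\<^sub>R B y) - y) = w - B y"
    using t by (simp add: w_def algebra_simps)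
  ultimately have wA: "w - B y \<in> A y" by simp
  have wK: "w \<in> K" using K weak y by (simp add: w_def subspace_scale subspace_diff)
  have nonneg: "0 \<le> (p n - y) \<bullet> (u n - w)" for n
  proof -
    have "0 \<le> (p n - y) \<bullet> ((u n - B (p n)) - (w - B y))" using A_monotone p u y wA by blast
    moreover have "0 \<le> (p n - y) \<bullet> (B (p n) - B y)" using B_monotone p y by blast
    ultimately show ?thesis by (simp add: inner_diff_right)
  qed
  have "(\<lambda>n. (p n - y) \<bullet> u n) \<longlonglongrightarrow> 0"
  proof (rule Lim_null_comparison)
    have "norm ((p n - y) \<bullet> u n) \<le> (M + norm y) * norm (u n)" for n
      using Cauchy_Schwarz_ineq2[of "p n - y" "u n"] bdd[of n] norm_triangle_ineq4[of "p n" y]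
      by (smt (verit) mult_right_mono norm_ge_zero real_norm_def)
    then show "\<forall>\<^sub>F n in sequentially. norm ((p n - y) \<bullet> u n) \<le> (M + norm y) * norm (u n)" by simp
    show "(\<lambda>n. (M + norm y) * norm (u n)) \<longlonglongrightarrow> 0"
      using tendsto_mult_right_zero[OF tendsto_norm_zero[OF u0]] .
  qed
  moreover have "(\<lambda>n. (p n - y) \<bullet> w) \<longlonglongrightarrow> (x - y) \<bullet> w"
    using weak wK unfolding weakly_tendsto_def inner_diff_left by (intro tendsto_diff[OF _ tendsto_const]) auto
  ultimately have "(\<lambda>n. (p n - y) \<bullet> (u n - w)) \<longlonglongrightarrow> 0 - (x - y) \<bullet> w"
    unfolding inner_diff_right by (rule tendsto_diff)
  then have "0 \<le> 0 - (x - y) \<bullet> w"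
    by (rule LIMSEQ_le_const) (use nonneg in blast)
  then have "(1/t) * ((x - y) \<bullet> (x - y)) \<le> 0" by (simp add: w_def)
  then have "(x - y) \<bullet> (x - y) \<le> 0" using t by (simp add: field_simps)
  then have "x = y" by (metis eq_iff_diff_eq_0 inner_gt_zero_iff not_le)
  then show ?thesis using wA y unfolding zer_def w_def by simp
qed

text \<open>
  Monotonicity of \<open>A + B\<close> between \<open>p\<close> and the zero \<open>z\<close> controls the cross term in the expansion of the left-hand
  side; the remaining term \<open>t\<^sup>2 * \<parallel>B x - B p\<parallel>\<^sup>2\<close> is bounded by the Lipschitz property.
\<close>

lemma forward_backward_forward_descent:
  assumes t: "t > 0" and xp: "x \<in> K" "p \<in> K" and z: "z \<in> zer"
    and p: "(1/t) *\<^sub>R (x - t *\<^sub>R B x - p) \<in> A p"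
  shows "(norm (p + t *\<^sub>R (B x - B p) - z))\<^sup>2 \<le> (norm (x - z))\<^sup>2 - (1 - (t * \<beta>)\<^sup>2) * (norm (x - p))\<^sup>2"
proof -
  have zK: "z \<in> K" "- B z \<in> A z" using z by (auto simp: zer_def)
  have eq: "(1/t) *\<^sub>R (x - t *\<^sub>R B x - p) = (1/t) *\<^sub>R (x - p) - B x"
    using t by (simp add: algebra_simps)
  have "0 \<le> (p - z) \<bullet> (((1/t) *\<^sub>R (x - p) - B x) - (- B z))"
    using A_monotone[OF xp(2) zK(1) p zK(2)] unfolding eq .
  moreover have "0 \<le> (p - z) \<bullet> (B p - B z)" using B_monotone xp zK by blast
  ultimately have "0 \<le> (p - z) \<bullet> ((1/t) *\<^sub>R (x - p)) - (p - z) \<bullet> (B x - B p)"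
    by (simp only: inner_diff_right inner_minus_right)
  then have "(p - z) \<bullet> (B x - B p) \<le> (1/t) * ((p - z) \<bullet> (x - p))" by simp
  then have key: "t * ((p - z) \<bullet> (B x - B p)) \<le> (p - z) \<bullet> (x - p)"
    using t by (simp add: field_simps)
  have sq: "(norm (a + s *\<^sub>R b))\<^sup>2 = (norm a)\<^sup>2 + 2 * s * (a \<bullet> b) + s\<^sup>2 * (norm b)\<^sup>2" for a b :: 'a and s
    unfolding power2_norm_eq_inner
    by (simp add: inner_add inner_commute algebra_simps power2_eq_square)
  have "norm (B x - B p) \<le> \<beta> * norm (x - p)" using B_lipschitz xp by blast
  then have "(norm (B x - B p))\<^sup>2 \<le> (\<beta> * norm (x - p))\<^sup>2" by (simp add: power_mono)
  then have "t\<^sup>2 * (norm (B x - B p))\<^sup>2 \<le> t\<^sup>2 * (\<beta> * norm (x - p))\<^sup>2" by (rule mult_left_mono) simp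
  then have lip: "t\<^sup>2 * (norm (B x - B p))\<^sup>2 \<le> (t * \<beta>)\<^sup>2 * (norm (x - p))\<^sup>2" by (simp add: power_mult_distrib)
  have "p + t *\<^sub>R (B x - B p) - z = (p - z) + t *\<^sub>R (B x - B p)" by simp
  then have "(norm (p + t *\<^sub>R (B x - B p) - z))\<^sup>2
      = (norm (p - z))\<^sup>2 + 2 * t * ((p - z) \<bullet> (B x - B p)) + t\<^sup>2 * (norm (B x - B p))\<^sup>2"
    by (simp only: sq)
  moreover have "(norm (x - z))\<^sup>2 = (norm (p - z))\<^sup>2 + 2 * ((p - z) \<bullet> (x - p)) + (norm (x - p))\<^sup>2"
    using sq[of "p - z" 1 "x - p"] by simp
  ultimately show ?thesis using key lip by (simp add: algebra_simps)
qed

text \<open>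
  The points \<open>P n\<close> are the resolvent points of a step without errors, and the errors \<open>a\<close>, \<open>b\<close>, \<open>c\<close>
  displace the next iterate only by a summable amount. Besides the convergence of the iterates the
  conclusion gives residuals \<open>U n \<in> (A + B) (P n)\<close> that tend to \<open>0\<close>, from which strong convergence of
  single components can be derived.
\<close>

theorem forward_backward_forward_weak_convergence:
  assumes eps: "0 < \<epsilon>" "\<epsilon> < 1" and gamma: "\<And>n. \<epsilon> \<le> \<gamma> n" "\<And>n. \<gamma> n \<le> (1 - \<epsilon>) / \<beta>"
    and zer: "zer \<noteq> {}"
    and x_in: "\<And>n. x n \<in> K"
    and a: "summable (\<lambda>n. norm (a n))"
    and b: "summable (\<lambda>n. norm (b n))"
    and c: "summable (\<lambda>n. norm (c n))"
    and p_in: "\<And>n. p n \<in> K" and b_in: "\<And>n. b n \<in> K"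
    and y: "\<And>n. y n = x n - \<gamma> n *\<^sub>R (B (x n) + a n)"
    and p: "\<And>n. (1 / \<gamma> n) *\<^sub>R (y n - (p n - b n)) \<in> A (p n - b n)"
    and q: "\<And>n. q n = p n - \<gamma> n *\<^sub>R (B (p n) + c n)"
    and x_Suc: "\<And>n. x (Suc n) = x n - y n + q n"
  shows "summable (\<lambda>n. (norm (x n - p n))\<^sup>2) \<and>
    (\<exists>xb P U. xb \<in> zer \<and> weakly_tendsto K x xb \<and> weakly_tendsto K p xb \<and>
           (\<forall>n. P n \<in> K \<and> U n - B (P n) \<in> A (P n)) \<and> U \<longlonglongrightarrow> 0 \<and>
           (\<lambda>n. P n - x n) \<longlonglongrightarrow> 0 \<and> (\<lambda>n. P n - p n) \<longlonglongrightarrow> 0 \<and> bounded (range P))"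
proof -
  have g: "\<gamma> n > 0" "\<gamma> n * \<beta> \<le> 1 - \<epsilon>" for n
    using gamma[of n] eps beta_pos by (auto simp: pos_le_divide_eq)
  have g_le: "\<gamma> n \<le> 1/\<beta>" for n
    using gamma(2)[of n] eps beta_pos by (smt (verit) divide_right_mono)
  have "\<exists>P. P \<in> K \<and> (1 / \<gamma> n) *\<^sub>R (x n - \<gamma> n *\<^sub>R B (x n) - P) \<in> A P" for n
    using A_resolvent[OF g(1)[of n], of "x n - \<gamma> n *\<^sub>R B (x n)"] K x_in B_in
    by (auto simp: subspace_diff subspace_scale)
  then obtain P where P: "\<And>n. P n \<in> K" "\<And>n. (1 / \<gamma> n) *\<^sub>R (x n - \<gamma> n *\<^sub>R B (x n) - P n) \<in> A (P n)"
    by metis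
  define x' where "x' n = P n + \<gamma> n *\<^sub>R (B (x n) - B (P n))" for n
  define d where "d n = \<gamma> n * norm (a n) + norm (b n)" for n
  \<comment> \<open>Since \<open>\<gamma> n * \<beta> \<le> 1\<close>, the error of \<open>p\<close> enters the next iterate twice: directly and through \<open>B\<close>.\<close>
  define e where "e n = (1/\<beta>) * norm (a n) + 2 * ((1/\<beta>) * norm (a n) + norm (b n)) + (1/\<beta>) * norm (c n)" for n
  have d_nonneg: "0 \<le> d n" for n using g[of n] by (simp add: d_def)
  have d_le: "d n \<le> (1/\<beta>) * norm (a n) + norm (b n)" for n
    using mult_right_mono[OF g_le norm_ge_zero, of n "a n"] by (simp add: d_def)
  have ab: "summable (\<lambda>n. (1/\<beta>) * norm (a n) + norm (b n))"
    by (intro summable_add summable_mult a b)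
  have d_sum: "summable d"
    by (rule summable_comparison_test[OF _ ab]) (use d_le d_nonneg in auto)
  have e_nonneg: "0 \<le> e n" for n using beta_pos by (simp add: e_def)
  have e_sum: "summable e" unfolding e_def by (intro summable_add summable_mult a b c)
  have pP: "norm (p n - P n) \<le> d n" for n
  proof -
    have "p n - b n \<in> K" using K p_in b_in by (simp add: subspace_diff)
    then have "norm ((p n - b n) - P n) \<le> norm (y n - (x n - \<gamma> n *\<^sub>R B (x n)))"
      using resolvent_nonexpansive[OF g(1) _ P(1) p P(2)] by blast
    also have "y n - (x n - \<gamma> n *\<^sub>R B (x n)) = - (\<gamma> n *\<^sub>R a n)" by (simp add: y algebra_simps)
    also have "norm \<dots> = \<gamma> n * norm (a n)" using g(1)[of n] by simp
    finally have "norm ((p n - P n) - b n) \<le> \<gamma> n * norm (a n)" by (simp add: algebra_simps)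
    then show ?thesis using norm_triangle_sub[of "p n - P n" "b n"] by (simp add: d_def)
  qed
  have x_err: "norm (x (Suc n) - x' n) \<le> e n" for n
  proof -
    have eq: "x (Suc n) - x' n = \<gamma> n *\<^sub>R a n + (p n - P n) - \<gamma> n *\<^sub>R (B (p n) - B (P n)) - \<gamma> n *\<^sub>R c n"
      by (simp add: x_Suc x'_def y q algebra_simps)
    have arith: "X \<le> s + 2 * (s + b') + s'"
      if "X \<le> X1 + X2 + X3 + X4" "X1 \<le> s" "X4 \<le> s'" "X3 \<le> X2" "X2 \<le> d'" "d' \<le> s + b'"
      for X X1 X2 X3 X4 s s' b' d' :: real using that by argo
    have "norm (x (Suc n) - x' n)
        \<le> norm (\<gamma> n *\<^sub>R a n) + norm (p n - P n) + norm (\<gamma> n *\<^sub>R (B (p n) - B (P n))) + norm (\<gamma> n *\<^sub>R c n)"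
      using norm_triangle_ineq[of "\<gamma> n *\<^sub>R a n" "p n - P n"]
        norm_triangle_ineq4[of "\<gamma> n *\<^sub>R a n + (p n - P n)" "\<gamma> n *\<^sub>R (B (p n) - B (P n))"]
        norm_triangle_ineq4[of "\<gamma> n *\<^sub>R a n + (p n - P n) - \<gamma> n *\<^sub>R (B (p n) - B (P n))" "\<gamma> n *\<^sub>R c n"]
      unfolding eq by linarith
    moreover have "norm (\<gamma> n *\<^sub>R a n) \<le> (1/\<beta>) * norm (a n)"
      using mult_right_mono[OF g_le norm_ge_zero, of n "a n"] g(1)[of n] by simp
    moreover have "norm (\<gamma> n *\<^sub>R c n) \<le> (1/\<beta>) * norm (c n)"
      using mult_right_mono[OF g_le norm_ge_zero, of n "c n"] g(1)[of n] by simp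
    moreover have "norm (\<gamma> n *\<^sub>R (B (p n) - B (P n))) \<le> norm (p n - P n)"
    proof -
      have "norm (\<gamma> n *\<^sub>R (B (p n) - B (P n))) \<le> \<gamma> n * (\<beta> * norm (p n - P n))"
        using B_lipschitz[OF p_in P(1)] g(1)[of n] by simp
      also have "\<dots> \<le> 1 * norm (p n - P n)"
        using g(2)[of n] eps unfolding mult.assoc[symmetric] by (intro mult_right_mono) auto
      finally show ?thesis by simp
    qed
    ultimately show ?thesis using pP[of n] d_le[of n] unfolding e_def by (rule arith)
  qed
  have descent: "(norm (x' n - w))\<^sup>2 \<le> (norm (x n - w))\<^sup>2 - \<epsilon> * (norm (x n - P n))\<^sup>2" if "w \<in> zer" for n w
  proof -
    have "(\<gamma> n * \<beta>)\<^sup>2 \<le> (1 - \<epsilon>)\<^sup>2" using g[of n] beta_pos by (intro power_mono) auto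
    also have "\<dots> \<le> 1 - \<epsilon>" using eps by (simp add: power2_eq_square mult_left_le)
    finally have "\<epsilon> * (norm (x n - P n))\<^sup>2 \<le> (1 - (\<gamma> n * \<beta>)\<^sup>2) * (norm (x n - P n))\<^sup>2"
      by (intro mult_right_mono) auto
    then show ?thesis
      using forward_backward_forward_descent[OF g(1) x_in P(1) that P(2), of n] unfolding x'_def by simp
  qed
  have x'_le: "norm (x' n - w) \<le> norm (x n - w)" if "w \<in> zer" for n w
  proof -
    have "0 \<le> \<epsilon> * (norm (x n - P n))\<^sup>2" using eps by simp
    then have "(norm (x' n - w))\<^sup>2 \<le> (norm (x n - w))\<^sup>2" using descent[OF that, of n] by linarith
    then show ?thesis by (simp add: power2_le_iff_abs_le)
  qed
  have x_tri: "norm (x (Suc n) - w) \<le> norm (x' n - w) + e n" for n w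
    using x_err[of n] norm_triangle_ineq[of "x (Suc n) - x' n" "x' n - w"] by simp
  have conv: "convergent (\<lambda>n. norm (x n - w))" if "w \<in> zer" for w
  proof (rule quasi_fejer_convergent[OF _ e_sum])
    show "norm (x (Suc n) - w) \<le> norm (x n - w) + e n" for n
      using x_tri[of n w] x'_le[OF that, of n] by linarith
  qed simp
  obtain w where w: "w \<in> zer" using zer by blast
  from convergent_imp_Bseq[OF conv[OF w]] obtain M where M: "\<And>n. norm (norm (x n - w)) \<le> M" "M > 0"
    by (auto simp: Bseq_def)
  have "summable (\<lambda>n. \<epsilon> * (norm (x n - P n))\<^sup>2)"
  proof (rule quasi_fejer_summable)
    \<comment> \<open>Perturbing a distance of at most \<open>M\<close> by \<open>e n\<close> changes its square by at most this summand.\<close>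
    show "summable (\<lambda>n. 2 * M * e n + (e n)\<^sup>2)"
      by (intro summable_add summable_mult e_sum summable_power2 e_nonneg)
    show "(norm (x (Suc n) - w))\<^sup>2 \<le> (norm (x n - w))\<^sup>2 - \<epsilon> * (norm (x n - P n))\<^sup>2 + (2 * M * e n + (e n)\<^sup>2)" for n
    proof -
      have "(norm (x (Suc n) - w))\<^sup>2 \<le> (norm (x' n - w) + e n)\<^sup>2"
        using x_tri by (intro power_mono) auto
      also have "\<dots> = (norm (x' n - w))\<^sup>2 + 2 * (norm (x' n - w) * e n) + (e n)\<^sup>2"
        by (simp add: power2_sum)
      also have "norm (x' n - w) * e n \<le> M * e n"
        using x'_le[OF w, of n] M(1)[of n] e_nonneg by (intro mult_right_mono) auto
      finally show ?thesis using descent[OF w, of n] by simp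
    qed
  qed (use eps in auto)
  then have xP_sum: "summable (\<lambda>n. (norm (x n - P n))\<^sup>2)"
    using eps by (simp add: summable_cmult_iff)
  have "summable (\<lambda>n. 2 * (norm (x n - P n))\<^sup>2 + 2 * (d n)\<^sup>2)"
    by (intro summable_add summable_mult xP_sum summable_power2 d_sum d_nonneg)
  then have summable: "summable (\<lambda>n. (norm (x n - p n))\<^sup>2)"
  proof (rule summable_comparison_test[rotated], intro exI allI impI)
    fix n
    have "norm (x n - p n) \<le> norm (x n - P n) + d n"
      using norm_triangle_ineq4[of "x n - P n" "p n - P n"] pP[of n] by simp
    then have "(norm (x n - p n))\<^sup>2 \<le> (norm (x n - P n) + d n)\<^sup>2" by (intro power_mono) auto
    also have "\<dots> \<le> 2 * (norm (x n - P n))\<^sup>2 + 2 * (d n)\<^sup>2"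
      using sum_squares_bound[of "norm (x n - P n)" "d n"] by (simp add: power2_sum)
    finally show "norm ((norm (x n - p n))\<^sup>2) \<le> 2 * (norm (x n - P n))\<^sup>2 + 2 * (d n)\<^sup>2" by simp
  qed
  have "(\<lambda>n. sqrt ((norm (x n - P n))\<^sup>2)) \<longlonglongrightarrow> sqrt 0"
    by (intro tendsto_real_sqrt summable_LIMSEQ_zero xP_sum)
  then have nxP: "(\<lambda>n. norm (x n - P n)) \<longlonglongrightarrow> 0" by simp
  from tendsto_minus[OF tendsto_norm_zero_cancel[OF this]] have xP: "(\<lambda>n. P n - x n) \<longlonglongrightarrow> 0" by simp
  have "(\<lambda>n. p n - P n) \<longlonglongrightarrow> 0"
    by (rule Lim_null_comparison[OF _ summable_LIMSEQ_zero[OF d_sum]]) (use pP in auto)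
  from tendsto_minus[OF this] have Pp: "(\<lambda>n. P n - p n) \<longlonglongrightarrow> 0" by simp
  define U where "U n = (1 / \<gamma> n) *\<^sub>R (x n - P n) - (B (x n) - B (P n))" for n
  have UA: "U n - B (P n) \<in> A (P n)" for n
  proof -
    have "U n - B (P n) = (1 / \<gamma> n) *\<^sub>R (x n - \<gamma> n *\<^sub>R B (x n) - P n)"
      using g(1)[of n] by (simp add: U_def algebra_simps)
    then show ?thesis using P(2) by simp
  qed
  have U0: "U \<longlonglongrightarrow> 0"
  proof (rule Lim_null_comparison)
    have "norm (U n) \<le> (1/\<epsilon> + \<beta>) * norm (x n - P n)" for n
    proof -
      have "norm (U n) \<le> norm ((1 / \<gamma> n) *\<^sub>R (x n - P n)) + norm (B (x n) - B (P n))"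
        unfolding U_def by (rule norm_triangle_ineq4)
      also have "norm ((1 / \<gamma> n) *\<^sub>R (x n - P n)) = (1 / \<gamma> n) * norm (x n - P n)"
        using g(1)[of n] by simp
      also have "\<dots> \<le> (1/\<epsilon>) * norm (x n - P n)"
        using gamma(1)[of n] eps by (intro mult_right_mono divide_left_mono) auto
      finally show ?thesis using B_lipschitz[OF x_in P(1), of n n] by (simp add: algebra_simps)
    qed
    then show "\<forall>\<^sub>F n in sequentially. norm (U n) \<le> (1/\<epsilon> + \<beta>) * norm (x n - P n)" by simp
    show "(\<lambda>n. (1/\<epsilon> + \<beta>) * norm (x n - P n)) \<longlonglongrightarrow> 0"
      using tendsto_mult_right_zero[OF nxP] .
  qed
  obtain M1 where M1: "\<And>n. norm (P n - x n) \<le> M1"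
    using convergent_imp_Bseq[OF convergentI[OF xP]] by (auto simp: Bseq_def)
  have P_bdd: "norm (P n) \<le> M1 + M + norm w" for n
    using norm_triangle_ineq[of "P n - x n" "x n"] M1[of n] M(1)[of n] norm_triangle_sub[of "x n" w]
    by simp
  have cluster: "v \<in> zer" if r: "strict_mono (r :: nat \<Rightarrow> nat)" "v \<in> K" "weakly_tendsto K (x \<circ> r) v" for r v
  proof (rule weak_limit_in_zer[where p = "P \<circ> r" and u = "U \<circ> r" and M = "M1 + M + norm w"])
    show "(U \<circ> r) \<longlonglongrightarrow> 0" using LIMSEQ_subseq_LIMSEQ[OF U0 r(1)] .
    show "weakly_tendsto K (P \<circ> r) v"
      using weakly_tendsto_null_diff[OF r(3), of "P \<circ> r"] LIMSEQ_subseq_LIMSEQ[OF xP r(1)]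
      by (simp add: o_def)
  qed (use P UA r P_bdd in auto)
  have "zer \<subseteq> K" by (auto simp: zer_def)
  then obtain xb where xb: "xb \<in> zer" "weakly_tendsto K x xb"
  proof (rule opial_weak_convergence[OF K x_in zer _ conv])
    show "v \<in> zer" if "strict_mono (r :: nat \<Rightarrow> nat)" "v \<in> K" "weakly_tendsto K (x \<circ> r) v" for r v
      by (rule cluster) (fact that)+
  qed auto
  have "(\<lambda>n. (P n - x n) - (P n - p n)) \<longlonglongrightarrow> 0 - 0" by (intro tendsto_diff xP Pp)
  then have "weakly_tendsto K p xb" using weakly_tendsto_null_diff[OF xb(2), of p] by simp
  moreover have "bounded (range P)" using P_bdd by (auto simp: bounded_iff)
  ultimately have "\<exists>xb P U. xb \<in> zer \<and> weakly_tendsto K x xb \<and> weakly_tendsto K p xb \<and>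
           (\<forall>n. P n \<in> K \<and> U n - B (P n) \<in> A (P n)) \<and> U \<longlonglongrightarrow> 0 \<and>
           (\<lambda>n. P n - x n) \<longlonglongrightarrow> 0 \<and> (\<lambda>n. P n - p n) \<longlonglongrightarrow> 0 \<and> bounded (range P)"
    using xb P(1) UA U0 xP Pp by blast
  with summable show ?thesis by (rule conjI)
qed

end

section \<open>Finite direct sums of subspaces\<close>

abbreviation lookup :: "('a \<Rightarrow>\<^sub>0 'b::zero) \<Rightarrow> 'a \<Rightarrow> 'b" where
  "lookup \<equiv> poly_mapping.lookup"

text \<open>
  Finitely supported families with this norm contain each finite direct sum of subspaces. The whole
  type is not complete, but the families supported in a fixed finite set, with values in complete
  subspaces, form a complete subspace, as the convergence theorem for monotone inclusions demands. In
  this encoding the number of summands is a variable.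
\<close>

instantiation poly_mapping :: (type, real_vector) real_vector
begin

lift_definition scaleR_poly_mapping :: "real \<Rightarrow> ('a \<Rightarrow>\<^sub>0 'b) \<Rightarrow> 'a \<Rightarrow>\<^sub>0 'b"
  is "\<lambda>c f i. c *\<^sub>R f i"
  by (rule finite_subset[rotated]) auto

instance
  by standard (transfer, simp add: fun_eq_iff algebra_simps)+

end

instantiation poly_mapping :: (type, real_inner) real_inner
begin

definition inner_poly_mapping :: "('a \<Rightarrow>\<^sub>0 'b) \<Rightarrow> ('a \<Rightarrow>\<^sub>0 'b) \<Rightarrow> real" where
  "inner_poly_mapping p q = (\<Sum>i\<in>Poly_Mapping.keys p. lookup p i \<bullet> lookup q i)"

definition norm_poly_mapping :: "('a \<Rightarrow>\<^sub>0 'b) \<Rightarrow> real" where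
  "norm_poly_mapping p = sqrt (p \<bullet> p)"

definition dist_poly_mapping :: "('a \<Rightarrow>\<^sub>0 'b) \<Rightarrow> ('a \<Rightarrow>\<^sub>0 'b) \<Rightarrow> real" where
  "dist_poly_mapping p q = norm (p - q)"

definition sgn_poly_mapping :: "('a \<Rightarrow>\<^sub>0 'b) \<Rightarrow> 'a \<Rightarrow>\<^sub>0 'b" where
  "sgn_poly_mapping p = p /\<^sub>R norm p"

definition uniformity_poly_mapping :: "(('a \<Rightarrow>\<^sub>0 'b) \<times> ('a \<Rightarrow>\<^sub>0 'b)) filter" where
  "uniformity_poly_mapping = (INF e\<in>{0<..}. principal {(x, y). dist x y < e})"

definition open_poly_mapping :: "('a \<Rightarrow>\<^sub>0 'b) set \<Rightarrow> bool" where
  "open_poly_mapping U \<longleftrightarrow> (\<forall>x\<in>U. \<forall>\<^sub>F (x', y) in uniformity. x' = x \<longrightarrow> y \<in> U)"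

lemma inner_poly_mapping_superset:
  fixes p q :: "'a \<Rightarrow>\<^sub>0 'b"
  assumes "finite S" "Poly_Mapping.keys p \<subseteq> S"
  shows "p \<bullet> q = (\<Sum>i\<in>S. lookup p i \<bullet> lookup q i)"
  unfolding inner_poly_mapping_def
  by (rule sum.mono_neutral_left) (use assms in \<open>auto simp: in_keys_iff\<close>)

lemma lookup_scaleR: "lookup (c *\<^sub>R p) i = c *\<^sub>R lookup (p :: 'a \<Rightarrow>\<^sub>0 'b) i"
  by transfer simp

instance
proof
  fix x y z :: "'a \<Rightarrow>\<^sub>0 'b" and c :: real
  let ?S = "Poly_Mapping.keys x \<union> Poly_Mapping.keys y \<union> Poly_Mapping.keys z"
  have S: "finite ?S" by simp
  have add: "Poly_Mapping.keys (x + y) \<subseteq> ?S" using Poly_Mapping.keys_add[of x y] by blast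
  have scale: "Poly_Mapping.keys (c *\<^sub>R x) \<subseteq> ?S" by (auto simp: in_keys_iff lookup_scaleR)
  note sup = inner_poly_mapping_superset[OF S]
  show "x \<bullet> y = y \<bullet> x" by (subst (1 2) sup) (auto simp: inner_commute)
  show "(x + y) \<bullet> z = x \<bullet> z + y \<bullet> z"
    by (subst (1 2 3) sup) (use add in \<open>auto simp: lookup_add inner_add_left sum.distrib\<close>)
  show "(c *\<^sub>R x) \<bullet> y = c * (x \<bullet> y)"
    by (subst (1 2) sup) (use scale in \<open>auto simp: lookup_scaleR sum_distrib_left\<close>)
  show "0 \<le> x \<bullet> x" unfolding inner_poly_mapping_def by (intro sum_nonneg) auto
  show "(x \<bullet> x = 0) = (x = 0)"
    unfolding inner_poly_mapping_def
    by (subst sum_nonneg_eq_0_iff) (auto simp: in_keys_iff intro: poly_mapping_eqI)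
qed (fact norm_poly_mapping_def dist_poly_mapping_def sgn_poly_mapping_def
       uniformity_poly_mapping_def open_poly_mapping_def)+

end

definition direct_sum :: "'i set \<Rightarrow> ('i \<Rightarrow> 'b::real_inner set) \<Rightarrow> ('i \<Rightarrow>\<^sub>0 'b) set" where
  "direct_sum I G = {p. (\<forall>i\<in>I. lookup p i \<in> G i) \<and> Poly_Mapping.keys p \<subseteq> I}"

text \<open>
  The value \<open>0\<close> outside \<open>I\<close> makes the family independent of the values of \<open>w\<close> there.
\<close>

definition family :: "'i set \<Rightarrow> ('i \<Rightarrow> 'b) \<Rightarrow> 'i \<Rightarrow>\<^sub>0 'b::zero" where
  "family I w = Abs_poly_mapping (\<lambda>i. if i \<in> I then w i else 0)"

lemma lookup_family:
  assumes "finite I"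
  shows "lookup (family I w) i = (if i \<in> I then w i else 0)"
proof -
  have "finite {i. (if i \<in> I then w i else 0) \<noteq> 0}"
    by (rule finite_subset[OF _ assms]) auto
  then show ?thesis unfolding family_def by (simp add: Abs_poly_mapping_inverse)
qed

lemma family_in_direct_sum:
  assumes "finite I" "\<And>i. i \<in> I \<Longrightarrow> w i \<in> G i"
  shows "family I w \<in> direct_sum I G"
  using assms by (auto simp: direct_sum_def lookup_family in_keys_iff split: if_splits)

lemma keys_family: "finite I \<Longrightarrow> Poly_Mapping.keys (family I w) \<subseteq> I"
  by (auto simp: lookup_family in_keys_iff split: if_splits)

lemma norm_poly_mapping_L2:
  fixes p :: "'i \<Rightarrow>\<^sub>0 'b::real_inner"
  assumes "finite I" "Poly_Mapping.keys p \<subseteq> I"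
  shows "norm p = L2_set (\<lambda>i. norm (lookup p i)) I"
  unfolding norm_poly_mapping_def L2_set_def inner_poly_mapping_superset[OF assms]
  by (simp add: power2_norm_eq_inner)

lemma norm_lookup_le: "norm (lookup p i) \<le> norm (p :: 'i \<Rightarrow>\<^sub>0 'b::real_inner)"
proof -
  have "norm p = L2_set (\<lambda>i. norm (lookup p i)) (insert i (Poly_Mapping.keys p))"
    by (intro norm_poly_mapping_L2) auto
  then show ?thesis
    using member_le_L2_set[of "insert i (Poly_Mapping.keys p)" i "\<lambda>i. norm (lookup p i)"] by simp
qed

lemma tendsto_lookup:
  fixes p :: "nat \<Rightarrow> 'i \<Rightarrow>\<^sub>0 'b::real_inner"
  assumes "p \<longlonglongrightarrow> q"
  shows "(\<lambda>n. lookup (p n) i) \<longlonglongrightarrow> lookup q i"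
proof (rule LIM_zero_cancel, rule Lim_null_comparison)
  show "\<forall>\<^sub>F n in sequentially. norm (lookup (p n) i - lookup q i) \<le> norm (p n - q)"
    using norm_lookup_le[of "p _ - q" i] by (simp add: lookup_minus)
  show "(\<lambda>n. norm (p n - q)) \<longlonglongrightarrow> 0" using assms by (simp add: LIM_zero_iff tendsto_norm_zero_iff)
qed

lemma inner_single:
  fixes p :: "'i \<Rightarrow>\<^sub>0 'b::real_inner"
  shows "p \<bullet> Poly_Mapping.single i u = lookup p i \<bullet> u"
proof -
  have "Poly_Mapping.single i u \<bullet> p = (\<Sum>j\<in>{i}. lookup (Poly_Mapping.single i u) j \<bullet> lookup p j)"
    by (rule inner_poly_mapping_superset) auto
  then show ?thesis by (simp add: inner_commute)
qed

lemma subspace_direct_sum: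
  assumes "\<And>i. i \<in> I \<Longrightarrow> subspace (G i)"
  shows "subspace (direct_sum I G)"
proof (rule subspaceI)
  show "0 \<in> direct_sum I G" using assms by (auto simp: direct_sum_def subspace_0)
next
  fix p q assume pq: "p \<in> direct_sum I G" "q \<in> direct_sum I G"
  then have "Poly_Mapping.keys (p + q) \<subseteq> I"
    using Poly_Mapping.keys_add[of p q] unfolding direct_sum_def by blast
  then show "p + q \<in> direct_sum I G"
    using pq assms by (auto simp: direct_sum_def lookup_add subspace_add)
next
  fix c and p assume "p \<in> direct_sum I G"
  then show "c *\<^sub>R p \<in> direct_sum I G"
    using assms by (auto simp: direct_sum_def lookup_scaleR subspace_scale in_keys_iff)
qed

lemma complete_direct_sum:
  assumes I: "finite I" and G: "\<And>i. i \<in> I \<Longrightarrow> complete (G i)" and sub: "\<And>i. i \<in> I \<Longrightarrow> subspace (G i)"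
  shows "complete (direct_sum I G)"
  unfolding complete_def
proof (intro allI impI)
  fix p assume p: "(\<forall>n. p n \<in> direct_sum I G) \<and> Cauchy p"
  have "\<exists>q\<in>G i. (\<lambda>n. lookup (p n) i) \<longlonglongrightarrow> q" if i: "i \<in> I" for i
  proof -
    have "Cauchy (\<lambda>n. lookup (p n) i)"
    proof (rule metric_CauchyI)
      fix e :: real assume "e > 0"
      then obtain N where N: "\<And>m n. m \<ge> N \<Longrightarrow> n \<ge> N \<Longrightarrow> dist (p m) (p n) < e"
        using p by (meson metric_CauchyD)
      have "dist (lookup (p m) i) (lookup (p n) i) \<le> dist (p m) (p n)" for m n
        using norm_lookup_le[of "p m - p n" i] by (simp add: dist_norm lookup_minus)
      then show "\<exists>N. \<forall>m\<ge>N. \<forall>n\<ge>N. dist (lookup (p m) i) (lookup (p n) i) < e"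
        using N le_less_trans by blast
    qed
    moreover have "\<forall>n. lookup (p n) i \<in> G i" using p i by (auto simp: direct_sum_def)
    ultimately show ?thesis by (meson completeE G[OF i])
  qed
  then obtain q where q: "\<And>i. i \<in> I \<Longrightarrow> q i \<in> G i"
    "\<And>i. i \<in> I \<Longrightarrow> (\<lambda>n. lookup (p n) i) \<longlonglongrightarrow> q i"
    by metis
  have "p \<longlonglongrightarrow> family I q"
  proof (rule LIM_zero_cancel, rule Lim_null_comparison)
    have "norm (p n - family I q) \<le> (\<Sum>i\<in>I. norm (lookup (p n) i - q i))" for n
    proof -
      have "family I q \<in> direct_sum I G" by (rule family_in_direct_sum[where w = q and G = G, OF I q(1)])
      then have "p n - family I q \<in> direct_sum I G"
        using p sub by (simp add: subspace_diff subspace_direct_sum)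
      then have "norm (p n - family I q) = L2_set (\<lambda>i. norm (lookup (p n - family I q) i)) I"
        by (intro norm_poly_mapping_L2[OF I]) (simp add: direct_sum_def)
      also have "\<dots> \<le> (\<Sum>i\<in>I. norm (lookup (p n - family I q) i))"
        by (rule L2_set_le_sum) simp
      also have "\<dots> = (\<Sum>i\<in>I. norm (lookup (p n) i - q i))"
        by (rule sum.cong) (auto simp: lookup_minus lookup_family[OF I])
      finally show ?thesis .
    qed
    then show "\<forall>\<^sub>F n in sequentially. norm (p n - family I q) \<le> (\<Sum>i\<in>I. norm (lookup (p n) i - q i))"
      by simp
    have "(\<lambda>n. \<Sum>i\<in>I. norm (lookup (p n) i - q i)) \<longlonglongrightarrow> (\<Sum>i\<in>I. 0)"
      by (intro tendsto_sum tendsto_norm_zero LIM_zero q)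
    then show "(\<lambda>n. \<Sum>i\<in>I. norm (lookup (p n) i - q i)) \<longlonglongrightarrow> 0" by simp
  qed
  then show "\<exists>l\<in>direct_sum I G. p \<longlonglongrightarrow> l" using family_in_direct_sum[where w = q and G = G, OF I q(1)] by blast
qed

lemma complete_Times:
  fixes S :: "'a::metric_space set" and T :: "'b::metric_space set"
  assumes "complete S" "complete T"
  shows "complete (S \<times> T)"
  unfolding complete_def
proof (intro allI impI)
  fix p :: "nat \<Rightarrow> 'a \<times> 'b" assume p: "(\<forall>n. p n \<in> S \<times> T) \<and> Cauchy p"
  then have "\<And>n. fst (p n) \<in> S" "\<And>n. snd (p n) \<in> T" by (auto simp: mem_Times_iff)
  then obtain a b where ab: "a \<in> S" "(\<lambda>n. fst (p n)) \<longlonglongrightarrow> a" "b \<in> T" "(\<lambda>n. snd (p n)) \<longlonglongrightarrow> b"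
    using p assms Cauchy_fst Cauchy_snd by (metis completeE)
  from tendsto_Pair[OF ab(2,4)] ab(1,3) show "\<exists>l\<in>S \<times> T. p \<longlonglongrightarrow> l" by auto
qed

lemma norm_family_le:
  fixes w :: "'i \<Rightarrow> 'b::real_inner"
  assumes I: "finite I"
  shows "norm (family I w) \<le> (\<Sum>i\<in>I. norm (w i))"
proof -
  have "norm (family I w) = L2_set (\<lambda>i. norm (lookup (family I w) i)) I"
    by (rule norm_poly_mapping_L2[OF I keys_family[OF I]])
  also have "\<dots> \<le> (\<Sum>i\<in>I. norm (lookup (family I w) i))"
    by (rule L2_set_le_sum) simp
  also have "\<dots> = (\<Sum>i\<in>I. norm (w i))" by (rule sum.cong) (auto simp: lookup_family[OF I])
  finally show ?thesis .
qed

lemma summable_norm_Pair_family: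
  fixes a :: "nat \<Rightarrow> 'a::real_inner" and b :: "'i \<Rightarrow> nat \<Rightarrow> 'b::real_inner"
  assumes I: "finite I" and a: "summable (\<lambda>n. norm (a n))"
    and b: "\<And>i. i \<in> I \<Longrightarrow> summable (\<lambda>n. norm (b i n))"
  shows "summable (\<lambda>n. norm (a n, family I (\<lambda>i. b i n)))"
proof (rule summable_comparison_test[rotated])
  show "summable (\<lambda>n. norm (a n) + (\<Sum>i\<in>I. norm (b i n)))"
    by (intro summable_add a summable_sum b)
  have "norm (a n, family I (\<lambda>i. b i n)) \<le> norm (a n) + (\<Sum>i\<in>I. norm (b i n))" for n
    using norm_Pair_le[of "a n" "family I (\<lambda>i. b i n)"] norm_family_le[OF I, of "\<lambda>i. b i n"] by linarith
  then show "\<exists>N. \<forall>n\<ge>N. norm (norm (a n, family I (\<lambda>i. b i n))) \<le> norm (a n) + (\<Sum>i\<in>I. norm (b i n))"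
    by simp
qed

lemma norm_lookup_snd_le: "norm (lookup (snd w) i) \<le> norm (w :: 'a::real_inner \<times> ('i \<Rightarrow>\<^sub>0 'b::real_inner))"
  using norm_lookup_le[of "snd w" i] norm_snd_le[where x = "fst w" and y = "snd w"] by simp

lemma summable_power2_comparison:
  fixes a :: "nat \<Rightarrow> 'a::real_normed_vector" and b :: "nat \<Rightarrow> 'b::real_normed_vector"
  assumes "summable (\<lambda>n. (norm (b n))\<^sup>2)" "\<And>n. norm (a n) \<le> norm (b n)"
  shows "summable (\<lambda>n. (norm (a n))\<^sup>2)"
  by (rule summable_comparison_test[OF _ assms(1)]) (use assms(2) in \<open>auto intro!: power_mono\<close>)

section \<open>The operators of the primal-dual problem\<close>

locale primal_dual_problem =
  fixes z :: "'h::{real_inner, banach}" and m :: nat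
    and f :: "'h \<Rightarrow> ereal" and h :: "'h \<Rightarrow> real" and \<mu> :: real
    and G :: "nat \<Rightarrow> 'g::{real_inner, banach} set" and r :: "nat \<Rightarrow> 'g"
    and g l :: "nat \<Rightarrow> 'g \<Rightarrow> ereal" and \<nu> :: "nat \<Rightarrow> real" and L :: "nat \<Rightarrow> 'h \<Rightarrow> 'g"
  assumes f: "f \<in> Gamma0 UNIV"
    and h_convex: "convex_on UNIV h"
    and h_diff: "\<And>u. h differentiable (at u)"
    and mu: "\<mu> > 0"
    and h_lipschitz: "\<mu>-lipschitz_on UNIV (gradient UNIV h)"
    and G: "\<And>i. i \<in> {1..m} \<Longrightarrow> subspace (G i)" "\<And>i. i \<in> {1..m} \<Longrightarrow> complete (G i)"
    and r: "\<And>i. i \<in> {1..m} \<Longrightarrow> r i \<in> G i"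
    and g: "\<And>i. i \<in> {1..m} \<Longrightarrow> g i \<in> Gamma0 (G i)"
    and l: "\<And>i. i \<in> {1..m} \<Longrightarrow> l i \<in> Gamma0 (G i)"
    and nu: "\<And>i. i \<in> {1..m} \<Longrightarrow> \<nu> i > 0"
    and l_strong: "\<And>i. i \<in> {1..m} \<Longrightarrow> strongly_convex_on (G i) (1 / \<nu> i) (l i)"
    and L_linear: "\<And>i. i \<in> {1..m} \<Longrightarrow> bounded_linear (L i)"
    and L_range: "\<And>i x. i \<in> {1..m} \<Longrightarrow> L i x \<in> G i"
begin

abbreviation "dh \<equiv> gradient UNIV h"
abbreviation "dl i \<equiv> grad_conjugate (G i) (l i)"
abbreviation "df \<equiv> subdifferential UNIV f"
abbreviation "dg i \<equiv> subdifferential (G i) (conjugate (G i) (g i))"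
abbreviation "adjoint_sum w \<equiv> (\<Sum>i=1..m. adjoint (L i) (w i))"

definition product_space :: "('h \<times> (nat \<Rightarrow>\<^sub>0 'g)) set" where "product_space = UNIV \<times> direct_sum {1..m} G"

text \<open>
  The conditions are the membership relations of the product operator with the shifts \<open>- z\<close> and \<open>r\<^sub>i\<close> moved
  to the other side.
\<close>

definition setvalued_part :: "'h \<times> (nat \<Rightarrow>\<^sub>0 'g) \<Rightarrow> ('h \<times> (nat \<Rightarrow>\<^sub>0 'g)) set" where
  "setvalued_part w = {u \<in> product_space. fst u + z \<in> df (fst w) \<and>
      (\<forall>i\<in>{1..m}. lookup (snd u) i - r i \<in> dg i (lookup (snd w) i))}"

definition lipschitz_part :: "'h \<times> (nat \<Rightarrow>\<^sub>0 'g) \<Rightarrow> 'h \<times> (nat \<Rightarrow>\<^sub>0 'g)" where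
  "lipschitz_part w = (dh (fst w) + adjoint_sum (lookup (snd w)),
           family {1..m} (\<lambda>i. dl i (lookup (snd w) i) - L i (fst w)))"

definition lipschitz_bound :: real where
  "lipschitz_bound = Max (insert \<mu> (\<nu> ` {1..m})) + sqrt (\<Sum>i=1..m. (onorm (L i))\<^sup>2)"

lemma lookup_in: "w \<in> product_space \<Longrightarrow> i \<in> {1..m} \<Longrightarrow> lookup (snd w) i \<in> G i"
  unfolding product_space_def direct_sum_def by auto

lemma subspace_product_space: "subspace product_space"
  unfolding product_space_def by (intro subspace_Times subspace_UNIV subspace_direct_sum G)

lemma complete_product_space: "complete product_space"
  unfolding product_space_def by (intro complete_Times complete_UNIV complete_direct_sum G) auto

lemma inner_product_space:
  assumes "v \<in> product_space"
  shows "v \<bullet> w = fst v \<bullet> fst w + (\<Sum>i=1..m. lookup (snd v) i \<bullet> lookup (snd w) i)"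
proof -
  have "snd v \<bullet> snd w = (\<Sum>i=1..m. lookup (snd v) i \<bullet> lookup (snd w) i)"
    using assms by (intro inner_poly_mapping_superset) (auto simp: product_space_def direct_sum_def)
  then show ?thesis by (simp add: inner_prod_def)
qed

lemma dl_in: "i \<in> {1..m} \<Longrightarrow> w \<in> G i \<Longrightarrow> dl i w \<in> subdifferential (G i) (conjugate (G i) (l i)) w"
  using grad_conjugate_in_subdifferential[OF G l l_strong] nu by simp

lemma dl_mem: "i \<in> {1..m} \<Longrightarrow> w \<in> G i \<Longrightarrow> dl i w \<in> G i"
  using dl_in[of i w] by (simp add: subdifferential_def)

lemma dl_lipschitz: "i \<in> {1..m} \<Longrightarrow> v \<in> G i \<Longrightarrow> w \<in> G i \<Longrightarrow> norm (dl i v - dl i w) \<le> \<nu> i * norm (v - w)"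
  using grad_conjugate_lipschitz[OF G l l_strong] nu by simp

lemma dl_monotone: "i \<in> {1..m} \<Longrightarrow> v \<in> G i \<Longrightarrow> w \<in> G i \<Longrightarrow> 0 \<le> (v - w) \<bullet> (dl i v - dl i w)"
  by (rule subdifferential_monotone[OF conjugate_proper[OF G l]]) (auto intro: dl_in)

lemma dg_monotone:
  "\<lbrakk>i \<in> {1..m}; v \<in> G i; w \<in> G i; a \<in> dg i v; b \<in> dg i w\<rbrakk> \<Longrightarrow> 0 \<le> (v - w) \<bullet> (a - b)"
  by (rule subdifferential_monotone[OF conjugate_proper[OF G g]]) auto

lemma proper_h: "proper_on UNIV (\<lambda>x. ereal (h x))"
  by (auto simp: proper_on_def edom_def)

lemma dh_in: "dh x \<in> subdifferential UNIV (\<lambda>x. ereal (h x)) x"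
  by (rule gradient_in_subdifferential[OF h_convex h_diff])

lemma dh_monotone: "0 \<le> (x - y) \<bullet> (dh x - dh y)"
  by (rule subdifferential_monotone[OF proper_h UNIV_I dh_in UNIV_I dh_in])

lemma df_monotone: "a \<in> df x \<Longrightarrow> b \<in> df y \<Longrightarrow> 0 \<le> (x - y) \<bullet> (a - b)"
  by (rule subdifferential_monotone[OF Gamma0_proper[OF f] UNIV_I _ UNIV_I])

lemma inner_adjoint_sum: "x \<bullet> adjoint_sum w = (\<Sum>i=1..m. L i x \<bullet> w i)"
  unfolding inner_sum_right by (rule sum.cong) (auto simp: adjoint_inner[OF L_linear])

lemma adjoint_sum_diff: "adjoint_sum (\<lambda>i. v i - w i) = adjoint_sum v - adjoint_sum w"
  unfolding sum_subtractf[symmetric] by (rule sum.cong) (auto simp: adjoint_diff[OF L_linear])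

lemma lipschitz_part_in: "w \<in> product_space \<Longrightarrow> lipschitz_part w \<in> product_space"
  unfolding lipschitz_part_def product_space_def using lookup_in[of w]
  by (auto intro!: family_in_direct_sum subspace_diff G dl_mem L_range simp: product_space_def)

text \<open>
  The contributions of \<open>L\<^sub>i\<close> and of its adjoint cancel, since the linear part of the operator is skew.
\<close>

lemma lipschitz_part_inner:
  assumes v: "v \<in> product_space" and w: "w \<in> product_space"
  shows "(v - w) \<bullet> (lipschitz_part v - lipschitz_part w) = (fst v - fst w) \<bullet> (dh (fst v) - dh (fst w)) +
    (\<Sum>i=1..m. (lookup (snd v) i - lookup (snd w) i) \<bullet>
        (dl i (lookup (snd v) i) - dl i (lookup (snd w) i)))"
proof -
  let ?v = "lookup (snd v)" and ?w = "lookup (snd w)"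
  have vw: "v - w \<in> product_space" using subspace_product_space v w by (rule subspace_diff)
  have L: "L i (x - y) = L i x - L i y" if "i \<in> {1..m}" for i x y
    using L_linear[OF that] by (simp add: bounded_linear.linear linear_diff)
  have "(v - w) \<bullet> (lipschitz_part v - lipschitz_part w) = (fst v - fst w) \<bullet> (dh (fst v) - dh (fst w) + adjoint_sum (\<lambda>i. ?v i - ?w i))
      + (\<Sum>i=1..m. (?v i - ?w i) \<bullet> ((dl i (?v i) - dl i (?w i)) - L i (fst v - fst w)))"
    unfolding inner_product_space[OF vw] adjoint_sum_diff
    by (intro arg_cong2[where f = "(+)"] sum.cong)
       (auto simp: lipschitz_part_def lookup_family lookup_minus L algebra_simps)
  also have "\<dots> = (fst v - fst w) \<bullet> (dh (fst v) - dh (fst w)) +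
      (\<Sum>i=1..m. L i (fst v - fst w) \<bullet> (?v i - ?w i)) +
      (\<Sum>i=1..m. (?v i - ?w i) \<bullet> (dl i (?v i) - dl i (?w i)) - L i (fst v - fst w) \<bullet> (?v i - ?w i))"
    unfolding inner_add_right inner_adjoint_sum by (simp add: inner_diff_right inner_commute)
  finally show ?thesis by (simp add: sum_subtractf)
qed

lemma lipschitz_part_monotone:
  assumes "v \<in> product_space" "w \<in> product_space"
  shows "0 \<le> (v - w) \<bullet> (lipschitz_part v - lipschitz_part w)"
  unfolding lipschitz_part_inner[OF assms]
  by (intro add_nonneg_nonneg sum_nonneg dh_monotone dl_monotone lookup_in assms)

lemma setvalued_part_inner:
  assumes v: "v \<in> product_space" "a \<in> setvalued_part v" and w: "w \<in> product_space" "b \<in> setvalued_part w"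
  shows "(v - w) \<bullet> (a - b) = (fst v - fst w) \<bullet> ((fst a + z) - (fst b + z)) +
    (\<Sum>i=1..m. (lookup (snd v) i - lookup (snd w) i) \<bullet>
        ((lookup (snd a) i - r i) - (lookup (snd b) i - r i)))"
  unfolding inner_product_space[OF subspace_diff[OF subspace_product_space v(1) w(1)]] by (simp add: lookup_minus)

lemma setvalued_part_monotone:
  assumes v: "v \<in> product_space" "a \<in> setvalued_part v" and w: "w \<in> product_space" "b \<in> setvalued_part w"
  shows "0 \<le> (v - w) \<bullet> (a - b)"
proof -
  have a: "fst a + z \<in> df (fst v)"
    "\<And>i. i \<in> {1..m} \<Longrightarrow> lookup (snd a) i - r i \<in> dg i (lookup (snd v) i)"
    using v(2) unfolding setvalued_part_def by blast+
  have b: "fst b + z \<in> df (fst w)"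
    "\<And>i. i \<in> {1..m} \<Longrightarrow> lookup (snd b) i - r i \<in> dg i (lookup (snd w) i)"
    using w(2) unfolding setvalued_part_def by blast+
  show ?thesis
    unfolding setvalued_part_inner[OF assms]
    by (intro add_nonneg_nonneg sum_nonneg df_monotone[OF a(1) b(1)]
        dg_monotone[OF _ lookup_in[OF v(1)] lookup_in[OF w(1)] a(2) b(2)])
qed

text \<open>
  The shifts by \<open>z\<close> and by \<open>r\<^sub>i\<close> in the operator become the shifts of the arguments of the proximity operators in
  the algorithm.
\<close>

lemma setvalued_part_resolventI:
  assumes t: "t > 0" and w: "w \<in> product_space" and P: "P \<in> product_space"
    and 1: "(1/t) *\<^sub>R (fst w + t *\<^sub>R z - fst P) \<in> df (fst P)"
    and 2: "\<And>i. i \<in> {1..m} \<Longrightarrow> (1/t) *\<^sub>R (lookup (snd w) i - t *\<^sub>R r i - lookup (snd P) i)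
        \<in> dg i (lookup (snd P) i)"
  shows "(1/t) *\<^sub>R (w - P) \<in> setvalued_part P"
proof -
  have "(1/t) *\<^sub>R (w - P) \<in> product_space" using subspace_product_space w P by (simp add: subspace_scale subspace_diff)
  moreover have "fst ((1/t) *\<^sub>R (w - P)) + z = (1/t) *\<^sub>R (fst w + t *\<^sub>R z - fst P)"
    using t by (simp add: algebra_simps)
  moreover have "lookup (snd ((1/t) *\<^sub>R (w - P))) i - r i
      = (1/t) *\<^sub>R (lookup (snd w) i - t *\<^sub>R r i - lookup (snd P) i)" for i
    using t by (simp add: lookup_scaleR lookup_minus algebra_simps)
  ultimately show ?thesis unfolding setvalued_part_def using 1 2 by simp
qed

lemma setvalued_part_resolvent:
  assumes t: "t > 0" and w: "w \<in> product_space"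
  shows "\<exists>P\<in>product_space. (1/t) *\<^sub>R (w - P) \<in> setvalued_part P"
proof -
  obtain p where p: "(1/t) *\<^sub>R (fst w + t *\<^sub>R z - p) \<in> df p"
    using Gamma0_resolvent_exists[OF subspace_UNIV complete_UNIV f t UNIV_I] by metis
  have "\<exists>q. q \<in> G i \<and> (1/t) *\<^sub>R (lookup (snd w) i - t *\<^sub>R r i - q) \<in> dg i q"
    if i: "i \<in> {1..m}" for i
  proof -
    have "lookup (snd w) i - t *\<^sub>R r i \<in> G i"
      using lookup_in[OF w i] r[OF i] G(1)[OF i] by (simp add: subspace_diff subspace_scale)
    then show ?thesis using conjugate_resolvent_exists[OF G(1)[OF i] G(2)[OF i] g[OF i] t] by metis
  qed
  then obtain q where q: "\<And>i. i \<in> {1..m} \<Longrightarrow> q i \<in> G i"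
    "\<And>i. i \<in> {1..m} \<Longrightarrow> (1/t) *\<^sub>R (lookup (snd w) i - t *\<^sub>R r i - q i) \<in> dg i (q i)"
    by metis
  have P: "(p, family {1..m} q) \<in> product_space"
    using q(1) by (auto simp: product_space_def intro!: family_in_direct_sum)
  have "(1/t) *\<^sub>R (w - (p, family {1..m} q)) \<in> setvalued_part (p, family {1..m} q)"
    by (rule setvalued_part_resolventI[OF t w P]) (use p q in \<open>auto simp: lookup_family\<close>)
  then show ?thesis using P by blast
qed

text \<open>
  The difference splits into the differences \<open>(S1, S2)\<close> of the gradients, with constant
  \<open>max {\<mu>, \<nu>\<^sub>i}\<close>, and the skew part \<open>(T1, - T2)\<close>, which exchanges the two factors of the product and
  has constant \<open>\<Lambda> = sqrt (\<Sum>i \<parallel>L\<^sub>i\<parallel>\<^sup>2)\<close> by the Cauchy-Schwarz inequality.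
\<close>

lemma lipschitz_part_lipschitz:
  assumes v: "v \<in> product_space" and w: "w \<in> product_space"
  shows "norm (lipschitz_part v - lipschitz_part w) \<le> lipschitz_bound * norm (v - w)"
proof -
  let ?v = "lookup (snd v)" and ?w = "lookup (snd w)"
  define M where "M = Max (insert \<mu> (\<nu> ` {1..m}))"
  define \<Lambda> where "\<Lambda> = L2_set (\<lambda>i. onorm (L i)) {1..m}"
  define S1 where "S1 = dh (fst v) - dh (fst w)"
  define S2 where "S2 = family {1..m} (\<lambda>i. dl i (?v i) - dl i (?w i))"
  define T1 where "T1 = adjoint_sum (\<lambda>i. ?v i - ?w i)"
  define T2 where "T2 = family {1..m} (\<lambda>i. L i (fst v - fst w))"
  have L: "L i (x - y) = L i x - L i y" if "i \<in> {1..m}" for i x y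
    using L_linear[OF that] by (simp add: bounded_linear.linear linear_diff)
  have M: "\<mu> \<le> M" "\<And>i. i \<in> {1..m} \<Longrightarrow> \<nu> i \<le> M" unfolding M_def by (rule Max_ge; simp)+
  have M0: "M \<ge> 0" using M(1) mu by simp
  have \<Lambda>0: "\<Lambda> \<ge> 0" by (simp add: \<Lambda>_def)
  have "v - w \<in> product_space" using subspace_product_space v w by (rule subspace_diff)
  then have keys: "Poly_Mapping.keys (snd v - snd w) \<subseteq> {1..m}"
    unfolding product_space_def direct_sum_def by (simp only: mem_Times_iff snd_diff mem_Collect_eq)
  have n2: "norm (snd v - snd w) = L2_set (\<lambda>i. norm (?v i - ?w i)) {1..m}"
    unfolding norm_poly_mapping_L2[OF finite_atLeastAtMost keys] by (simp only: lookup_minus)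
  have nfam: "norm (family {1..m} q) = L2_set (\<lambda>i. norm (q i)) {1..m}" for q :: "nat \<Rightarrow> 'g"
    by (subst norm_poly_mapping_L2[of "{1..m}"]) (auto simp: keys_family lookup_family intro!: L2_set_cong)
  have s1: "norm S1 \<le> M * norm (fst v - fst w)"
  proof -
    have "norm S1 \<le> \<mu> * norm (fst v - fst w)"
      using lipschitz_onD[OF h_lipschitz, of "fst v" "fst w"] by (simp add: S1_def dist_norm)
    also have "\<dots> \<le> M * norm (fst v - fst w)" using M by (intro mult_right_mono) auto
    finally show ?thesis .
  qed
  have s2: "norm S2 \<le> M * norm (snd v - snd w)"
  proof -
    have "norm S2 \<le> L2_set (\<lambda>i. M * norm (?v i - ?w i)) {1..m}"
      unfolding S2_def nfam
    proof (rule L2_set_mono)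
      fix i assume i: "i \<in> {1..m}"
      have "norm (dl i (?v i) - dl i (?w i)) \<le> \<nu> i * norm (?v i - ?w i)"
        by (intro dl_lipschitz lookup_in i v w)
      also have "\<dots> \<le> M * norm (?v i - ?w i)" using M(2)[OF i] by (intro mult_right_mono) auto
      finally show "norm (dl i (?v i) - dl i (?w i)) \<le> M * norm (?v i - ?w i)" .
    qed auto
    then show ?thesis unfolding n2 by (simp add: L2_set_right_distrib M0)
  qed
  have t1: "norm T1 \<le> \<Lambda> * norm (snd v - snd w)"
  proof -
    have "norm T1 \<le> (\<Sum>i=1..m. norm (adjoint (L i) (?v i - ?w i)))"
      unfolding T1_def by (rule norm_sum)
    also have "\<dots> \<le> (\<Sum>i=1..m. \<bar>onorm (L i)\<bar> * \<bar>norm (?v i - ?w i)\<bar>)"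
      by (intro sum_mono) (use norm_adjoint_le[OF L_linear] onorm_pos_le[OF L_linear] in auto)
    also have "\<dots> \<le> \<Lambda> * L2_set (\<lambda>i. norm (?v i - ?w i)) {1..m}"
      unfolding \<Lambda>_def by (rule L2_set_mult_ineq)
    finally show ?thesis unfolding n2 .
  qed
  have t2: "norm T2 \<le> \<Lambda> * norm (fst v - fst w)"
  proof -
    have "norm T2 \<le> L2_set (\<lambda>i. onorm (L i) * norm (fst v - fst w)) {1..m}"
      unfolding T2_def nfam by (intro L2_set_mono onorm L_linear) auto
    then show ?thesis unfolding \<Lambda>_def by (simp add: L2_set_left_distrib)
  qed
  have pair: "norm (a, b) \<le> c * norm (v - w)"
    if "norm a \<le> c * x" "norm b \<le> c * y" "c \<ge> 0" "x\<^sup>2 + y\<^sup>2 = (norm (v - w))\<^sup>2"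
    for a :: 'h and b :: "nat \<Rightarrow>\<^sub>0 'g" and c x y
  proof -
    have "(norm a)\<^sup>2 + (norm b)\<^sup>2 \<le> (c * x)\<^sup>2 + (c * y)\<^sup>2"
      using that by (intro add_mono power_mono) auto
    also have "\<dots> = (c * norm (v - w))\<^sup>2"
      unfolding power_mult_distrib that(4)[symmetric] by (simp add: distrib_left)
    finally show ?thesis using that(3) unfolding norm_Pair by (intro real_le_lsqrt) auto
  qed
  have pyth: "(norm (fst v - fst w))\<^sup>2 + (norm (snd v - snd w))\<^sup>2 = (norm (v - w))\<^sup>2"
    by (simp add: norm_prod_def)
  have "lipschitz_part v - lipschitz_part w = (S1, S2) + (T1, - T2)"
  proof (rule prod_eqI)
    show "fst (lipschitz_part v - lipschitz_part w) = fst ((S1, S2) + (T1, - T2))"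
      unfolding S1_def T1_def adjoint_sum_diff by (simp add: lipschitz_part_def)
    show "snd (lipschitz_part v - lipschitz_part w) = snd ((S1, S2) + (T1, - T2))"
      by (rule poly_mapping_eqI)
         (simp add: lipschitz_part_def S2_def T2_def lookup_family lookup_minus lookup_add L)
  qed
  then have "norm (lipschitz_part v - lipschitz_part w) \<le> norm (S1, S2) + norm (T1, - T2)" by (simp only: norm_triangle_ineq)
  also have "norm (S1, S2) \<le> M * norm (v - w)" by (rule pair[OF s1 s2 M0 pyth])
  also have "norm (T1, - T2) \<le> \<Lambda> * norm (v - w)"
    by (rule pair[where x = "norm (snd v - snd w)" and y = "norm (fst v - fst w)"])
       (use t1 t2 \<Lambda>0 pyth in auto)
  finally show ?thesis
    by (simp add: lipschitz_bound_def M_def \<Lambda>_def L2_set_def distrib_right)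
qed

lemma lipschitz_bound_pos: "lipschitz_bound > 0"
proof -
  have "\<mu> \<le> Max (insert \<mu> (\<nu> ` {1..m}))" by (intro Max_ge) auto
  moreover have "0 \<le> sqrt (\<Sum>i=1..m. (onorm (L i))\<^sup>2)" by (simp add: sum_nonneg)
  ultimately show ?thesis using mu unfolding lipschitz_bound_def by linarith
qed

sublocale monotone_lipschitz_inclusion product_space setvalued_part lipschitz_part lipschitz_bound
proof
  show "0 \<le> (x - y) \<bullet> (u - w)" if "x \<in> product_space" "y \<in> product_space" "u \<in> setvalued_part x" "w \<in> setvalued_part y" for x y u w
    by (rule setvalued_part_monotone) (fact that)+
  show "\<exists>p\<in>product_space. (1/t) *\<^sub>R (x - p) \<in> setvalued_part p" if "t > 0" "x \<in> product_space" for t x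
    by (rule setvalued_part_resolvent) (fact that)+
  show "lipschitz_part x \<in> product_space" if "x \<in> product_space" for x by (rule lipschitz_part_in) (fact that)
  show "0 \<le> (x - y) \<bullet> (lipschitz_part x - lipschitz_part y)" "norm (lipschitz_part x - lipschitz_part y) \<le> lipschitz_bound * norm (x - y)"
    if "x \<in> product_space" "y \<in> product_space" for x y
    by (rule lipschitz_part_monotone lipschitz_part_lipschitz, fact, fact)+
qed (fact subspace_product_space complete_product_space lipschitz_bound_pos)+

lemma zer_iff:
  "w \<in> zer \<longleftrightarrow> w \<in> product_space \<and> z - adjoint_sum (lookup (snd w)) - dh (fst w) \<in> df (fst w) \<and>
    (\<forall>i\<in>{1..m}. L i (fst w) - r i - dl i (lookup (snd w) i) \<in> dg i (lookup (snd w) i))"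
proof (cases "w \<in> product_space")
  case True
  have mem: "- lipschitz_part w \<in> product_space" using subspace_product_space lipschitz_part_in[OF True] by (rule subspace_neg)
  have 1: "fst (- lipschitz_part w) + z = z - adjoint_sum (lookup (snd w)) - dh (fst w)"
    by (simp add: lipschitz_part_def)
  have 2: "lookup (snd (- lipschitz_part w)) i - r i = L i (fst w) - r i - dl i (lookup (snd w) i)"
    if "i \<in> {1..m}" for i
    using that by (simp add: lipschitz_part_def lookup_family)
  have "(\<forall>i\<in>{1..m}. lookup (snd (- lipschitz_part w)) i - r i \<in> dg i (lookup (snd w) i)) \<longleftrightarrow>
      (\<forall>i\<in>{1..m}. L i (fst w) - r i - dl i (lookup (snd w) i) \<in> dg i (lookup (snd w) i))"
    by (rule ball_cong[OF refl]) (simp only: 2)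
  then show ?thesis unfolding zer_def setvalued_part_def by (simp only: mem_Collect_eq True mem 1 simp_thms)
next
  case False
  then show ?thesis by (simp add: zer_def)
qed

text \<open>
  A primal point in the range condition comes with \<open>v\<^sub>i \<in> (\<partial>g\<^sub>i \<box> \<partial>l\<^sub>i) (L\<^sub>i u - r\<^sub>i)\<close>, that is, with a
  splitting \<open>L\<^sub>i u - r\<^sub>i = a + b\<close> for which \<open>v\<^sub>i\<close> is a common subgradient. Inverting these subgradients gives
  \<open>a \<in> \<partial>g\<^sub>i\<^sup>* v\<^sub>i\<close> and \<open>b = \<nabla>l\<^sub>i\<^sup>* v\<^sub>i\<close>.
\<close>

lemma zer_nonempty:
  assumes "z \<in> (\<Union>u. df u + (\<Sum>i=1..m. adjoint (L i) `
      parallel_sum (G i) (subdifferential (G i) (g i)) (subdifferential (G i) (l i)) (L i u - r i)) + {dh u})"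
  shows "zer \<noteq> {}"
proof -
  let ?S = "\<lambda>u i. adjoint (L i) `
      parallel_sum (G i) (subdifferential (G i) (g i)) (subdifferential (G i) (l i)) (L i u - r i)"
  obtain u s t where u: "s \<in> df u" "t \<in> sum (?S u) {1..m}" "z = s + t + dh u"
    using assms by (auto elim!: set_plus_elim)
  then obtain q where q: "t = sum q {1..m}" "\<forall>i\<in>{1..m}. q i \<in> ?S u i"
    by (auto simp: set_sum_alt)
  have "\<exists>w. w \<in> parallel_sum (G i) (subdifferential (G i) (g i)) (subdifferential (G i) (l i)) (L i u - r i) \<and> q i = adjoint (L i) w"
    if "i \<in> {1..m}" for i using q(2) that by blast
  then obtain w where w: "\<And>i. i \<in> {1..m} \<Longrightarrow>
      w i \<in> parallel_sum (G i) (subdifferential (G i) (g i)) (subdifferential (G i) (l i)) (L i u - r i)"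
    and qw: "\<And>i. i \<in> {1..m} \<Longrightarrow> q i = adjoint (L i) (w i)" by metis
  have wG: "w i \<in> G i" if "i \<in> {1..m}" for i
    using w[OF that] by (simp add: parallel_sum_def op_inverse_def)
  have dual: "L i u - r i - dl i (w i) \<in> dg i (w i)" if i: "i \<in> {1..m}" for i
  proof -
    obtain a b where ab: "L i u - r i = a + b" "a \<in> G i" "w i \<in> subdifferential (G i) (g i) a"
      "b \<in> G i" "w i \<in> subdifferential (G i) (l i) b"
      using w[OF i] by (auto simp: parallel_sum_def op_inverse_def elim!: set_plus_elim)
    have "dl i (w i) = b"
      using grad_conjugate_unique[OF G(1)[OF i] G(2)[OF i] l[OF i] l_strong[OF i] _ wG[OF i] ab(4,5)] nu[OF i] by simp
    moreover have "a \<in> dg i (w i)" by (rule conjugate_subgradient[OF Gamma0_proper[OF g[OF i]] ab(2,3)])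
    ultimately show ?thesis using ab(1) by simp
  qed
  have "(u, family {1..m} w) \<in> zer"
    unfolding zer_iff
  proof (intro conjI)
    show "(u, family {1..m} w) \<in> product_space" using wG by (auto simp: product_space_def intro!: family_in_direct_sum)
    have "t = adjoint_sum (lookup (family {1..m} w))"
      unfolding q(1) by (rule sum.cong) (simp_all add: qw lookup_family)
    then have "z - adjoint_sum (lookup (family {1..m} w)) - dh u = s" using u(3) by simp
    then show "z - adjoint_sum (lookup (snd (u, family {1..m} w))) - dh (fst (u, family {1..m} w))
        \<in> df (fst (u, family {1..m} w))" using u(1) by simp
  qed (use dual in \<open>auto simp: lookup_family\<close>)
  then show ?thesis by blast
qed

context
  fixes xb :: 'h and vb :: "nat \<Rightarrow> 'g"
  assumes vb: "\<And>i. i \<in> {1..m} \<Longrightarrow> vb i \<in> G i"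
    and primal: "z - adjoint_sum vb - dh xb \<in> df xb"
    and dual: "\<And>i. i \<in> {1..m} \<Longrightarrow> L i xb - r i - dl i (vb i) \<in> dg i (vb i)"
begin

lemma primal_split_in: "i \<in> {1..m} \<Longrightarrow> L i xb - r i - dl i (vb i) \<in> G i"
  using dual[of i] by (simp add: subdifferential_def)

text \<open>
  At a zero, \<open>L\<^sub>i xb - r\<^sub>i\<close> splits into \<open>L\<^sub>i xb - r\<^sub>i - \<nabla>l\<^sub>i\<^sup>* v\<^sub>i\<close> and \<open>\<nabla>l\<^sub>i\<^sup>* v\<^sub>i\<close>, and \<open>v\<^sub>i\<close> is a
  common subgradient there; this makes the infimal convolution exact.
\<close>

lemma primal_split_subgradients:
  assumes i: "i \<in> {1..m}"
  shows "vb i \<in> subdifferential (G i) (g i) (L i xb - r i - dl i (vb i))"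
    and "vb i \<in> subdifferential (G i) (l i) (dl i (vb i))"
  using dual[OF i] dl_in[OF i vb[OF i]]
    subdifferential_conjugate_iff[OF G(1)[OF i] G(2)[OF i] g[OF i] primal_split_in[OF i] vb[OF i]]
    subdifferential_conjugate_iff[OF G(1)[OF i] G(2)[OF i] l[OF i] dl_mem[OF i vb[OF i]] vb[OF i]]
  by auto

text \<open>
  Every term of the objective has an affine minorant that is exact at \<open>xb\<close>, with slopes
  \<open>z - \<Sum>i L\<^sub>i\<^sup>* v\<^sub>i - \<nabla>h xb\<close>, \<open>L\<^sub>i\<^sup>* v\<^sub>i\<close>, \<open>\<nabla>h xb\<close> and \<open>- z\<close>; the slopes add up to zero.
\<close>

lemma kuhn_tucker_primal_solution: "primal_solution m G f h g l L r z xb"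
proof -
  let ?F = "real_of_ereal (f xb)" and ?u = "z - adjoint_sum vb - dh xb"
  define c where "c i = real_of_ereal (g i (L i xb - r i - dl i (vb i))) + real_of_ereal (l i (dl i (vb i)))" for i
  have inf_lower: "ereal (c i + (L i y - L i xb) \<bullet> vb i) \<le> infconv (G i) (g i) (l i) (L i y - r i)"
    and inf_eq: "infconv (G i) (g i) (l i) (L i xb - r i) = ereal (c i)" if i: "i \<in> {1..m}" for i y
  proof -
    note sub = Gamma0_proper[OF g[OF i]] Gamma0_proper[OF l[OF i]] G(1)[OF i] primal_split_in[OF i] primal_split_subgradients(1)[OF i]
      dl_mem[OF i vb[OF i]] primal_split_subgradients(2)[OF i]
    have "L i y - r i \<in> G i" using L_range[OF i] r[OF i] G(1)[OF i] by (simp add: subspace_diff)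
    from infconv_minorant[OF sub this] show "ereal (c i + (L i y - L i xb) \<bullet> vb i) \<le> infconv (G i) (g i) (l i) (L i y - r i)"
      by (simp add: c_def)
    from infconv_exact[OF sub] show "infconv (G i) (g i) (l i) (L i xb - r i) = ereal (c i)" by (simp add: c_def)
  qed
  have fx: "f xb = ereal ?F"
    using proper_on_finite(2)[OF Gamma0_proper[OF f] subdifferentialD(1)[OF Gamma0_proper[OF f] UNIV_I primal]] .
  have obj: "primal_objective m G f h g l L r z xb = ereal (?F + (\<Sum>i=1..m. c i) + h xb - xb \<bullet> z)"
    unfolding primal_objective_def by (subst fx) (simp add: inf_eq)
  have "ereal (?F + (\<Sum>i=1..m. c i) + h xb - xb \<bullet> z) \<le> primal_objective m G f h g l L r z y" for y
  proof -
    have h_le: "h xb + (y - xb) \<bullet> dh xb \<le> h y"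
      using dh_in[of xb] by (simp add: subdifferential_def add.commute)
    have "(y - xb) \<bullet> adjoint_sum vb = (\<Sum>i=1..m. (L i y - L i xb) \<bullet> vb i)"
      unfolding inner_adjoint_sum using L_linear by (intro sum.cong) (auto simp: bounded_linear.linear linear_diff)
    then have eq: "?F + (\<Sum>i=1..m. c i) + h xb - xb \<bullet> z
        = (?F + (y - xb) \<bullet> ?u) + (\<Sum>i=1..m. c i + (L i y - L i xb) \<bullet> vb i) + (h xb + (y - xb) \<bullet> dh xb) - y \<bullet> z"
      by (simp add: sum.distrib inner_diff_right inner_diff_left)
    have "ereal (?F + (y - xb) \<bullet> ?u) \<le> f y"
      by (rule subdifferential_minorant[OF Gamma0_proper[OF f] UNIV_I primal UNIV_I])
    moreover have "(\<Sum>i=1..m. ereal (c i + (L i y - L i xb) \<bullet> vb i)) \<le> (\<Sum>i=1..m. infconv (G i) (g i) (l i) (L i y - r i))"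
      by (intro sum_mono inf_lower)
    ultimately have "ereal (?F + (y - xb) \<bullet> ?u) + (\<Sum>i=1..m. ereal (c i + (L i y - L i xb) \<bullet> vb i)) + ereal (h xb + (y - xb) \<bullet> dh xb)
        \<le> f y + (\<Sum>i=1..m. infconv (G i) (g i) (l i) (L i y - r i)) + ereal (h y)"
      using h_le by (intro add_mono) auto
    then have "ereal (?F + (y - xb) \<bullet> ?u) + (\<Sum>i=1..m. ereal (c i + (L i y - L i xb) \<bullet> vb i)) + ereal (h xb + (y - xb) \<bullet> dh xb) - ereal (y \<bullet> z)
        \<le> primal_objective m G f h g l L r z y"
      unfolding primal_objective_def by (rule ereal_minus_mono) simp
    then show ?thesis unfolding eq by simp
  qed
  then show ?thesis
    unfolding primal_solution_def is_arg_min_def obj by (simp add: not_less)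
qed

text \<open>
  The same argument as for the primal problem, with roles exchanged: \<open>xb\<close> is a common subgradient of the
  conjugates of \<open>f\<close> and \<open>h\<close>, and the affine minorants of the terms have slopes that add up to zero.
\<close>

lemma kuhn_tucker_dual_solution: "dual_solution m G f h g l L r z vb"
proof -
  let ?u = "z - adjoint_sum vb - dh xb"
  let ?fs = "conjugate UNIV f" and ?hs = "conjugate UNIV (\<lambda>x. ereal (h x))"
  note K = subspace_UNIV complete_UNIV
  have hG: "(\<lambda>x. ereal (h x)) \<in> Gamma0 UNIV"
  proof -
    have "lsc_on UNIV (\<lambda>x. ereal (h x))"
    proof (rule lsc_onI)
      fix x and c assume c: "c < ereal (h x)"
      have "isCont h x" by (rule differentiable_imp_continuous_within[OF h_diff])
      then have "isCont (\<lambda>x. ereal (h x)) x" by (intro continuous_intros)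
      then have "\<forall>\<^sub>F y in at x. c < ereal (h y)"
        using c unfolding isCont_def by (rule order_tendstoD(1))
      then obtain d where "d > 0" "\<forall>y\<in>UNIV. y \<noteq> x \<and> dist y x < d \<longrightarrow> c < ereal (h y)"
        unfolding eventually_at by blast
      then show "\<exists>d>0. \<forall>y\<in>UNIV. dist y x < d \<longrightarrow> c < ereal (h y)" using c by (intro exI[of _ d]) auto
    qed
    moreover have "econvex_on UNIV (\<lambda>x. ereal (h x))"
      unfolding econvex_on_def
    proof (intro ballI allI impI)
      fix x y and \<alpha> :: real assume \<alpha>: "0 < \<alpha> \<and> \<alpha> < 1"
      show "ereal (h (\<alpha> *\<^sub>R x + (1 - \<alpha>) *\<^sub>R y)) \<le> ereal \<alpha> * ereal (h x) + ereal (1 - \<alpha>) * ereal (h y)"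
        using convex_onD[OF h_convex, of "1 - \<alpha>" x y] \<alpha> by simp
    qed
    ultimately show ?thesis using proper_h by (simp add: Gamma0_def proper_on_def)
  qed
  note pf = conjugate_proper[OF K f] and ph = conjugate_proper[OF K hG]
  have subf: "xb \<in> subdifferential UNIV ?fs ?u" by (rule conjugate_subgradient[OF Gamma0_proper[OF f] UNIV_I primal])
  have subh: "xb \<in> subdifferential UNIV ?hs (dh xb)" by (rule conjugate_subgradient[OF proper_h UNIV_I dh_in])
  define a where "a = real_of_ereal (?fs ?u) + real_of_ereal (?hs (dh xb))"
  have sum: "?u + dh xb = z - adjoint_sum vb" by simp
  note sub = pf ph subspace_UNIV UNIV_I subf UNIV_I subh
  have inf_lower: "ereal (a + (y - (z - adjoint_sum vb)) \<bullet> xb) \<le> infconv UNIV ?fs ?hs y" for y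
    using infconv_minorant[OF sub UNIV_I, of y] unfolding sum a_def .
  have inf_eq: "infconv UNIV ?fs ?hs (z - adjoint_sum vb) = ereal a"
    using infconv_exact[OF sub] unfolding sum a_def .
  define c where "c i = real_of_ereal (conjugate (G i) (g i) (vb i)) + real_of_ereal (conjugate (G i) (l i) (vb i))" for i
  have g_lower: "ereal (c i + (w - vb i) \<bullet> (L i xb - r i)) \<le> conjugate (G i) (g i) w + conjugate (G i) (l i) w"
    and g_eq: "conjugate (G i) (g i) (vb i) + conjugate (G i) (l i) (vb i) = ereal (c i)"
    if i: "i \<in> {1..m}" and w: "w \<in> G i" for i w
  proof -
    note pg = conjugate_proper[OF G(1)[OF i] G(2)[OF i] g[OF i]]
    note pl = conjugate_proper[OF G(1)[OF i] G(2)[OF i] l[OF i]]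
    have "ereal (real_of_ereal (conjugate (G i) (g i) (vb i)) + (w - vb i) \<bullet> (L i xb - r i - dl i (vb i)))
        + ereal (real_of_ereal (conjugate (G i) (l i) (vb i)) + (w - vb i) \<bullet> dl i (vb i))
        \<le> conjugate (G i) (g i) w + conjugate (G i) (l i) w"
      by (intro add_mono subdifferential_minorant[OF pg vb[OF i] dual[OF i] w]
          subdifferential_minorant[OF pl vb[OF i] dl_in[OF i vb[OF i]] w])
    then show "ereal (c i + (w - vb i) \<bullet> (L i xb - r i)) \<le> conjugate (G i) (g i) w + conjugate (G i) (l i) w"
      by (simp add: c_def inner_diff_right algebra_simps)
    have "ereal (real_of_ereal (conjugate (G i) (g i) (vb i))) + ereal (real_of_ereal (conjugate (G i) (l i) (vb i)))
       = conjugate (G i) (g i) (vb i) + conjugate (G i) (l i) (vb i)"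
      by (simp only: proper_on_finite(3)[OF pg subdifferentialD(1)[OF pg vb[OF i] dual[OF i]]]
          proper_on_finite(3)[OF pl subdifferentialD(1)[OF pl vb[OF i] dl_in[OF i vb[OF i]]]])
    then show "conjugate (G i) (g i) (vb i) + conjugate (G i) (l i) (vb i) = ereal (c i)"
      by (simp add: c_def)
  qed
  have obj: "dual_objective m G f h g l L r z vb = ereal (a + (\<Sum>i=1..m. c i + vb i \<bullet> r i))"
  proof -
    have "(\<Sum>i=1..m. conjugate (G i) (g i) (vb i) + conjugate (G i) (l i) (vb i) + ereal (vb i \<bullet> r i))
        = (\<Sum>i=1..m. ereal (c i + vb i \<bullet> r i))"
      by (rule sum.cong[OF refl]) (simp add: g_eq[OF _ vb])
    then show ?thesis unfolding dual_objective_def inf_eq by simp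
  qed
  have "ereal (a + (\<Sum>i=1..m. c i + vb i \<bullet> r i)) \<le> dual_objective m G f h g l L r z w"
    if w: "\<forall>i\<in>{1..m}. w i \<in> G i" for w
  proof -
    have "(z - adjoint_sum w - (z - adjoint_sum vb)) \<bullet> xb = - (xb \<bullet> adjoint_sum (\<lambda>i. w i - vb i))"
      unfolding adjoint_sum_diff by (simp add: inner_diff inner_commute)
    also have "\<dots> = - (\<Sum>i=1..m. (w i - vb i) \<bullet> L i xb)" unfolding inner_adjoint_sum by (simp add: inner_commute)
    finally have "a + (\<Sum>i=1..m. c i + vb i \<bullet> r i) = (a + (z - adjoint_sum w - (z - adjoint_sum vb)) \<bullet> xb)
        + (\<Sum>i=1..m. (c i + (w i - vb i) \<bullet> (L i xb - r i)) + w i \<bullet> r i)"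
      by (simp add: sum.distrib sum_subtractf inner_diff_right inner_diff_left)
    moreover have "ereal (a + (z - adjoint_sum w - (z - adjoint_sum vb)) \<bullet> xb)
        + (\<Sum>i=1..m. ereal (c i + (w i - vb i) \<bullet> (L i xb - r i)) + ereal (w i \<bullet> r i))
        \<le> dual_objective m G f h g l L r z w"
      unfolding dual_objective_def using w by (intro add_mono sum_mono inf_lower g_lower order_refl) auto
    ultimately show ?thesis by (simp add: add.assoc)
  qed
  then show ?thesis
    unfolding dual_solution_def is_arg_min_def obj using vb by (auto simp: not_less)
qed

end

text \<open>
  If \<open>u \<in> (A + B) w\<close>, the two residues are the subgradients of \<open>f\<close> and of the conjugates of the \<open>g\<^sub>i\<close> that
  occur in the components of \<open>u\<close>. For \<open>u = 0\<close> they are the subgradients in the optimality conditions.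
\<close>

definition primal_residue :: "'h \<times> (nat \<Rightarrow>\<^sub>0 'g) \<Rightarrow> 'h \<times> (nat \<Rightarrow>\<^sub>0 'g) \<Rightarrow> 'h" where
  "primal_residue w u = fst u + z - dh (fst w) - adjoint_sum (lookup (snd w))"

definition dual_residue :: "'h \<times> (nat \<Rightarrow>\<^sub>0 'g) \<Rightarrow> 'h \<times> (nat \<Rightarrow>\<^sub>0 'g) \<Rightarrow> nat \<Rightarrow> 'g" where
  "dual_residue w u i =
     lookup (snd u) i - r i - dl i (lookup (snd w) i) + L i (fst w)"

lemma residues_in:
  assumes U: "U - lipschitz_part P \<in> setvalued_part P"
  shows "primal_residue P U \<in> df (fst P)"
    and "\<And>i. i \<in> {1..m} \<Longrightarrow> dual_residue P U i \<in> dg i (lookup (snd P) i)"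
    and "fst (U - lipschitz_part P) + z = primal_residue P U"
    and "\<And>i. i \<in> {1..m} \<Longrightarrow> lookup (snd (U - lipschitz_part P)) i - r i = dual_residue P U i"
proof -
  show 1: "fst (U - lipschitz_part P) + z = primal_residue P U" by (simp add: lipschitz_part_def primal_residue_def)
  show 2: "lookup (snd (U - lipschitz_part P)) i - r i = dual_residue P U i" if "i \<in> {1..m}" for i
    using that by (simp add: lipschitz_part_def dual_residue_def lookup_minus lookup_family)
  show "primal_residue P U \<in> df (fst P)" using U unfolding setvalued_part_def 1[symmetric] by blast
  show "dual_residue P U i \<in> dg i (lookup (snd P) i)" if i: "i \<in> {1..m}" for i
    using U i unfolding setvalued_part_def 2[OF i, symmetric] by blast
qed

text \<open>
  The right-hand side is the sum over \<open>f\<close>, \<open>h\<close> and all \<open>g\<^sub>i\<^sup>*\<close>, \<open>l\<^sub>i\<^sup>*\<close> of the terms on the left, and each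
  of these is nonnegative by monotonicity.
\<close>

lemma residue_dissipation:
  assumes Xb: "Xb \<in> product_space" "V - lipschitz_part Xb \<in> setvalued_part Xb" and P: "P \<in> product_space" and U: "U - lipschitz_part P \<in> setvalued_part P"
  shows "(fst P - fst Xb) \<bullet> (primal_residue P U - primal_residue Xb V) \<le> (P - Xb) \<bullet> (U - V)"
    and "(fst P - fst Xb) \<bullet> (dh (fst P) - dh (fst Xb)) \<le> (P - Xb) \<bullet> (U - V)"
    and "\<And>i. i \<in> {1..m} \<Longrightarrow> (lookup (snd P) i - lookup (snd Xb) i) \<bullet>
         (dual_residue P U i - dual_residue Xb V i) \<le> (P - Xb) \<bullet> (U - V)"
    and "\<And>i. i \<in> {1..m} \<Longrightarrow> (lookup (snd P) i - lookup (snd Xb) i) \<bullet>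
         (dl i (lookup (snd P) i) - dl i (lookup (snd Xb) i)) \<le> (P - Xb) \<bullet> (U - V)"
proof -
  note p = residues_in[OF U] and x = residues_in[OF Xb(2)]
  define a where "a = (fst P - fst Xb) \<bullet> (primal_residue P U - primal_residue Xb V)"
  define b where "b = (fst P - fst Xb) \<bullet> (dh (fst P) - dh (fst Xb))"
  define c where "c i = (lookup (snd P) i - lookup (snd Xb) i) \<bullet>
         (dual_residue P U i - dual_residue Xb V i)" for i
  define d where "d i = (lookup (snd P) i - lookup (snd Xb) i) \<bullet>
         (dl i (lookup (snd P) i) - dl i (lookup (snd Xb) i))" for i
  have A: "(P - Xb) \<bullet> ((U - lipschitz_part P) - (V - lipschitz_part Xb)) = a + (\<Sum>i=1..m. c i)"
    unfolding setvalued_part_inner[OF P U Xb] p(3) x(3) a_def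
    by (intro arg_cong2[where f = "(+)"] sum.cong refl) (simp only: p(4) x(4) c_def)
  have B: "(P - Xb) \<bullet> (lipschitz_part P - lipschitz_part Xb) = b + (\<Sum>i=1..m. d i)"
    unfolding lipschitz_part_inner[OF P Xb(1)] b_def d_def by (rule refl)
  have "(P - Xb) \<bullet> (U - V) = (P - Xb) \<bullet> ((U - lipschitz_part P) - (V - lipschitz_part Xb)) + (P - Xb) \<bullet> (lipschitz_part P - lipschitz_part Xb)"
    by (simp add: inner_diff_right)
  then have total: "(P - Xb) \<bullet> (U - V) = (a + (\<Sum>i=1..m. c i)) + (b + (\<Sum>i=1..m. d i))"
    unfolding A B .
  have ab: "0 \<le> a" "0 \<le> b" unfolding a_def b_def by (rule df_monotone[OF p(1) x(1)] dh_monotone)+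
  have c: "0 \<le> c i" if "i \<in> {1..m}" for i
    unfolding c_def by (rule dg_monotone[OF that lookup_in[OF P that] lookup_in[OF Xb(1) that] p(2)[OF that] x(2)[OF that]])
  have d: "0 \<le> d i" if "i \<in> {1..m}" for i
    unfolding d_def by (rule dl_monotone[OF that lookup_in[OF P that] lookup_in[OF Xb(1) that]])
  have sums: "0 \<le> (\<Sum>i=1..m. c i)" "0 \<le> (\<Sum>i=1..m. d i)" using c d by (auto intro: sum_nonneg)
  have single: "c i \<le> (\<Sum>i=1..m. c i)" "d i \<le> (\<Sum>i=1..m. d i)" if "i \<in> {1..m}" for i
    by (rule member_le_sum[OF that]; use c d in auto)+
  show "(fst P - fst Xb) \<bullet> (primal_residue P U - primal_residue Xb V) \<le> (P - Xb) \<bullet> (U - V)"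
    unfolding total a_def[symmetric] using ab sums by linarith
  show "(fst P - fst Xb) \<bullet> (dh (fst P) - dh (fst Xb)) \<le> (P - Xb) \<bullet> (U - V)"
    unfolding total b_def[symmetric] using ab sums by linarith
  fix i assume i: "i \<in> {1..m}"
  show "(lookup (snd P) i - lookup (snd Xb) i) \<bullet>
         (dual_residue P U i - dual_residue Xb V i) \<le> (P - Xb) \<bullet> (U - V)"
    unfolding total c_def[symmetric] using ab sums single(1)[OF i] by linarith
  show "(lookup (snd P) i - lookup (snd Xb) i) \<bullet>
         (dl i (lookup (snd P) i) - dl i (lookup (snd Xb) i)) \<le> (P - Xb) \<bullet> (U - V)"
    unfolding total d_def[symmetric] using ab sums single(2)[OF i] by linarith
qed

end

section \<open>Convergence of the primal-dual method\<close>

theorem theorem4p2: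
  fixes z :: "'h::{real_inner, banach}"
    and m :: nat
    and f :: "'h \<Rightarrow> ereal" and h :: "'h \<Rightarrow> real" and \<mu> :: real
    and G :: "nat \<Rightarrow> 'g::{real_inner, banach} set"
    and r :: "nat \<Rightarrow> 'g"
    and g l :: "nat \<Rightarrow> 'g \<Rightarrow> ereal" and \<nu> :: "nat \<Rightarrow> real"
    and L :: "nat \<Rightarrow> 'h \<Rightarrow> 'g"
    and a1 b1 c1 :: "nat \<Rightarrow> 'h"
    and a2 b2 c2 :: "nat \<Rightarrow> nat \<Rightarrow> 'g"
    and \<beta> \<epsilon> :: real and \<gamma> :: "nat \<Rightarrow> real"
    and x0 :: 'h and v0 :: "nat \<Rightarrow> 'g"
    and x y1 p1 q1 :: "nat \<Rightarrow> 'h"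
    and v y2 p2 q2 :: "nat \<Rightarrow> nat \<Rightarrow> 'g"
  assumes m: "m \<ge> 1"
    and f: "f \<in> Gamma0 UNIV"
    and h_convex: "convex_on UNIV h"
    and h_diff: "\<And>u. h differentiable (at u)"
    and mu: "\<mu> > 0"
    and h_lipschitz: "\<mu>-lipschitz_on UNIV (gradient UNIV h)"
    and G: "\<And>i. i \<in> {1..m} \<Longrightarrow> subspace (G i) \<and> closed (G i)"
    and r: "\<And>i. i \<in> {1..m} \<Longrightarrow> r i \<in> G i"
    and g: "\<And>i. i \<in> {1..m} \<Longrightarrow> g i \<in> Gamma0 (G i)"
    and l: "\<And>i. i \<in> {1..m} \<Longrightarrow> l i \<in> Gamma0 (G i)"
    and nu: "\<And>i. i \<in> {1..m} \<Longrightarrow> \<nu> i > 0"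
    and l_strong: "\<And>i. i \<in> {1..m} \<Longrightarrow> strongly_convex_on (G i) (1 / \<nu> i) (l i)"
    and L: "\<And>i. i \<in> {1..m} \<Longrightarrow> bounded_linear (L i) \<and> range (L i) \<subseteq> G i \<and> L i \<noteq> (\<lambda>_. 0)"
    and z: "z \<in> (\<Union>u. subdifferential UNIV f u
              + (\<Sum>i=1..m. adjoint (L i) `
                  parallel_sum (G i) (subdifferential (G i) (g i)) (subdifferential (G i) (l i)) (L i u - r i))
              + {gradient UNIV h u})"
    and a1: "summable (\<lambda>n. norm (a1 n))"
    and b1: "summable (\<lambda>n. norm (b1 n))"
    and c1: "summable (\<lambda>n. norm (c1 n))"
    and a2: "\<And>i. i \<in> {1..m} \<Longrightarrow> range (a2 i) \<subseteq> G i \<and> summable (\<lambda>n. norm (a2 i n))"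
    and b2: "\<And>i. i \<in> {1..m} \<Longrightarrow> range (b2 i) \<subseteq> G i \<and> summable (\<lambda>n. norm (b2 i n))"
    and c2: "\<And>i. i \<in> {1..m} \<Longrightarrow> range (c2 i) \<subseteq> G i \<and> summable (\<lambda>n. norm (c2 i n))"
    and beta: "\<beta> = Max (insert \<mu> (\<nu> ` {1..m})) + sqrt (\<Sum>i=1..m. (onorm (L i))\<^sup>2)"
    and v0: "\<And>i. i \<in> {1..m} \<Longrightarrow> v0 i \<in> G i"
    and eps: "\<epsilon> \<in> {0<..<1 / (\<beta> + 1)}"
    and gamma: "\<And>n. \<gamma> n \<in> {\<epsilon>..(1 - \<epsilon>) / \<beta>}"
    and x_0: "x 0 = x0"
    and v_0: "\<And>i. i \<in> {1..m} \<Longrightarrow> v i 0 = v0 i"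
    and y1: "\<And>n. y1 n = x n - \<gamma> n *\<^sub>R (gradient UNIV h (x n) + (\<Sum>i=1..m. adjoint (L i) (v i n)) + a1 n)"
    and p1: "\<And>n. p1 n = prox UNIV (\<lambda>u. ereal (\<gamma> n) * f u) (y1 n + \<gamma> n *\<^sub>R z) + b1 n"
    and y2: "\<And>i n. i \<in> {1..m} \<Longrightarrow>
               y2 i n = v i n + \<gamma> n *\<^sub>R (L i (x n) - grad_conjugate (G i) (l i) (v i n) + a2 i n)"
    and p2: "\<And>i n. i \<in> {1..m} \<Longrightarrow>
               p2 i n = prox (G i) (\<lambda>w. ereal (\<gamma> n) * conjugate (G i) (g i) w) (y2 i n - \<gamma> n *\<^sub>R r i) + b2 i n"
    and q2: "\<And>i n. i \<in> {1..m} \<Longrightarrow>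
               q2 i n = p2 i n + \<gamma> n *\<^sub>R (L i (p1 n) - grad_conjugate (G i) (l i) (p2 i n) + c2 i n)"
    and v_Suc: "\<And>i n. i \<in> {1..m} \<Longrightarrow> v i (Suc n) = v i n - y2 i n + q2 i n"
    and q1: "\<And>n. q1 n = p1 n - \<gamma> n *\<^sub>R (gradient UNIV h (p1 n) + (\<Sum>i=1..m. adjoint (L i) (p2 i n)) + c1 n)"
    and x_Suc: "\<And>n. x (Suc n) = x n - y1 n + q1 n"
  shows "summable (\<lambda>n. (norm (x n - p1 n))\<^sup>2) \<and>
         (\<forall>i\<in>{1..m}. summable (\<lambda>n. (norm (v i n - p2 i n))\<^sup>2)) \<and>
         (\<exists>xb vb.
            primal_solution m G f h g l L r z xb \<and>
            dual_solution m G f h g l L r z vb \<and>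
            z - (\<Sum>j=1..m. adjoint (L j) (vb j)) \<in> subdifferential UNIV f xb + {gradient UNIV h xb} \<and>
            (\<forall>i\<in>{1..m}. L i xb - r i
               \<in> subdifferential (G i) (conjugate (G i) (g i)) (vb i) + {grad_conjugate (G i) (l i) (vb i)}) \<and>
            weakly_tendsto UNIV x xb \<and> weakly_tendsto UNIV p1 xb \<and>
            (\<forall>i\<in>{1..m}. weakly_tendsto (G i) (v i) (vb i) \<and> weakly_tendsto (G i) (p2 i) (vb i)) \<and>
            (uniformly_convex_at UNIV f xb \<or> uniformly_convex_at UNIV (\<lambda>u. ereal (h u)) xb
               \<longrightarrow> x \<longlonglongrightarrow> xb \<and> p1 \<longlonglongrightarrow> xb) \<and>
            (\<forall>i\<in>{1..m}. uniformly_convex_at (G i) (conjugate (G i) (g i)) (vb i) \<or>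
                         uniformly_convex_at (G i) (conjugate (G i) (l i)) (vb i)
               \<longrightarrow> v i \<longlonglongrightarrow> vb i \<and> p2 i \<longlonglongrightarrow> vb i))"
proof -
  interpret pd: primal_dual_problem z m f h \<mu> G r g l \<nu> L
  proof (rule primal_dual_problem.intro)
    fix i assume i: "i \<in> {1..m}"
    show "subspace (G i)" "complete (G i)" using G[OF i] by (simp_all add: complete_eq_closed)
    show "r i \<in> G i" by (rule r[OF i])
    show "g i \<in> Gamma0 (G i)" by (rule g[OF i])
    show "l i \<in> Gamma0 (G i)" by (rule l[OF i])
    show "\<nu> i > 0" by (rule nu[OF i])
    show "strongly_convex_on (G i) (1 / \<nu> i) (l i)" by (rule l_strong[OF i])
    show "bounded_linear (L i)" using L[OF i] by simp
    show "L i x \<in> G i" for x using L[OF i] by blast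
  qed (rule f h_convex h_diff mu h_lipschitz)+
  let ?I = "{1..m}"
  have I: "finite ?I" by simp
  note lookup = lookup_family[OF finite_atLeastAtMost]
  have b0: "pd.lipschitz_bound = \<beta>" using beta by (simp add: pd.lipschitz_bound_def)
  have \<beta>: "\<beta> > 0" using pd.lipschitz_bound_pos b0 by simp
  have eps': "0 < \<epsilon>" "\<epsilon> < 1"
  proof -
    have "1 / (\<beta> + 1) < 1" using \<beta> by simp
    then show "0 < \<epsilon>" "\<epsilon> < 1" using eps by auto
  qed
  have gam: "\<epsilon> \<le> \<gamma> n" "\<gamma> n \<le> (1 - \<epsilon>) / \<beta>" "\<gamma> n > 0" for n using gamma[of n] eps' by auto
  define P1 where "P1 n = prox UNIV (\<lambda>u. ereal (\<gamma> n) * f u) (y1 n + \<gamma> n *\<^sub>R z)" for n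
  define P2 where "P2 i n = prox (G i) (\<lambda>w. ereal (\<gamma> n) * conjugate (G i) (g i) w) (y2 i n - \<gamma> n *\<^sub>R r i)" for i n
  have P1: "(1 / \<gamma> n) *\<^sub>R (y1 n + \<gamma> n *\<^sub>R z - P1 n) \<in> subdifferential UNIV f (P1 n)" for n
    unfolding P1_def using prox_Gamma0[OF subspace_UNIV complete_UNIV f gam(3) UNIV_I] by blast
  have mem: "v i n \<in> G i \<and> y2 i n \<in> G i \<and> P2 i n \<in> G i \<and> p2 i n \<in> G i" if i: "i \<in> ?I" for i n
  proof -
    have sub: "subspace (G i)" "complete (G i)" using pd.G[OF i] by auto
    have Lx: "L i x \<in> G i" for x by (rule pd.L_range[OF i])
    have err: "a2 i n \<in> G i" "b2 i n \<in> G i" "c2 i n \<in> G i" for n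
      using a2[OF i] b2[OF i] c2[OF i] by auto
    have step: "y2 i n \<in> G i \<and> P2 i n \<in> G i \<and> p2 i n \<in> G i" if v: "v i n \<in> G i" for n
    proof -
      have y: "y2 i n \<in> G i" unfolding y2[OF i]
        by (intro subspace_add[OF sub(1)] subspace_diff[OF sub(1)] subspace_scale[OF sub(1)] v Lx err pd.dl_mem[OF i])
      have "y2 i n - \<gamma> n *\<^sub>R r i \<in> G i"
        by (intro subspace_diff[OF sub(1)] subspace_scale[OF sub(1)] y r[OF i])
      then have P: "P2 i n \<in> G i" unfolding P2_def using prox_conjugate[OF sub g[OF i] gam(3)] by blast
      have "p2 i n \<in> G i" unfolding p2[OF i] P2_def[symmetric] by (intro subspace_add[OF sub(1)] P err)
      then show ?thesis using y P by blast
    qed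
    have "v i n \<in> G i" for n
    proof (induction n)
      case 0
      then show ?case using v_0[OF i] v0[OF i] by simp
    next
      case (Suc n)
      have "y2 i n \<in> G i" "p2 i n \<in> G i" using step[OF Suc] by auto
      then show ?case unfolding v_Suc[OF i] q2[OF i]
        by (intro subspace_add[OF sub(1)] subspace_diff[OF sub(1)] subspace_scale[OF sub(1)] Suc Lx err pd.dl_mem[OF i])
    qed
    then show ?thesis using step by blast
  qed
  have P2: "(1 / \<gamma> n) *\<^sub>R (y2 i n - \<gamma> n *\<^sub>R r i - P2 i n) \<in> subdifferential (G i) (conjugate (G i) (g i)) (P2 i n)"
    if i: "i \<in> ?I" for i n
  proof -
    have "y2 i n - \<gamma> n *\<^sub>R r i \<in> G i"
      using mem[OF i, of n] r[OF i] pd.G(1)[OF i] by (auto intro: subspace_diff subspace_scale)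
    then show ?thesis unfolding P2_def using prox_conjugate[OF pd.G(1)[OF i] pd.G(2)[OF i] g[OF i] gam(3)] by blast
  qed
  define X where "X n = (x n, family ?I (\<lambda>i. v i n))" for n
  define Y where "Y n = (y1 n, family ?I (\<lambda>i. y2 i n))" for n
  define Pn where "Pn n = (p1 n, family ?I (\<lambda>i. p2 i n))" for n
  define Q where "Q n = (q1 n, family ?I (\<lambda>i. q2 i n))" for n
  \<comment> \<open>The dual components of \<open>B\<close> enter the algorithm with the opposite sign, hence the signs of these errors.\<close>
  define ea where "ea n = (a1 n, family ?I (\<lambda>i. - a2 i n))" for n
  define eb where "eb n = (b1 n, family ?I (\<lambda>i. b2 i n))" for n
  define ec where "ec n = (c1 n, family ?I (\<lambda>i. - c2 i n))" for n
  note defs = X_def Y_def Pn_def Q_def ea_def eb_def ec_def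
  have product_space: "X n \<in> pd.product_space" "Y n \<in> pd.product_space" "Pn n \<in> pd.product_space" "eb n \<in> pd.product_space" for n
    using mem b2 by (auto simp: pd.product_space_def defs image_subset_iff intro!: family_in_direct_sum)
  have Pb: "Pn n - eb n = (P1 n, family ?I (\<lambda>i. P2 i n))" for n
  proof (rule prod_eqI)
    show "fst (Pn n - eb n) = fst (P1 n, family ?I (\<lambda>i. P2 i n))"
      by (simp add: defs p1 P1_def)
    show "snd (Pn n - eb n) = snd (P1 n, family ?I (\<lambda>i. P2 i n))"
      by (rule poly_mapping_eqI) (simp add: defs lookup lookup_minus p2 P2_def)
  qed
  have fbf: "summable (\<lambda>n. (norm (X n - Pn n))\<^sup>2) \<and>
    (\<exists>xb P U. xb \<in> pd.zer \<and> weakly_tendsto pd.product_space X xb \<and> weakly_tendsto pd.product_space Pn xb \<and>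
           (\<forall>n. P n \<in> pd.product_space \<and> U n - pd.lipschitz_part (P n) \<in> pd.setvalued_part (P n)) \<and> U \<longlonglongrightarrow> 0 \<and>
           (\<lambda>n. P n - X n) \<longlonglongrightarrow> 0 \<and> (\<lambda>n. P n - Pn n) \<longlonglongrightarrow> 0 \<and> bounded (range P))"
  proof (rule pd.forward_backward_forward_weak_convergence[where \<epsilon> = \<epsilon> and \<gamma> = \<gamma> and a = ea and b = eb and c = ec and y = Y and q = Q])
    show "pd.zer \<noteq> {}" by (rule pd.zer_nonempty[OF z])
    show "summable (\<lambda>n. norm (ea n))" "summable (\<lambda>n. norm (eb n))" "summable (\<lambda>n. norm (ec n))"
      unfolding defs using a1 a2 b1 b2 c1 c2 by (intro summable_norm_Pair_family I; simp)+
    show "Y n = X n - \<gamma> n *\<^sub>R (pd.lipschitz_part (X n) + ea n)" for n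
    proof (rule prod_eqI)
      have "pd.adjoint_sum (lookup (family ?I (\<lambda>i. v i n))) = (\<Sum>i=1..m. adjoint (L i) (v i n))"
        by (rule sum.cong[OF refl]) (simp only: lookup if_True)
      then show "fst (Y n) = fst (X n - \<gamma> n *\<^sub>R (pd.lipschitz_part (X n) + ea n))"
        by (simp only: defs pd.lipschitz_part_def fst_conv snd_conv fst_diff fst_scaleR fst_add y1)
      show "snd (Y n) = snd (X n - \<gamma> n *\<^sub>R (pd.lipschitz_part (X n) + ea n))"
        by (rule poly_mapping_eqI)
           (simp add: defs pd.lipschitz_part_def lookup lookup_minus lookup_scaleR lookup_add y2 algebra_simps)
    qed
    show "Q n = Pn n - \<gamma> n *\<^sub>R (pd.lipschitz_part (Pn n) + ec n)" for n
    proof (rule prod_eqI)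
      have "pd.adjoint_sum (lookup (family ?I (\<lambda>i. p2 i n))) = (\<Sum>i=1..m. adjoint (L i) (p2 i n))"
        by (rule sum.cong[OF refl]) (simp only: lookup if_True)
      then show "fst (Q n) = fst (Pn n - \<gamma> n *\<^sub>R (pd.lipschitz_part (Pn n) + ec n))"
        by (simp only: defs pd.lipschitz_part_def fst_conv snd_conv fst_diff fst_scaleR fst_add q1)
      show "snd (Q n) = snd (Pn n - \<gamma> n *\<^sub>R (pd.lipschitz_part (Pn n) + ec n))"
        by (rule poly_mapping_eqI)
           (simp add: defs pd.lipschitz_part_def lookup lookup_minus lookup_scaleR lookup_add q2 algebra_simps)
    qed
    show "X (Suc n) = X n - Y n + Q n" for n
    proof (rule prod_eqI)
      show "fst (X (Suc n)) = fst (X n - Y n + Q n)" by (simp add: defs x_Suc)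
      show "snd (X (Suc n)) = snd (X n - Y n + Q n)"
        by (rule poly_mapping_eqI) (simp add: defs lookup lookup_minus lookup_add v_Suc)
    qed
    show "(1 / \<gamma> n) *\<^sub>R (Y n - (Pn n - eb n)) \<in> pd.setvalued_part (Pn n - eb n)" for n
      unfolding Pb
    proof (rule pd.setvalued_part_resolventI[OF gam(3) product_space(2)])
      show "(P1 n, family ?I (\<lambda>i. P2 i n)) \<in> pd.product_space"
        using mem by (auto simp: pd.product_space_def intro!: family_in_direct_sum)
      show "(1 / \<gamma> n) *\<^sub>R (fst (Y n) + \<gamma> n *\<^sub>R z - fst (P1 n, family ?I (\<lambda>i. P2 i n)))
          \<in> subdifferential UNIV f (fst (P1 n, family ?I (\<lambda>i. P2 i n)))"
        using P1 by (simp add: Y_def)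
      show "(1 / \<gamma> n) *\<^sub>R (lookup (snd (Y n)) i - \<gamma> n *\<^sub>R r i
            - lookup (snd (P1 n, family ?I (\<lambda>i. P2 i n))) i)
          \<in> subdifferential (G i) (conjugate (G i) (g i)) (lookup (snd (P1 n, family ?I (\<lambda>i. P2 i n))) i)"
        if "i \<in> ?I" for i
        using P2[OF that, of n] that by (simp only: Y_def snd_conv lookup if_True)
    qed
  qed (use eps' gam product_space in \<open>simp_all add: b0\<close>)
  obtain Xb P U where zb: "Xb \<in> pd.zer" and weak: "weakly_tendsto pd.product_space X Xb" "weakly_tendsto pd.product_space Pn Xb"
    and PU: "\<And>n. P n \<in> pd.product_space" "\<And>n. U n - pd.lipschitz_part (P n) \<in> pd.setvalued_part (P n)" "U \<longlonglongrightarrow> 0"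
    and PX: "(\<lambda>n. P n - X n) \<longlonglongrightarrow> 0" "(\<lambda>n. P n - Pn n) \<longlonglongrightarrow> 0" and bdd: "bounded (range P)"
    using fbf by blast
  define xb where "xb = fst Xb"
  define vb where "vb = lookup (snd Xb)"
  note zb' = zb[unfolded pd.zer_iff, folded xb_def vb_def]
  have XbK: "Xb \<in> pd.product_space" "0 - pd.lipschitz_part Xb \<in> pd.setvalued_part Xb" using zb by (auto simp: pd.zer_def)
  have vb: "vb i \<in> G i" if "i \<in> ?I" for i using pd.lookup_in[OF XbK(1) that] by (simp only: vb_def)
  have kt1: "z - (\<Sum>j=1..m. adjoint (L j) (vb j)) - gradient UNIV h xb \<in> subdifferential UNIV f xb"
    using zb' by blast
  have kt2: "L i xb - r i - grad_conjugate (G i) (l i) (vb i) \<in> subdifferential (G i) (conjugate (G i) (g i)) (vb i)"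
    if "i \<in> ?I" for i using zb' that by blast
  have x_weak: "weakly_tendsto UNIV x xb" "weakly_tendsto UNIV p1 xb"
  proof -
    \<comment> \<open>Weak convergence of a component is tested with vectors that vanish in all other components.\<close>
    have "(u, 0) \<in> pd.product_space" for u
      using pd.G(1) by (auto simp: pd.product_space_def intro!: subspace_0 subspace_direct_sum)
    then show "weakly_tendsto UNIV x xb" "weakly_tendsto UNIV p1 xb"
      using weak unfolding weakly_tendsto_def xb_def X_def Pn_def inner_prod_def by force+
  qed
  have v_weak: "weakly_tendsto (G i) (v i) (vb i)" "weakly_tendsto (G i) (p2 i) (vb i)" if i: "i \<in> ?I" for i
  proof -
    have K: "(0, Poly_Mapping.single i u) \<in> pd.product_space" if "u \<in> G i" for u
      using that i pd.G(1) by (auto simp: pd.product_space_def direct_sum_def lookup_single when_def subspace_0)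
    show "weakly_tendsto (G i) (v i) (vb i)" unfolding weakly_tendsto_def
    proof
      fix u assume "u \<in> G i"
      from weak(1)[unfolded weakly_tendsto_def, rule_format, OF K[OF this]]
      show "(\<lambda>n. v i n \<bullet> u) \<longlonglongrightarrow> vb i \<bullet> u"
        using i by (simp add: X_def inner_prod_def inner_single vb_def lookup)
    qed
    show "weakly_tendsto (G i) (p2 i) (vb i)" unfolding weakly_tendsto_def
    proof
      fix u assume "u \<in> G i"
      from weak(2)[unfolded weakly_tendsto_def, rule_format, OF K[OF this]]
      show "(\<lambda>n. p2 i n \<bullet> u) \<longlonglongrightarrow> vb i \<bullet> u"
        using i by (simp add: Pn_def inner_prod_def inner_single vb_def lookup)
    qed
  qed
  have sum1: "summable (\<lambda>n. (norm (x n - p1 n))\<^sup>2)"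
    by (rule summable_power2_comparison[OF conjunct1[OF fbf]]) (simp only: X_def Pn_def diff_Pair norm_fst_le)
  have sum2: "summable (\<lambda>n. (norm (v i n - p2 i n))\<^sup>2)" if i: "i \<in> ?I" for i
    by (rule summable_power2_comparison[OF conjunct1[OF fbf]])
       (use norm_lookup_snd_le[of "X _ - Pn _" i] i in \<open>simp add: X_def Pn_def lookup lookup_minus\<close>)
  \<comment> \<open>The residual of the zero \<open>Xb\<close> is \<open>0\<close>.\<close>
  define t where "t n = (P n - Xb) \<bullet> (U n - 0)" for n
  obtain M where M: "\<And>n. norm (P n) \<le> M" using bdd by (auto simp: bounded_iff)
  have t0: "t \<longlonglongrightarrow> 0"
  proof (rule Lim_null_comparison)
    have "norm (t n) \<le> (M + norm Xb) * norm (U n)" for n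
    proof -
      have "norm (t n) \<le> norm (P n - Xb) * norm (U n)" unfolding t_def by (simp add: Cauchy_Schwarz_ineq2)
      also have "\<dots> \<le> (M + norm Xb) * norm (U n)"
        using norm_triangle_ineq4[of "P n" Xb] M[of n] by (intro mult_right_mono) auto
      finally show ?thesis .
    qed
    then show "\<forall>\<^sub>F n in sequentially. norm (t n) \<le> (M + norm Xb) * norm (U n)" by simp
    show "(\<lambda>n. (M + norm Xb) * norm (U n)) \<longlonglongrightarrow> 0"
      using tendsto_mult_right_zero[OF tendsto_norm_zero[OF PU(3)]] .
  qed
  note diss = pd.residue_dissipation[OF XbK PU(1,2), folded t_def xb_def vb_def]
  have x_strong: "x \<longlonglongrightarrow> xb \<and> p1 \<longlonglongrightarrow> xb"
    if uc: "uniformly_convex_at UNIV f xb \<or> uniformly_convex_at UNIV (\<lambda>u. ereal (h u)) xb"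
  proof -
    have lim: "(\<lambda>n. fst (P n)) \<longlonglongrightarrow> xb"
      using uc
    proof
      assume uc: "uniformly_convex_at UNIV f xb"
      show ?thesis
        by (rule uniformly_convex_strong_convergence[OF Gamma0_proper[OF f] subspace_UNIV uc
              pd.residues_in(1)[OF XbK(2), folded xb_def] UNIV_I pd.residues_in(1)[OF PU(2)] diss(1) t0])
    next
      assume uc: "uniformly_convex_at UNIV (\<lambda>u. ereal (h u)) xb"
      show ?thesis
        by (rule uniformly_convex_strong_convergence[OF pd.proper_h subspace_UNIV uc pd.dh_in UNIV_I pd.dh_in diss(2) t0])
    qed
    have "(\<lambda>n. fst (P n) - x n) \<longlonglongrightarrow> 0" "(\<lambda>n. fst (P n) - p1 n) \<longlonglongrightarrow> 0"
      using tendsto_fst[OF PX(1)] tendsto_fst[OF PX(2)] by (simp_all add: X_def Pn_def)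
    from tendsto_diff[OF lim this(1)] tendsto_diff[OF lim this(2)] show ?thesis by simp
  qed
  have v_strong: "v i \<longlonglongrightarrow> vb i \<and> p2 i \<longlonglongrightarrow> vb i"
    if i: "i \<in> ?I" and uc: "uniformly_convex_at (G i) (conjugate (G i) (g i)) (vb i) \<or>
      uniformly_convex_at (G i) (conjugate (G i) (l i)) (vb i)" for i
  proof -
    let ?P = "\<lambda>n. lookup (snd (P n)) i"
    have PG: "?P n \<in> G i" for n by (rule pd.lookup_in[OF PU(1) i])
    note sub = pd.G(1)[OF i] pd.G(2)[OF i]
    have lim: "?P \<longlonglongrightarrow> vb i"
      using uc
    proof
      assume uc: "uniformly_convex_at (G i) (conjugate (G i) (g i)) (vb i)"
      show ?thesis
        by (rule uniformly_convex_strong_convergence[OF conjugate_proper[OF sub g[OF i]] sub(1) uc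
              pd.residues_in(2)[OF XbK(2) i, folded vb_def] PG pd.residues_in(2)[OF PU(2) i] diss(3)[OF i] t0])
    next
      assume uc: "uniformly_convex_at (G i) (conjugate (G i) (l i)) (vb i)"
      show ?thesis
        by (rule uniformly_convex_strong_convergence[OF conjugate_proper[OF sub l[OF i]] sub(1) uc
              pd.dl_in[OF i vb[OF i]] PG pd.dl_in[OF i PG] diss(4)[OF i] t0])
    qed
    have "(\<lambda>n. ?P n - v i n) \<longlonglongrightarrow> 0" "(\<lambda>n. ?P n - p2 i n) \<longlonglongrightarrow> 0"
      using tendsto_lookup[OF tendsto_snd[OF PX(1)], of i] tendsto_lookup[OF tendsto_snd[OF PX(2)], of i] i
      by (simp_all add: X_def Pn_def lookup lookup_minus)
    from tendsto_diff[OF lim this(1)] tendsto_diff[OF lim this(2)] show ?thesis by simp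
  qed
  have kt1': "z - (\<Sum>j=1..m. adjoint (L j) (vb j)) \<in> subdifferential UNIV f xb + {gradient UNIV h xb}"
    using set_plus_intro[OF kt1 singletonI[of "gradient UNIV h xb"]] by simp
  have kt2': "L i xb - r i \<in> subdifferential (G i) (conjugate (G i) (g i)) (vb i) + {grad_conjugate (G i) (l i) (vb i)}"
    if "i \<in> ?I" for i
    using set_plus_intro[OF kt2[OF that] singletonI[of "grad_conjugate (G i) (l i) (vb i)"]] by simp
  have sols: "primal_solution m G f h g l L r z xb" "dual_solution m G f h g l L r z vb"
    using pd.kuhn_tucker_primal_solution[OF vb kt1 kt2] pd.kuhn_tucker_dual_solution[OF vb kt1 kt2] by simp_all
  show ?thesis
    by (intro conjI exI[of _ xb] exI[of _ vb] ballI impI;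
        rule sum1 sum2 sols kt1' kt2' x_weak v_weak conjunct1[OF x_strong] conjunct2[OF x_strong]
          conjunct1[OF v_strong] conjunct2[OF v_strong]; assumption)
qed

end
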